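(* Let $d\geq 1$, let $v=(v_1,\dots,v_d)\in\mathbf{R}^d$ satisfy $v_j\neq 0$ for $1\leq j\leq d$, and let $p(\xi)=\sum_{j=1}^d p_j(\xi_j)$, $\xi\in\mathbf{R}^d$, where $p_j(\xi_j)=\sum_{k=0}^{m_j}c_{j,k}\xi_j^k$ with $c_{j,k}\in\mathbf{R}$, $c_{j,m_j}\neq 0$, and $m=\max_{1\leq j\leq d} m_j\geq 2$. Let $P_m(\xi)=\sum_{j:\ m_j=m}c_{j,m}\xi_j^m$ be the principal part of $p$ and let $$\chi_t(x,\xi)=(x+t\nabla P_m(\xi),\xi),\quad t\in\mathbf{R},\quad (x,\xi)\in T^*\mathbf{R}^d\setminus 0,$$ be the Hamilton flow of $P_m(\xi)$. Let $\mathscr{K}_t:\mathscr{S}'(\mathbf{R}^d)\to\mathscr{S}'(\mathbf{R}^d)$ be the solution operator for the evolution equation $$\partial_t u(t,x)+i\left(p(D_x)+\langle v,x\rangle\right)u(t,x)=0,\quad x\in\mathbf{R}^d,\ t\in\mathbf{R},\qquad u(0,\cdot)=u_0.$$ Then $$\mathrm{WF}_{\rm g}^\sigma(\mathscr{K}_t u)=\chi_t\left(\mathrm{WF}_{\rm g}^\sigma(u)\right),\quad t\in\mathbf{R},\quad u\in\mathscr{S}'(\mathbf{R}^d),\quad \sigma=\frac{1}{m-1},$$ $$\mathrm{WF}_{\rm g}^\sigma(\mathscr{K}_t u)=\mathrm{WF}_{\rm g}^\sigma(u),\quad t\in\mathbf{R},\quad u\in\mathscr{S}'(\mathbf{R}^d),\quad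 0<\sigma<\frac{1}{m-1}.$$
   Context: $T^*\mathbf{R}^d$ is identified with $\mathbf{R}^{2d}$; $\setminus 0$ denotes removal of the origin; $D_j=-i\partial_j$. The Fourier transform is $\widehat f(\xi)=(2\pi)^{-d/2}\int f(x)e^{-i\langle x,\xi\rangle}dx$. The pairing $(\cdot,\cdot)$ is conjugate linear in the second argument. Solution operator: let $q_j$ be a polynomial with $q_j'=p_j$, $1\leq j\leq d$, and set $\varphi_t(\xi)=\sum_{j=1}^d v_j^{-1}\left(q_j(\xi_j-tv_j)-q_j(\xi_j)\right)$. For $f\in\mathscr{S}(\mathbf{R}^d)$, $\mathscr{K}_tf(x)=e^{-it\langle x,v\rangle}\mathscr{F}^{-1}\left(e^{i\varphi_t}\widehat f\,\right)(x)$. This is a one-parameter group of operators, unitary on $L^2(\mathbf{R}^d)$ and continuous on $\mathscr{S}(\mathbf{R}^d)$, extended to $u\in\mathscr{S}'(\mathbf{R}^d)$ by $(\mathscr{K}_tu,\phi)=(u,\mathscr{K}_{-t}\phi)$, $\phi\in\mathscr{S}(\mathbf{R}^d)$. Its Schwartz kernel is $K_t(x,y)=(2\pi)^{-d/2}e^{-it\langle x,v\rangle}\mathscr{F}^{-1}(e^{i\varphi_t})(x-y)$. Anisotropic Gabor wave front set: for $\varphi\in\mathscr{S}(\mathbf{R}^d)\setminus 0$, $V_\varphi u(x,\xi)=(2\pi)^{-d/2}(u,e^{i\langle\cdot,\xi\rangle}\varphi(\cdot-x))$. For $\sigma>0$ and $u\in\mathscr{S}'(\mathbf{R}^d)$,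 a point $z_0\in T^*\mathbf{R}^d\setminus 0$ satisfies $z_0\notin\mathrm{WF}_{\rm g}^\sigma(u)$ if there is an open set $U\ni z_0$ such that $\sup_{(x,\xi)\in U,\ \lambda>0}\lambda^N|V_\varphi u(\lambda x,\lambda^\sigma\xi)|<\infty$ for all $N\geq 0$ (independent of the choice of $\varphi$). *)

theory Defs
  imports "HOL-Analysis.Analysis" "HOL-Computational_Algebra.Polynomial"
begin

text \<open>Throughout, the space \<open>R^d\<close> is \<^typ>\<open>real ^ 'n\<close> with \<open>d = CARD('n)\<close>, and \<open>T*R^d\<close> is
  \<^typ>\<open>(real ^ 'n) \<times> (real ^ 'n)\<close>.\<close>

section \<open>The Schwartz space and tempered distributions\<close>

definition partial_deriv ::
  "'n::finite \<Rightarrow> (real ^ 'n \<Rightarrow> 'b::real_normed_vector) \<Rightarrow> real ^ 'n \<Rightarrow> 'b" where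
  "partial_deriv j f x = vector_derivative (\<lambda>s. f (x + s *\<^sub>R axis j 1)) (at 0)"

text \<open>Derivatives of higher order are indexed by lists of coordinates:
  the list \<open>[j1, ..., jk]\<close> stands for \<open>\<partial>_j1 ... \<partial>_jk\<close>. For smooth functions the order of the list is
  irrelevant, so that these are exactly the derivatives indexed by multi-indices.\<close>

definition iter_deriv ::
  "'n::finite list \<Rightarrow> (real ^ 'n \<Rightarrow> 'b::real_normed_vector) \<Rightarrow> real ^ 'n \<Rightarrow> 'b" where
  "iter_deriv js f = foldr partial_deriv js f"

definition smooth :: "(real ^ 'n::finite \<Rightarrow> 'b::real_normed_vector) \<Rightarrow> bool" where
  "smooth f \<longleftrightarrow> (\<forall>js. iter_deriv js f differentiable_on UNIV)"

definition monomial :: "('n::finite \<Rightarrow> nat) \<Rightarrow> real ^ 'n \<Rightarrow> real" where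
  "monomial \<alpha> x = (\<Prod>j\<in>UNIV. (x $ j) ^ \<alpha> j)"

definition schwartz :: "(real ^ 'n::finite \<Rightarrow> complex) set" where
  "schwartz = {f :: real ^ 'n \<Rightarrow> complex. smooth f \<and>
     (\<forall>\<alpha> js. bdd_above (range (\<lambda>x. cmod (complex_of_real (monomial \<alpha> x) * iter_deriv js f x))))}"

definition schwartz_seminorm ::
  "('n::finite \<Rightarrow> nat) \<Rightarrow> 'n list \<Rightarrow> (real ^ 'n \<Rightarrow> complex) \<Rightarrow> real" where
  "schwartz_seminorm \<alpha> js f = (SUP x. cmod (complex_of_real (monomial \<alpha> x) * iter_deriv js f x))"

definition schwartz_topology :: "(real ^ 'n::finite \<Rightarrow> complex) topology" where
  "schwartz_topology = topology_generated_by
     {{g \<in> schwartz. schwartz_seminorm \<alpha> js (\<lambda>x. g x - f x) < \<epsilon>} | f \<alpha> js \<epsilon>.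
        f \<in> schwartz \<and> \<epsilon> > 0}"

text \<open>Tempered distributions are continuous \<^emph>\<open>linear\<close> functionals on the Schwartz space.
  They are represented by functionals on all functions, whose values outside
  the Schwartz space are irrelevant.\<close>

definition tempered_distributions :: "((real ^ 'n::finite \<Rightarrow> complex) \<Rightarrow> complex) set" where
  "tempered_distributions = {u.
     (\<forall>f\<in>schwartz. \<forall>g\<in>schwartz. u (\<lambda>x. f x + g x) = u f + u g) \<and>
     (\<forall>c. \<forall>f\<in>schwartz. u (\<lambda>x. c * f x) = c * u f) \<and>
     continuous_map schwartz_topology euclidean u}"

text \<open>The pairing \<open>(u, f)\<close>, conjugate linear in the second argument, which extends the inner product
  of \<open>L^2\<close>.\<close>

definition pairing ::
  "((real ^ 'n::finite \<Rightarrow> complex) \<Rightarrow> complex) \<Rightarrow> (real ^ 'n \<Rightarrow> complex) \<Rightarrow> complex" where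
  "pairing u f = u (\<lambda>x. cnj (f x))"


section \<open>The anisotropic Gabor wave front set\<close>

definition stft ::
  "(real ^ 'n::finite \<Rightarrow> complex) \<Rightarrow> ((real ^ 'n \<Rightarrow> complex) \<Rightarrow> complex) \<Rightarrow>
     real ^ 'n \<Rightarrow> real ^ 'n \<Rightarrow> complex" where
  "stft \<phi> u x \<xi> = complex_of_real ((2 * pi) powr (- real CARD('n) / 2)) *
     pairing u (\<lambda>y. cis (y \<bullet> \<xi>) * \<phi> (y - x))"

text \<open>The wave front set does not depend on the window \<open>\<phi>\<close> among the nonzero Schwartz functions;
  the window is therefore kept as a parameter.\<close>

definition gabor_WF ::
  "(real ^ 'n::finite \<Rightarrow> complex) \<Rightarrow> real \<Rightarrow> ((real ^ 'n \<Rightarrow> complex) \<Rightarrow> complex) \<Rightarrow>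
     ((real ^ 'n) \<times> (real ^ 'n)) set" where
  "gabor_WF \<phi> \<sigma> u = {z\<^sub>0. z\<^sub>0 \<noteq> 0 \<and>
     \<not> (\<exists>U. open U \<and> z\<^sub>0 \<in> U \<and>
          (\<forall>N::real. N \<ge> 0 \<longrightarrow>
             bdd_above {l powr N * cmod (stft \<phi> u (l *\<^sub>R x) ((l powr \<sigma>) *\<^sub>R \<xi>)) | l x \<xi>.
                          (x, \<xi>) \<in> U \<and> l > 0}))}"


section \<open>The solution operator\<close>

definition fourier :: "(real ^ 'n::finite \<Rightarrow> complex) \<Rightarrow> real ^ 'n \<Rightarrow> complex" where
  "fourier f \<xi> = complex_of_real ((2 * pi) powr (- real CARD('n) / 2)) *
     (LINT x|lborel. f x * cis (- (x \<bullet> \<xi>)))"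

definition inv_fourier :: "(real ^ 'n::finite \<Rightarrow> complex) \<Rightarrow> real ^ 'n \<Rightarrow> complex" where
  "inv_fourier f x = complex_of_real ((2 * pi) powr (- real CARD('n) / 2)) *
     (LINT \<xi>|lborel. f \<xi> * cis (x \<bullet> \<xi>))"

text \<open>In the following, the polynomials \<open>q j\<close> are primitives of the one-variable components \<open>p j\<close>
  of the symbol of the evolution equation \<open>\<partial>_t u + i (p(D) + <v,x>) u = 0\<close>.\<close>

definition solution_phase ::
  "real ^ 'n::finite \<Rightarrow> ('n \<Rightarrow> real poly) \<Rightarrow> real \<Rightarrow> real ^ 'n \<Rightarrow> real" where
  "solution_phase v q t \<xi> =
     (\<Sum>j\<in>UNIV. inverse (v $ j) * (poly (q j) (\<xi> $ j - t * v $ j) - poly (q j) (\<xi> $ j)))"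

definition solution_op ::
  "real ^ 'n::finite \<Rightarrow> ('n \<Rightarrow> real poly) \<Rightarrow> real \<Rightarrow> (real ^ 'n \<Rightarrow> complex) \<Rightarrow>
     real ^ 'n \<Rightarrow> complex" where
  "solution_op v q t f x = cis (- t * (x \<bullet> v)) *
     inv_fourier (\<lambda>\<xi>. cis (solution_phase v q t \<xi>) * fourier f \<xi>) x"

text \<open>The extension to tempered distributions, characterised by \<open>pairing_solution_op_dist\<close>.\<close>

definition solution_op_dist ::
  "real ^ 'n::finite \<Rightarrow> ('n \<Rightarrow> real poly) \<Rightarrow> real \<Rightarrow> ((real ^ 'n \<Rightarrow> complex) \<Rightarrow> complex) \<Rightarrow>
     (real ^ 'n \<Rightarrow> complex) \<Rightarrow> complex" where
  "solution_op_dist v q t u \<psi> = pairing u (solution_op v q (- t) (\<lambda>x. cnj (\<psi> x)))"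

lemma pairing_solution_op_dist:
  "pairing (solution_op_dist v q t u) \<phi> = pairing u (solution_op v q (- t) \<phi>)"
  unfolding pairing_def solution_op_dist_def by simp


section \<open>The Hamilton flow of the principal part\<close>

definition principal_part :: "('n::finite \<Rightarrow> real poly) \<Rightarrow> nat \<Rightarrow> real ^ 'n \<Rightarrow> real" where
  "principal_part p m \<xi> = (\<Sum>j | degree (p j) = m. coeff (p j) m * (\<xi> $ j) ^ m)"

definition gradient :: "(real ^ 'n::finite \<Rightarrow> real) \<Rightarrow> real ^ 'n \<Rightarrow> real ^ 'n" where
  "gradient f x = (\<chi> j. partial_deriv j f x)"

text \<open>The Hamilton flow of a Hamiltonian \<open>P(\<xi>)\<close> that is independent of \<open>x\<close>.\<close>

definition hamilton_flow ::
  "(real ^ 'n::finite \<Rightarrow> real) \<Rightarrow> real \<Rightarrow> (real ^ 'n) \<times> (real ^ 'n) \<Rightarrow> (real ^ 'n) \<times> (real ^ 'n)" where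
  "hamilton_flow P t = (\<lambda>(x, \<xi>). (x + t *\<^sub>R gradient P \<xi>, \<xi>))"

end

theory Submission
  imports Defs "HOL-Probability.Characteristic_Functions" "HOL-Probability.Sinc_Integral"
begin

text \<open>By the reproducing formula of the short-time Fourier transform, \<open>V_\<phi> (K_t u)(z)\<close> is, up to a
  constant, the integral over \<open>w\<close> of \<open>V_\<phi> u (w)\<close> against the conjugate of
  \<open>k(z, w) = (K_{-t} \<pi>(z) \<phi>, \<pi>(w) \<phi>)\<close>, where \<open>\<pi>(x, \<xi>) \<phi> = e^{i <., \<xi>>} \<phi>(. - x)\<close>. On the Fourier side
  \<open>k\<close> is an oscillatory integral whose phase \<open>\<Phi> = \<phi>_{-t}\<close> has a polynomial gradient; for \<open>z = (x, \<xi>)\<close> and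
  \<open>w = (y, \<eta>)\<close>, integration by parts bounds it by powers of
  \<open>(1 + |\<xi>|)^{m-2} / (1 + |y - x + \<nabla>\<Phi>(\<xi>)|)\<close> and of \<open>1 / (1 + |\<xi> - \<eta> + t v|)\<close>. On the anisotropic scale
  \<open>(\<lambda> x, \<lambda>^\<sigma> \<xi>)\<close> one has \<open>\<nabla>\<Phi>(\<lambda>^\<sigma> \<xi>) = \<lambda> B(\<xi>) + o(\<lambda>)\<close>, where \<open>B = t \<nabla>P_m\<close> if \<open>\<sigma> = 1 / (m - 1)\<close> and
  \<open>B = 0\<close> if \<open>\<sigma> < 1 / (m - 1)\<close>, while the width \<open>\<lambda>^{\<sigma> (m - 2)}\<close> of the kernel is \<open>o(\<lambda>)\<close>, so rapid decay of
  \<open>V_\<phi> u\<close> near \<open>(x - B(\<xi>), \<xi>)\<close> gives rapid decay of \<open>V_\<phi> (K_t u)\<close> near \<open>(x, \<xi>)\<close>. The reverse inclusions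
  follow from \<open>K_{-t} K_t = 1\<close>.\<close>

section \<open>Smooth functions\<close>

text \<open>Two obstacles shape the development. First, \<open>u\<close> is only a continuous linear
  functional on the Schwartz space, so the reproducing formula requires \<open>u\<close> to commute
  with an integral over phase space. This is obtained from Riemann sums on boxes that converge in
  every Schwartz seminorm, followed by exhaustion. Secondly, the kernel has to be controlled
  uniformly in \<open>z\<close> and \<open>w\<close>; estimates are therefore proved for families
  over an arbitrary index set, with a weight. The integral over \<open>w\<close> runs over all of
  phase space, but decay of the transform of \<open>u\<close> is known only near one anisotropic
  ray. There it is used against a crude kernel bound. Elsewhere only polynomial growth is known, and
  high powers of the kernel decay must beat it. They do, because \<open>w\<close> is then at
  distance at least of order \<lambda> in position or \<open>\<lambda> powr \<sigma>\<close> in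
  frequency, while one power of position decay costs only
  \<open>\<lambda> powr (\<sigma> * (m - 2))\<close>, which is of lower order than \<lambda> for
  every exponent considered. The critical value of \<sigma> is the one at which a gradient of degree
  \<open>m - 1\<close> grows exactly like \<lambda>.\<close>

lemma has_derivative_partial_deriv:
  fixes f :: "real ^ 'n::finite \<Rightarrow> 'b::real_normed_vector"
  assumes "(f has_derivative D) (at x)"
  shows "partial_deriv j f x = D (axis j 1)"
proof -
  have "((\<lambda>s::real. x + s *\<^sub>R axis j 1) has_derivative (\<lambda>s. s *\<^sub>R axis j 1)) (at 0)"
    by (auto intro!: derivative_eq_intros)
  moreover have "(f has_derivative D) (at (x + (0::real) *\<^sub>R axis j 1))"
    using assms by simp
  ultimately have "((\<lambda>s::real. f (x + s *\<^sub>R axis j 1)) has_derivative (\<lambda>s. D (s *\<^sub>R axis j 1))) (at 0)"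
    by (rule has_derivative_compose)
  moreover have "D (s *\<^sub>R axis j 1) = s *\<^sub>R D (axis j 1)" for s
    using assms by (simp add: has_derivative_def bounded_linear.linear linear_scale)
  ultimately show ?thesis
    unfolding partial_deriv_def
    by (intro vector_derivative_at) (simp add: has_vector_derivative_def)
qed

lemma differentiable_has_derivative_partial:
  fixes f :: "real ^ 'n::finite \<Rightarrow> 'b::real_normed_vector"
  assumes "f differentiable (at x)"
  shows "(f has_derivative (\<lambda>h. \<Sum>j\<in>UNIV. (h $ j) *\<^sub>R partial_deriv j f x)) (at x)"
proof -
  obtain D where D: "(f has_derivative D) (at x)"
    using assms by (auto simp: differentiable_def)
  interpret D: bounded_linear D using D by (rule has_derivative_bounded_linear)
  have "D h = (\<Sum>j\<in>UNIV. (h $ j) *\<^sub>R partial_deriv j f x)" for h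
  proof -
    have "D h = D (\<Sum>j\<in>UNIV. (h $ j) *\<^sub>R axis j 1)"
      by (metis basis_expansion scalar_mult_eq_scaleR)
    also have "\<dots> = (\<Sum>j\<in>UNIV. (h $ j) *\<^sub>R partial_deriv j f x)"
      by (simp add: D.sum D.scaleR has_derivative_partial_deriv[OF D])
    finally show ?thesis .
  qed
  with D show ?thesis by (metis (no_types, lifting) ext)
qed

lemma iter_deriv_Nil [simp]: "iter_deriv [] f = f"
  by (simp add: iter_deriv_def)

lemma iter_deriv_Cons: "iter_deriv (j # js) f = partial_deriv j (iter_deriv js f)"
  by (simp add: iter_deriv_def)

lemma iter_deriv_snoc: "iter_deriv (js @ [j]) f = iter_deriv js (partial_deriv j f)"
  by (simp add: iter_deriv_def)

lemma iter_deriv_append: "iter_deriv (js @ ks) f = iter_deriv js (iter_deriv ks f)"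
  by (simp add: iter_deriv_def)

lemma smooth_differentiable: "smooth f \<Longrightarrow> f differentiable (at x)"
  unfolding smooth_def by (drule spec[of _ "[]"]) (simp add: differentiable_on_def)

lemma smooth_iter_deriv_differentiable: "smooth f \<Longrightarrow> iter_deriv js f differentiable (at x)"
  unfolding smooth_def by (simp add: differentiable_on_def)

lemma smooth_iter_deriv: "smooth f \<Longrightarrow> smooth (iter_deriv js f)"
  unfolding smooth_def iter_deriv_append[symmetric] by blast

lemma smooth_partial_deriv: "smooth f \<Longrightarrow> smooth (partial_deriv j f)"
  using smooth_iter_deriv[of f "[j]"] by (simp add: iter_deriv_Cons)

text \<open>Smooth functions form the greatest class of differentiable functions closed under
  partial derivatives, so any class with these two properties suffices. Closure proofs thus need
  first-order rules only, never a Leibniz formula of higher order.\<close>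

lemma smooth_coinduct:
  assumes "f \<in> Q"
    and "\<And>f x. f \<in> Q \<Longrightarrow> f differentiable (at x)"
    and "\<And>f j. f \<in> Q \<Longrightarrow> partial_deriv j f \<in> Q"
  shows "smooth f"
  unfolding smooth_def
proof
  fix js
  show "iter_deriv js f differentiable_on UNIV"
    using assms(1)
    \<comment> \<open>The last entry of the list acts first, so removing it replaces
      \<open>f\<close> by another member of \<open>Q\<close>.\<close>
    by (induction js arbitrary: f rule: rev_induct)
      (use assms(2,3) in \<open>auto simp: differentiable_on_def iter_deriv_snoc\<close>)
qed

lemma smooth_continuous_on: "smooth f \<Longrightarrow> continuous_on S f"
  by (meson continuous_at_imp_continuous_on differentiable_imp_continuous_within smooth_differentiable)

lemma smooth_measurable [measurable_dest]:
  "smooth f \<Longrightarrow> (f :: real ^ 'n::finite \<Rightarrow> 'b::real_normed_vector) \<in> borel_measurable borel"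
  by (intro borel_measurable_continuous_onI smooth_continuous_on)

lemma partial_deriv_add:
  fixes f g :: "real ^ 'n::finite \<Rightarrow> 'b::real_normed_vector"
  assumes "f differentiable (at x)" "g differentiable (at x)"
  shows "partial_deriv j (\<lambda>x. f x + g x) x = partial_deriv j f x + partial_deriv j g x"
proof -
  obtain D E where D: "(f has_derivative D) (at x)" and E: "(g has_derivative E) (at x)"
    using assms by (auto simp: differentiable_def)
  show ?thesis
    using has_derivative_partial_deriv[OF has_derivative_add[OF D E]]
    by (simp add: has_derivative_partial_deriv[OF D] has_derivative_partial_deriv[OF E])
qed

lemma partial_deriv_mult:
  fixes f g :: "real ^ 'n::finite \<Rightarrow> 'b::real_normed_algebra"
  assumes "f differentiable (at x)" "g differentiable (at x)"
  shows "partial_deriv j (\<lambda>x. f x * g x) x = f x * partial_deriv j g x + partial_deriv j f x * g x"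
proof -
  obtain D E where D: "(f has_derivative D) (at x)" and E: "(g has_derivative E) (at x)"
    using assms by (auto simp: differentiable_def)
  show ?thesis
    using has_derivative_partial_deriv[OF has_derivative_mult[OF D E]]
    by (simp add: has_derivative_partial_deriv[OF D] has_derivative_partial_deriv[OF E])
qed

lemma partial_deriv_bounded_linear:
  fixes f :: "real ^ 'n::finite \<Rightarrow> 'b::real_normed_vector"
  assumes "bounded_linear L" "f differentiable (at x)"
  shows "partial_deriv j (\<lambda>x. L (f x)) x = L (partial_deriv j f x)"
proof -
  obtain D where D: "(f has_derivative D) (at x)"
    using assms by (auto simp: differentiable_def)
  show ?thesis
    using has_derivative_partial_deriv[OF bounded_linear.has_derivative[OF assms(1) D]]
    by (simp add: has_derivative_partial_deriv[OF D])
qed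

lemma partial_deriv_const [simp]: "partial_deriv j (\<lambda>x. c) = (\<lambda>x. 0)"
  by (rule ext, subst has_derivative_partial_deriv[OF has_derivative_const], rule refl)

lemma iter_deriv_const_0: "iter_deriv js (\<lambda>x. 0) = (\<lambda>x. 0)"
  by (induction js) (auto simp: iter_deriv_Cons)

lemma smooth_const [simp]: "smooth (\<lambda>x. c)"
  by (rule smooth_coinduct[of _ "range (\<lambda>c x. c)"]) auto

lemma smooth_add:
  assumes "smooth f" "smooth g" shows "smooth (\<lambda>x. f x + g x)"
proof (rule smooth_coinduct[of _ "{\<lambda>x. f x + g x | f g. smooth f \<and> smooth g}"])
  fix h j assume "h \<in> {\<lambda>x. f x + g x | f g. smooth f \<and> smooth g}"
  then obtain f g where "h = (\<lambda>x. f x + g x)" "smooth f" "smooth g" by auto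
  moreover from this have "partial_deriv j h = (\<lambda>x. partial_deriv j f x + partial_deriv j g x)"
    by (auto simp: partial_deriv_add smooth_differentiable)
  ultimately show "partial_deriv j h \<in> {\<lambda>x. f x + g x | f g. smooth f \<and> smooth g}"
    using smooth_partial_deriv by blast
qed (use assms in \<open>auto intro: differentiable_add smooth_differentiable\<close>)

lemma iter_deriv_add:
  assumes "smooth f" "smooth g"
  shows "iter_deriv js (\<lambda>x. f x + g x) = (\<lambda>x. iter_deriv js f x + iter_deriv js g x)"
  by (induction js)
    (use assms in \<open>auto simp: iter_deriv_Cons partial_deriv_add smooth_iter_deriv_differentiable\<close>)

lemma smooth_bounded_linear:
  assumes "bounded_linear L" "smooth f" shows "smooth (\<lambda>x. L (f x))"
proof (rule smooth_coinduct[of _ "{\<lambda>x. L (f x) | f. smooth f}"])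
  fix h j assume "h \<in> {\<lambda>x. L (f x) | f. smooth f}"
  then obtain f where "h = (\<lambda>x. L (f x))" "smooth f" by auto
  moreover from this have "partial_deriv j h = (\<lambda>x. L (partial_deriv j f x))"
    using assms(1) by (auto simp: partial_deriv_bounded_linear smooth_differentiable)
  ultimately show "partial_deriv j h \<in> {\<lambda>x. L (f x) | f. smooth f}"
    using smooth_partial_deriv by blast
next
  fix h x assume "h \<in> {\<lambda>x. L (f x) | f. smooth f}"
  then show "h differentiable (at x)"
    using bounded_linear.has_derivative[OF assms(1)] smooth_differentiable
    unfolding differentiable_def by blast
qed (use assms in auto)

lemma iter_deriv_bounded_linear:
  assumes "bounded_linear L" "smooth f"
  shows "iter_deriv js (\<lambda>x. L (f x)) = (\<lambda>x. L (iter_deriv js f x))"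
  by (induction js)
    (use assms in \<open>auto simp: iter_deriv_Cons partial_deriv_bounded_linear smooth_iter_deriv_differentiable\<close>)

lemma iter_deriv_diff:
  assumes "smooth f" "smooth g"
  shows "iter_deriv js (\<lambda>x. f x - g x) = (\<lambda>x. iter_deriv js f x - iter_deriv js g x)"
  using iter_deriv_add[OF assms(1) smooth_bounded_linear[OF bounded_linear_minus[OF bounded_linear_ident] assms(2)]]
    iter_deriv_bounded_linear[OF bounded_linear_minus[OF bounded_linear_ident] assms(2)]
  by simp

lemma smooth_sum:
  "(\<And>i. i \<in> I \<Longrightarrow> smooth (f i)) \<Longrightarrow> smooth (\<lambda>x. \<Sum>i\<in>I. f i x)"
  by (induction I rule: infinite_finite_induct) (auto intro: smooth_add)

lemma iter_deriv_sum:
  assumes "\<And>i. i \<in> I \<Longrightarrow> smooth (f i)"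
  shows "iter_deriv js (\<lambda>x. \<Sum>i\<in>I. f i x) = (\<lambda>x. \<Sum>i\<in>I. iter_deriv js (f i) x)"
  using assms
  by (induction I rule: infinite_finite_induct)
    (auto simp: iter_deriv_const_0 iter_deriv_add smooth_sum)

text \<open>Products alone are not closed under differentiation; their sums are.\<close>

inductive_set prod_sums :: "(real ^ 'n::finite \<Rightarrow> 'b::real_normed_algebra) set" where
  prod: "smooth f \<Longrightarrow> smooth g \<Longrightarrow> (\<lambda>x. f x * g x) \<in> prod_sums"
| sum: "f \<in> prod_sums \<Longrightarrow> g \<in> prod_sums \<Longrightarrow> (\<lambda>x. f x + g x) \<in> prod_sums"

lemma smooth_mult:
  fixes f g :: "real ^ 'n::finite \<Rightarrow> 'b::real_normed_algebra"
  assumes "smooth f" "smooth g" shows "smooth (\<lambda>x. f x * g x)"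
proof (rule smooth_coinduct[of _ prod_sums])
  show diff: "h differentiable (at x)" if "h \<in> prod_sums" for h :: "real ^ 'n \<Rightarrow> 'b" and x
    using that by induction (auto intro: differentiable_mult differentiable_add smooth_differentiable)
  show "partial_deriv j h \<in> prod_sums" if "h \<in> prod_sums" for h :: "real ^ 'n \<Rightarrow> 'b" and j
    using that
  proof induction
    case (prod f g)
    then have "partial_deriv j (\<lambda>x. f x * g x) = (\<lambda>x. f x * partial_deriv j g x + partial_deriv j f x * g x)"
      by (auto simp: partial_deriv_mult smooth_differentiable)
    with prod show ?case by (simp add: prod_sums.intros smooth_partial_deriv)
  next
    case (sum f g)
    then have "partial_deriv j (\<lambda>x. f x + g x) = (\<lambda>x. partial_deriv j f x + partial_deriv j g x)"
      by (auto simp: partial_deriv_add diff)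
    with sum show ?case by (simp add: prod_sums.intros)
  qed
qed (use assms in \<open>auto intro: prod_sums.intros\<close>)

lemma partial_deriv_smooth_mult:
  fixes f g :: "real ^ 'n::finite \<Rightarrow> 'b::real_normed_algebra"
  assumes "smooth f" "smooth g"
  shows "partial_deriv j (\<lambda>x. f x * g x) = (\<lambda>x. f x * partial_deriv j g x + partial_deriv j f x * g x)"
  using assms by (auto simp: partial_deriv_mult smooth_differentiable)

lemma iter_deriv_translate: "iter_deriv js (\<lambda>x. f (x + a)) = (\<lambda>x. iter_deriv js f (x + a))"
proof (induction js)
  case (Cons j js)
  then show ?case
    by (auto simp: iter_deriv_Cons partial_deriv_def algebra_simps)
qed auto

lemma smooth_translate: assumes "smooth f" shows "smooth (\<lambda>x. f (x + a))"
proof (rule smooth_coinduct[of _ "{\<lambda>x. f (x + a) | f. smooth f}"])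
  fix h j assume "h \<in> {\<lambda>x. f (x + a) | f. smooth f}"
  then obtain f where "h = (\<lambda>x. f (x + a))" "smooth f" by auto
  moreover from this have "partial_deriv j h = (\<lambda>x. partial_deriv j f (x + a))"
    using iter_deriv_translate[of "[j]" f a] by (simp add: iter_deriv_Cons)
  ultimately show "partial_deriv j h \<in> {\<lambda>x. f (x + a) | f. smooth f}"
    using smooth_partial_deriv by blast
next
  fix h x assume "h \<in> {\<lambda>x. f (x + a) | f. smooth f}"
  then obtain f where h: "h = (\<lambda>x. f (x + a))" "smooth f" by auto
  then have "f differentiable (at (x + a))" by (simp add: smooth_differentiable)
  moreover have "(\<lambda>x. x + a) differentiable (at x)" by (intro differentiable_add) auto
  ultimately show "h differentiable (at x)"
    using differentiable_chain_at[of "\<lambda>x. x + a" x f] h by (simp add: comp_def)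
qed (use assms in auto)


section \<open>Weighted families of Schwartz functions and of multipliers\<close>

text \<open>A substitute for the bracket \<open>sqrt (1 + |x|^2)\<close>, convenient because it is
  submultiplicative with constant 1 (\<open>wt_add_le\<close>): moving a weight to a translate costs
  no constant.\<close>

definition wt :: "'a::real_normed_vector \<Rightarrow> real" where "wt x = 1 + norm x"

lemma wt_ge_1 [simp]: "1 \<le> wt x" and wt_pos [simp]: "0 < wt x" and wt_nonneg [simp]: "0 \<le> wt x"
  by (auto simp: wt_def add_pos_nonneg)

lemma norm_le_wt: "norm x \<le> wt x"
  by (simp add: wt_def)

lemma wt_add_le: "wt (x + y) \<le> wt x * wt y"
proof -
  have "norm (x + y) \<le> norm x + norm y" by (rule norm_triangle_ineq)
  then show ?thesis by (simp add: wt_def algebra_simps add.commute) (smt (verit) mult_nonneg_nonneg norm_ge_zero)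
qed

lemma wt_minus [simp]: "wt (- x) = wt x"
  by (simp add: wt_def)

lemma wt_diff_le: "wt (x - y) \<le> wt x * wt y"
  using wt_add_le[of x "- y"] by simp

lemma wt_component_le: "\<bar>x $ j\<bar> \<le> wt (x :: real ^ 'n::finite)"
  using component_le_norm_cart[of x j] by (simp add: wt_def)

lemma continuous_on_wt [continuous_intros]:
  "continuous_on S f \<Longrightarrow> continuous_on S (\<lambda>x. wt (f x))"
  unfolding wt_def by (intro continuous_intros)

lemma borel_measurable_wt [measurable]:
  "f \<in> borel_measurable M \<Longrightarrow> (\<lambda>x. wt (f x :: 'a::euclidean_space)) \<in> borel_measurable M"
  unfolding wt_def by measurable

text \<open>Estimates uniform in a parameter \<open>p\<close>. The same calculus yields invariance of \<open>S\<close> (one parameter),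
  continuity of operators on \<open>S\<close> (bounded sequences) and the kernel estimates below (phase space
  parameters).\<close>

definition sfam :: "('p \<Rightarrow> real) \<Rightarrow> ('p \<Rightarrow> real ^ 'n::finite \<Rightarrow> complex) \<Rightarrow> bool" where
  "sfam \<mu> G \<longleftrightarrow> (\<forall>p. smooth (G p)) \<and>
     (\<forall>js N. \<exists>C\<ge>0. \<forall>p x. wt x ^ N * cmod (iter_deriv js (G p) x) \<le> C * \<mu> p)"

text \<open>The multipliers of the Schwartz space. The growth exponent may depend on the derivative,
  but not on the parameter.\<close>

definition ofam :: "('p \<Rightarrow> real) \<Rightarrow> ('p \<Rightarrow> real ^ 'n::finite \<Rightarrow> complex) \<Rightarrow> bool" where
  "ofam \<mu> h \<longleftrightarrow> (\<forall>p. smooth (h p)) \<and>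
     (\<forall>js. \<exists>C\<ge>0. \<exists>N. \<forall>p x. cmod (iter_deriv js (h p) x) \<le> C * \<mu> p * wt x ^ N)"

lemma sfamD:
  assumes "sfam \<mu> G"
  obtains C where "C \<ge> 0" "\<And>p x. wt x ^ N * cmod (iter_deriv js (G p) x) \<le> C * \<mu> p"
  using assms unfolding sfam_def by blast

lemma sfam_boundD:
  assumes "sfam \<mu> G"
  obtains C where "C \<ge> 0" "\<And>p x. wt x ^ N * cmod (G p x) \<le> C * \<mu> p"
  using sfamD[OF assms, of N "[]"] by (metis iter_deriv_Nil)

lemma ofamD:
  assumes "ofam \<mu> G"
  obtains C N where "C \<ge> 0" "\<And>p x. cmod (iter_deriv js (G p) x) \<le> C * \<mu> p * wt x ^ N"
  using assms unfolding ofam_def by blast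

lemma ofam_boundD:
  assumes "ofam \<mu> G"
  obtains C N where "C \<ge> 0" "\<And>p x. cmod (G p x) \<le> C * \<mu> p * wt x ^ N"
  using ofamD[OF assms, of "[]"] by (metis iter_deriv_Nil)

lemma sfam_smooth: "sfam \<mu> G \<Longrightarrow> smooth (G p)" and ofam_smooth: "ofam \<mu> G \<Longrightarrow> smooth (G p)"
  by (auto simp: sfam_def ofam_def)

lemma sfam_partial_deriv: "sfam \<mu> G \<Longrightarrow> sfam \<mu> (\<lambda>p. partial_deriv j (G p))"
  unfolding sfam_def by (metis iter_deriv_snoc smooth_partial_deriv)

lemma ofam_partial_deriv: "ofam \<mu> G \<Longrightarrow> ofam \<mu> (\<lambda>p. partial_deriv j (G p))"
  unfolding ofam_def by (metis iter_deriv_snoc smooth_partial_deriv)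

lemma sfam_add:
  assumes "sfam \<mu> F" "sfam \<mu> G" shows "sfam \<mu> (\<lambda>p x. F p x + G p x)"
  unfolding sfam_def
proof (intro conjI allI)
  fix js N
  obtain C1 where C1: "C1 \<ge> 0" "\<And>p x. wt x ^ N * cmod (iter_deriv js (F p) x) \<le> C1 * \<mu> p"
    using sfamD[OF assms(1)] by blast
  obtain C2 where C2: "C2 \<ge> 0" "\<And>p x. wt x ^ N * cmod (iter_deriv js (G p) x) \<le> C2 * \<mu> p"
    using sfamD[OF assms(2)] by blast
  have "wt x ^ N * cmod (iter_deriv js (\<lambda>x. F p x + G p x) x) \<le> (C1 + C2) * \<mu> p" for p x
  proof -
    have "wt x ^ N * cmod (iter_deriv js (\<lambda>x. F p x + G p x) x)
        \<le> wt x ^ N * (cmod (iter_deriv js (F p) x) + cmod (iter_deriv js (G p) x))"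
      using assms by (intro mult_left_mono)
        (auto simp: iter_deriv_add sfam_smooth norm_triangle_ineq)
    also have "\<dots> \<le> (C1 + C2) * \<mu> p"
      using C1(2)[of x p] C2(2)[of x p] by (simp add: algebra_simps)
    finally show ?thesis .
  qed
  then show "\<exists>C\<ge>0. \<forall>p x. wt x ^ N * cmod (iter_deriv js (\<lambda>x. F p x + G p x) x) \<le> C * \<mu> p"
    using C1(1) C2(1) by (intro exI[of _ "C1 + C2"]) auto
qed (use assms in \<open>auto intro: smooth_add sfam_smooth\<close>)

lemma ofam_add:
  assumes "ofam \<mu> F" "ofam \<mu> G" "\<And>p. 0 \<le> \<mu> p" shows "ofam \<mu> (\<lambda>p x. F p x + G p x)"
  unfolding ofam_def
proof (intro conjI allI)
  fix js
  obtain C1 N1 where C1: "C1 \<ge> 0" "\<And>p x. cmod (iter_deriv js (F p) x) \<le> C1 * \<mu> p * wt x ^ N1"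
    using ofamD[OF assms(1)] by metis
  obtain C2 N2 where C2: "C2 \<ge> 0" "\<And>p x. cmod (iter_deriv js (G p) x) \<le> C2 * \<mu> p * wt x ^ N2"
    using ofamD[OF assms(2)] by metis
  have "cmod (iter_deriv js (\<lambda>x. F p x + G p x) x) \<le> (C1 + C2) * \<mu> p * wt x ^ (N1 + N2)" for p x
  proof -
    have "C1 * \<mu> p * wt x ^ N1 \<le> C1 * \<mu> p * wt x ^ (N1 + N2)"
      using assms(3) C1 by (intro mult_left_mono power_increasing) auto
    moreover have "C2 * \<mu> p * wt x ^ N2 \<le> C2 * \<mu> p * wt x ^ (N1 + N2)"
      using assms(3) C2 by (intro mult_left_mono power_increasing) auto
    moreover have "cmod (iter_deriv js (\<lambda>x. F p x + G p x) x)
        \<le> cmod (iter_deriv js (F p) x) + cmod (iter_deriv js (G p) x)"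
      using assms by (auto simp: iter_deriv_add ofam_smooth norm_triangle_ineq)
    ultimately show ?thesis
      using C1(2)[of p x] C2(2)[of p x] by (simp add: algebra_simps)
  qed
  then show "\<exists>C\<ge>0. \<exists>N. \<forall>p x. cmod (iter_deriv js (\<lambda>x. F p x + G p x) x) \<le> C * \<mu> p * wt x ^ N"
    using C1(1) C2(1) by (intro exI[of _ "C1 + C2"]) auto
qed (use assms in \<open>auto intro: smooth_add ofam_smooth\<close>)

text \<open>Taking the innermost derivative of a product gives two products of the same type, with
  the derivative on one factor. Induction over arbitrary \<open>h\<close> and \<open>G\<close>
  therefore replaces the Leibniz formula.\<close>

lemma sfam_mult:
  fixes h G :: "'p \<Rightarrow> real ^ 'n::finite \<Rightarrow> complex"
  assumes "ofam \<nu> h" "sfam \<mu> G"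
  shows "sfam (\<lambda>p. \<nu> p * \<mu> p) (\<lambda>p x. h p x * G p x)"
proof -
  have "\<exists>C\<ge>0. \<forall>p x. wt x ^ N * cmod (iter_deriv js (\<lambda>x. h p x * G p x) x) \<le> C * (\<nu> p * \<mu> p)" for js N
    using assms
  proof (induction js arbitrary: h G rule: rev_induct)
    case Nil
    obtain C1 N1 where C1: "C1 \<ge> 0" "\<And>p x. cmod (h p x) \<le> C1 * \<nu> p * wt x ^ N1"
      using ofam_boundD[OF Nil(1)] by metis
    obtain C2 where C2: "C2 \<ge> 0" "\<And>p x. wt x ^ (N + N1) * cmod (G p x) \<le> C2 * \<mu> p"
      using sfam_boundD[OF Nil(2)] by blast
    have "wt x ^ N * cmod (h p x * G p x) \<le> (C1 * C2) * (\<nu> p * \<mu> p)" for p x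
    proof -
      \<comment> \<open>The sign of \<open>C1 * \<nu> p\<close> is read off from the bound, which
        dominates a norm.\<close>
      have "0 \<le> C1 * \<nu> p * wt x ^ N1" using C1(2)[of p x] norm_ge_zero order_trans by blast
      then have nn: "0 \<le> C1 * \<nu> p" by (simp add: zero_le_mult_iff) (use wt_pos[of x] in \<open>smt (verit) zero_less_power\<close>)
      have "wt x ^ N * cmod (h p x * G p x) \<le> wt x ^ N * ((C1 * \<nu> p * wt x ^ N1) * cmod (G p x))"
        unfolding norm_mult using C1(2) by (intro mult_left_mono mult_right_mono) auto
      also have "\<dots> = C1 * \<nu> p * (wt x ^ (N + N1) * cmod (G p x))" by (simp add: power_add)
      also have "\<dots> \<le> C1 * \<nu> p * (C2 * \<mu> p)" using C2(2) nn by (intro mult_left_mono) auto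
      finally show ?thesis by (simp add: mult_ac)
    qed
    then show ?case using C1(1) C2(1) by (auto intro!: exI[of _ "C1 * C2"])
  next
    case (snoc j js)
    obtain C1 where C1: "C1 \<ge> 0" "\<And>p x. wt x ^ N * cmod (iter_deriv js (\<lambda>x. h p x * partial_deriv j (G p) x) x) \<le> C1 * (\<nu> p * \<mu> p)"
      using snoc.IH[OF snoc.prems(1) sfam_partial_deriv[OF snoc.prems(2)]] by blast
    obtain C2 where C2: "C2 \<ge> 0" "\<And>p x. wt x ^ N * cmod (iter_deriv js (\<lambda>x. partial_deriv j (h p) x * G p x) x) \<le> C2 * (\<nu> p * \<mu> p)"
      using snoc.IH[OF ofam_partial_deriv[OF snoc.prems(1)] snoc.prems(2)] by blast
    have "wt x ^ N * cmod (iter_deriv (js @ [j]) (\<lambda>x. h p x * G p x) x) \<le> (C1 + C2) * (\<nu> p * \<mu> p)" for p x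
    proof -
      have s: "smooth (h p)" "smooth (G p)" using snoc.prems by (auto intro: sfam_smooth ofam_smooth)
      have "cmod (iter_deriv (js @ [j]) (\<lambda>x. h p x * G p x) x) \<le>
          cmod (iter_deriv js (\<lambda>x. h p x * partial_deriv j (G p) x) x) +
          cmod (iter_deriv js (\<lambda>x. partial_deriv j (h p) x * G p x) x)"
        unfolding iter_deriv_snoc partial_deriv_smooth_mult[OF s]
        using s by (subst iter_deriv_add)
          (auto intro: smooth_mult smooth_partial_deriv norm_triangle_ineq)
      then have "wt x ^ N * cmod (iter_deriv (js @ [j]) (\<lambda>x. h p x * G p x) x) \<le> wt x ^ N * (\<dots>)"
        by (intro mult_left_mono) auto
      also have "\<dots> \<le> (C1 + C2) * (\<nu> p * \<mu> p)"
        using C1(2)[of x p] C2(2)[of x p] by (simp add: algebra_simps)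
      finally show ?thesis .
    qed
    then show ?case using C1(1) C2(1) by (intro exI[of _ "C1 + C2"]) auto
  qed
  then show ?thesis
    using assms unfolding sfam_def[of _ "\<lambda>p x. h p x * G p x"] by (auto intro: smooth_mult ofam_smooth sfam_smooth)
qed

lemma ofam_const: "(\<And>p. cmod (c p) \<le> \<mu> p) \<Longrightarrow> ofam \<mu> (\<lambda>p x. c p)"
  unfolding ofam_def
proof (intro conjI allI)
  fix js :: "'b list" assume c: "\<And>p. cmod (c p) \<le> \<mu> p"
  have "cmod (iter_deriv js (\<lambda>x. c p) x) \<le> 1 * \<mu> p * wt x ^ 0" for p and x :: "real ^ 'b"
  proof (cases js rule: rev_cases)
    case (snoc ks j)
    then show ?thesis using order_trans[OF norm_ge_zero c] by (simp add: iter_deriv_snoc iter_deriv_const_0)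
  qed (use c in auto)
  then show "\<exists>C\<ge>0. \<exists>N. \<forall>p. \<forall>x::real ^ 'b. cmod (iter_deriv js (\<lambda>x. c p) x) \<le> C * \<mu> p * wt x ^ N"
    by (meson zero_le_one)
qed auto

lemma sfam_cmult: "sfam \<mu> G \<Longrightarrow> sfam \<mu> (\<lambda>p x. c * G p x)"
proof -
  assume G: "sfam \<mu> G"
  have "sfam (\<lambda>p. cmod c * \<mu> p) (\<lambda>p x. c * G p x)"
    by (rule sfam_mult[OF ofam_const G]) auto
  then show ?thesis unfolding sfam_def mult.assoc[symmetric]
    by (meson mult_nonneg_nonneg norm_ge_zero)
qed

lemma sfam_cong_weight:
  assumes "sfam \<mu> G" "\<And>p. \<mu> p \<le> K * \<nu> p" "K \<ge> 0" shows "sfam \<nu> G"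
  unfolding sfam_def
proof (intro conjI allI)
  fix js N
  obtain C where C: "C \<ge> 0" "\<And>p x. wt x ^ N * cmod (iter_deriv js (G p) x) \<le> C * \<mu> p"
    using sfamD[OF assms(1)] by blast
  have "wt x ^ N * cmod (iter_deriv js (G p) x) \<le> (C * K) * \<nu> p" for p x
    using C(2)[of x p] mult_left_mono[OF assms(2)[of p] C(1)] by (simp add: mult.assoc)
  then show "\<exists>C\<ge>0. \<forall>p x. wt x ^ N * cmod (iter_deriv js (G p) x) \<le> C * \<nu> p"
    using C(1) assms(3) by (intro exI[of _ "C * K"]) auto
qed (use assms in \<open>auto intro: sfam_smooth\<close>)

lemma sfam_cnj: assumes "sfam \<mu> G" shows "sfam \<mu> (\<lambda>p x. cnj (G p x))"
  using assms unfolding sfam_def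
  by (simp add: iter_deriv_bounded_linear[OF bounded_linear_cnj] smooth_bounded_linear[OF bounded_linear_cnj])

lemma ofam_cnj: assumes "ofam \<mu> G" shows "ofam \<mu> (\<lambda>p x. cnj (G p x))"
  using assms unfolding ofam_def
  by (simp add: iter_deriv_bounded_linear[OF bounded_linear_cnj] smooth_bounded_linear[OF bounded_linear_cnj])

lemma sfam_comp: "sfam \<mu> G \<Longrightarrow> sfam (\<lambda>p. \<mu> (s p)) (\<lambda>p. G (s p))"
  unfolding sfam_def by meson

lemma ofam_comp: "ofam \<mu> G \<Longrightarrow> ofam (\<lambda>p. \<mu> (s p)) (\<lambda>p. G (s p))"
  unfolding ofam_def by meson

text \<open>If \<open>M\<close> is the largest of 1 and the moduli of the coordinates, then
  \<open>wt x\<close> is at most \<open>(d + 1) * M\<close>, and \<open>M ^ N\<close> is one of the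
  terms on the right.\<close>

lemma wt_powers_le:
  fixes x :: "real ^ 'n::finite"
  shows "wt x ^ N \<le> (real CARD('n) + 1) ^ N * (1 + (\<Sum>j\<in>UNIV. \<bar>x $ j\<bar> ^ N))"
proof -
  define M where "M = Max (insert 1 (range (\<lambda>j. \<bar>x $ j\<bar>)))"
  have M: "1 \<le> M" "\<And>j. \<bar>x $ j\<bar> \<le> M" unfolding M_def by (rule Max_ge; simp)+
  have "M \<in> insert 1 (range (\<lambda>j. \<bar>x $ j\<bar>))" unfolding M_def by (rule Max_in) auto
  then have MN: "M ^ N \<le> 1 + (\<Sum>j\<in>UNIV. \<bar>x $ j\<bar> ^ N)"
  proof
    assume "M \<in> range (\<lambda>j. \<bar>x $ j\<bar>)"
    then obtain j where "M = \<bar>x $ j\<bar>" by auto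
    then have "M ^ N \<le> (\<Sum>j\<in>UNIV. \<bar>x $ j\<bar> ^ N)" by (auto intro!: member_le_sum)
    then show ?thesis by simp
  qed (auto intro!: sum_nonneg)
  have "norm x \<le> (\<Sum>j\<in>UNIV. \<bar>x $ j\<bar>)" by (rule norm_le_l1_cart)
  also have "\<dots> \<le> (\<Sum>j\<in>(UNIV::'n set). M)" using M by (intro sum_mono)
  finally have "wt x \<le> (real CARD('n) + 1) * M" using M by (simp add: wt_def algebra_simps)
  then have "wt x ^ N \<le> ((real CARD('n) + 1) * M) ^ N" by (intro power_mono) auto
  also have "\<dots> \<le> (real CARD('n) + 1) ^ N * (1 + (\<Sum>j\<in>UNIV. \<bar>x $ j\<bar> ^ N))"
    unfolding power_mult_distrib using MN by (intro mult_left_mono) auto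
  finally show ?thesis .
qed

lemma monomial_le_wt: "\<bar>monomial \<alpha> x\<bar> \<le> wt x ^ (\<Sum>j\<in>UNIV. \<alpha> j)"
  unfolding monomial_def abs_prod power_sum
  by (intro prod_mono) (auto simp: power_abs intro!: power_mono wt_component_le)

lemma monomial_single: "monomial (\<lambda>i. if i = j then k else 0) x = (x $ j) ^ k"
proof -
  have "monomial (\<lambda>i. if i = j then k else 0) x = (\<Prod>i\<in>UNIV. if i = j then (x $ i) ^ k else 1)"
    unfolding monomial_def by (intro prod.cong) auto
  then show ?thesis by simp
qed

lemma monomial_0: "monomial (\<lambda>i. 0) x = 1"
  by (simp add: monomial_def)

text \<open>Pure powers of single coordinates suffice for weighted bounds. These are what repeated
  integration by parts in one direction produces, so mixed monomials need not be estimated.\<close>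

lemma wt_mult_le_monomials:
  fixes x :: "real ^ 'n::finite"
  assumes "c \<ge> 0" "c \<le> B" "\<And>j. \<bar>x $ j\<bar> ^ N * c \<le> B"
  shows "wt x ^ N * c \<le> (real CARD('n) + 1) ^ Suc N * B"
proof -
  have "wt x ^ N * c \<le> (real CARD('n) + 1) ^ N * (1 + (\<Sum>j\<in>UNIV. \<bar>x $ j\<bar> ^ N)) * c"
    using wt_powers_le[of x N] assms(1) by (intro mult_right_mono)
  also have "\<dots> = (real CARD('n) + 1) ^ N * (c + (\<Sum>j\<in>UNIV. \<bar>x $ j\<bar> ^ N * c))"
    by (simp add: algebra_simps sum_distrib_left sum_distrib_right)
  also have "\<dots> \<le> (real CARD('n) + 1) ^ N * (B + (\<Sum>j\<in>(UNIV::'n set). B))"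
    using assms by (intro mult_left_mono add_mono sum_mono) auto
  also have "\<dots> = (real CARD('n) + 1) ^ Suc N * B" by (simp add: algebra_simps)
  finally show ?thesis .
qed

text \<open>The Schwartz space is the case of a one-point index set, so every closure property of
  families specialises to it.\<close>

lemma schwartz_iff_sfam: "f \<in> schwartz \<longleftrightarrow> sfam (\<lambda>_::unit. 1) (\<lambda>_. f)"
proof
  assume f: "f \<in> schwartz"
  have "\<exists>C\<ge>0. \<forall>x. wt x ^ N * cmod (iter_deriv js f x) \<le> C" for js N
  proof -
    have "\<exists>B. \<forall>x. cmod (complex_of_real (monomial \<alpha> x) * iter_deriv js f x) \<le> B" for \<alpha>
      using f unfolding schwartz_def bdd_above_def by blast
    then obtain B where B: "\<And>\<alpha> x. \<bar>monomial \<alpha> x\<bar> * cmod (iter_deriv js f x) \<le> B \<alpha>"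
      unfolding norm_mult norm_of_real by metis
    define D where "D = Max (insert (B (\<lambda>i. 0)) (range (\<lambda>j. B (\<lambda>i. if i = j then N else 0))))"
    have D: "B (\<lambda>i. 0) \<le> D" "\<And>j. B (\<lambda>i. if i = j then N else 0) \<le> D" unfolding D_def by (rule Max_ge; simp)+
    have "wt x ^ N * cmod (iter_deriv js f x) \<le> (real CARD('a) + 1) ^ Suc N * D" for x
    proof (rule wt_mult_le_monomials)
      show "cmod (iter_deriv js f x) \<le> D" using B[of "\<lambda>i. 0" x] D(1) by (simp add: monomial_0)
      show "\<bar>x $ j\<bar> ^ N * cmod (iter_deriv js f x) \<le> D" for j
        using B[of "\<lambda>i. if i = j then N else 0" x] D(2)[of j] by (simp add: monomial_single power_abs)
    qed auto
    then show ?thesis by (meson dual_order.trans mult_nonneg_nonneg norm_ge_zero wt_nonneg zero_le_power)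
  qed
  then show "sfam (\<lambda>_::unit. 1) (\<lambda>_. f)" using f unfolding sfam_def schwartz_def by auto
next
  assume f: "sfam (\<lambda>_::unit. 1) (\<lambda>_. f)"
  have "bdd_above (range (\<lambda>x. cmod (complex_of_real (monomial \<alpha> x) * iter_deriv js f x)))" for \<alpha> js
  proof -
    obtain C where C: "\<And>x. wt x ^ (\<Sum>j\<in>UNIV. \<alpha> j) * cmod (iter_deriv js f x) \<le> C"
      using sfamD[OF f, of "\<Sum>j\<in>UNIV. \<alpha> j" js] by auto
    have "cmod (complex_of_real (monomial \<alpha> x) * iter_deriv js f x) \<le> C" for x
      using C[of x] mult_right_mono[OF monomial_le_wt[of \<alpha> x] norm_ge_zero[of "iter_deriv js f x"]]
      by (simp add: norm_mult)
    then show ?thesis by (auto simp: bdd_above_def)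
  qed
  with f show "f \<in> schwartz" unfolding schwartz_def by (auto dest: sfam_smooth)
qed

lemma sfam_schwartz: assumes "sfam \<mu> G" shows "G p \<in> schwartz"
proof -
  have "sfam (\<lambda>_::unit. \<mu> p) (\<lambda>_. G p)" using sfam_comp[OF assms, of "\<lambda>_. p"] by simp
  then have "sfam (\<lambda>_::unit. 1) (\<lambda>_. G p)"
    by (rule sfam_cong_weight[of _ _ "\<bar>\<mu> p\<bar>"]) auto
  then show ?thesis by (simp add: schwartz_iff_sfam)
qed

lemma schwartz_smooth: "f \<in> schwartz \<Longrightarrow> smooth f"
  by (simp add: schwartz_def)

lemma schwartz_iter_bound:
  assumes "f \<in> schwartz"
  obtains C where "C \<ge> 0" "\<And>x. wt x ^ N * cmod (iter_deriv js f x) \<le> C"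
  using sfamD[OF assms[unfolded schwartz_iff_sfam], of N js] by auto

lemma schwartz_bound:
  assumes "f \<in> schwartz"
  obtains C where "C \<ge> 0" "\<And>x. wt x ^ N * cmod (f x) \<le> C"
  using schwartz_iter_bound[OF assms, of N "[]"] by auto

lemma schwartz_sfam: "f \<in> schwartz \<Longrightarrow> sfam (\<lambda>_. 1) (\<lambda>_. f)"
  unfolding schwartz_iff_sfam sfam_def by simp

lemma schwartz_add: "f \<in> schwartz \<Longrightarrow> g \<in> schwartz \<Longrightarrow> (\<lambda>x. f x + g x) \<in> schwartz"
  unfolding schwartz_iff_sfam by (rule sfam_add)

lemma schwartz_cmult: "f \<in> schwartz \<Longrightarrow> (\<lambda>x. c * f x) \<in> schwartz"
  unfolding schwartz_iff_sfam by (rule sfam_cmult)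

lemma schwartz_cnj: "f \<in> schwartz \<Longrightarrow> (\<lambda>x. cnj (f x)) \<in> schwartz"
  unfolding schwartz_iff_sfam by (rule sfam_cnj)

lemma schwartz_diff: "f \<in> schwartz \<Longrightarrow> g \<in> schwartz \<Longrightarrow> (\<lambda>x. f x - g x) \<in> schwartz"
  using schwartz_add[OF _ schwartz_cmult[of g "-1"], of f] by simp

lemma schwartz_0: "(\<lambda>x. 0) \<in> schwartz"
  unfolding schwartz_iff_sfam sfam_def by (auto simp: iter_deriv_const_0)

lemma schwartz_sum: "(\<And>i. i \<in> I \<Longrightarrow> f i \<in> schwartz) \<Longrightarrow> (\<lambda>x. \<Sum>i\<in>I. f i x) \<in> schwartz"
  by (induction I rule: infinite_finite_induct) (auto intro: schwartz_0 schwartz_add)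

lemma schwartz_mult_ofam: "ofam (\<lambda>_::unit. 1) (\<lambda>_. h) \<Longrightarrow> f \<in> schwartz \<Longrightarrow> (\<lambda>x. h x * f x) \<in> schwartz"
  unfolding schwartz_iff_sfam by (drule (1) sfam_mult) simp

lemma schwartz_ofam: assumes "f \<in> schwartz" shows "ofam (\<lambda>_::unit. 1) (\<lambda>_. f)"
  unfolding ofam_def
proof (intro conjI allI)
  fix js
  obtain C where "C \<ge> 0" "\<And>x. wt x ^ 0 * cmod (iter_deriv js f x) \<le> C"
    using schwartz_iter_bound[OF assms, of 0 js] by blast
  then show "\<exists>C\<ge>0. \<exists>N. \<forall>p::unit. \<forall>x. cmod (iter_deriv js f x) \<le> C * 1 * wt x ^ N"
    by (intro exI[of _ C] conjI exI[of _ 0]) auto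
qed (use assms in \<open>simp add: schwartz_smooth\<close>)

text \<open>Peetre's inequality: decay of \<open>f\<close> at \<open>x + a\<close> becomes decay in
  \<open>a\<close> at the price of growth in \<open>x\<close>, which is harmless in a multiplier.
  The decay of the kernel in the frequency difference comes from here.\<close>

lemma ofam_translate:
  fixes f :: "real ^ 'n::finite \<Rightarrow> complex"
  assumes "f \<in> schwartz"
  shows "ofam (\<lambda>a. inverse (wt a ^ N)) (\<lambda>a x. f (x + a))"
  unfolding ofam_def
proof (intro conjI allI)
  fix js
  obtain C where C: "C \<ge> 0" "\<And>x. wt x ^ N * cmod (iter_deriv js f x) \<le> C"
    using schwartz_iter_bound[OF assms, of N js] by blast
  have "cmod (iter_deriv js (\<lambda>x. f (x + a)) x) \<le> C * inverse (wt a ^ N) * wt x ^ N" for a x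
  proof -
    have "wt a ^ N \<le> (wt (x + a) * wt x) ^ N"
      using wt_diff_le[of "x + a" x] by (intro power_mono) auto
    then have "wt a ^ N * cmod (iter_deriv js f (x + a)) \<le> wt x ^ N * (wt (x + a) ^ N * cmod (iter_deriv js f (x + a)))"
      unfolding power_mult_distrib by (metis (no_types, lifting) mult.assoc mult.commute mult_right_mono norm_ge_zero)
    also have "\<dots> \<le> wt x ^ N * C" using C by (intro mult_left_mono) auto
    finally show ?thesis by (simp add: iter_deriv_translate field_simps)
  qed
  then show "\<exists>C\<ge>0. \<exists>N'. \<forall>a x. cmod (iter_deriv js (\<lambda>x. f (x + a)) x) \<le> C * inverse (wt a ^ N) * wt x ^ N'"
    using C by blast
qed (use assms in \<open>auto intro: smooth_translate schwartz_smooth\<close>)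

lemma schwartz_translate: assumes "f \<in> schwartz" shows "(\<lambda>x. f (x + a)) \<in> schwartz"
  unfolding schwartz_iff_sfam sfam_def
proof (intro conjI allI)
  fix js N
  obtain C where C: "C \<ge> 0" "\<And>x. wt x ^ N * cmod (iter_deriv js f x) \<le> C"
    using schwartz_iter_bound[OF assms, of N js] by blast
  have "wt x ^ N * cmod (iter_deriv js (\<lambda>x. f (x + a)) x) \<le> wt a ^ N * C * 1" for x
  proof -
    have "wt x ^ N \<le> (wt (x + a) * wt a) ^ N"
      using wt_diff_le[of "x + a" a] by (intro power_mono) auto
    then have "wt x ^ N * cmod (iter_deriv js f (x + a)) \<le> wt a ^ N * (wt (x + a) ^ N * cmod (iter_deriv js f (x + a)))"
      unfolding power_mult_distrib by (metis (no_types, lifting) mult.assoc mult.commute mult_right_mono norm_ge_zero)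
    also have "\<dots> \<le> wt a ^ N * C" using C by (intro mult_left_mono) auto
    finally show ?thesis by (simp add: iter_deriv_translate)
  qed
  then show "\<exists>C\<ge>0. \<forall>(p::unit) x. wt x ^ N * cmod (iter_deriv js (\<lambda>x. f (x + a)) x) \<le> C * 1"
    using C by (intro exI[of _ "wt a ^ N * C"]) auto
qed (use assms in \<open>auto intro: smooth_translate schwartz_smooth\<close>)

lemma schwartz_iter_deriv: "f \<in> schwartz \<Longrightarrow> iter_deriv js f \<in> schwartz"
  unfolding schwartz_def by (auto simp: iter_deriv_append[symmetric] intro: smooth_iter_deriv)

lemma schwartz_partial_deriv: "f \<in> schwartz \<Longrightarrow> partial_deriv j f \<in> schwartz"
  using schwartz_iter_deriv[of f "[j]"] by (simp add: iter_deriv_Cons)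


section \<open>Integration\<close>

text \<open>Since \<open>1 + (x \<bullet> b)^2\<close> is at most \<open>wt x ^ 2\<close> for each
  basis vector, the function is dominated by a product of one-dimensional functions
  \<open>1 / (1 + t^2)\<close>. The exponent \<open>2 * DIM\<close> is chosen for this
  factorisation.\<close>

lemma integrable_inverse_wt:
  "integrable lborel (\<lambda>x::'a::euclidean_space. inverse (wt x ^ (2 * DIM('a))))"
proof -
  have int1: "integrable lborel (\<lambda>x::real. inverse (1 + x\<^sup>2))"
    using integrable_inverse_1_plus_square by (simp add: set_integrable_def)
  have le: "inverse (wt x ^ (2 * DIM('a))) \<le> (\<Prod>b\<in>Basis. inverse (1 + (x \<bullet> b)\<^sup>2))" for x :: 'a
  proof -
    have sq: "1 + (x \<bullet> b)\<^sup>2 \<le> wt x ^ 2" if "b \<in> Basis" for b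
    proof -
      have "(x \<bullet> b)\<^sup>2 \<le> norm x ^ 2"
        using Basis_le_norm[OF that, of x] by (metis abs_norm_cancel power2_abs power2_le_iff_abs_le norm_ge_zero)
      moreover have "wt x ^ 2 = 1 + norm x ^ 2 + 2 * norm x" by (simp add: wt_def power2_sum)
      ultimately show ?thesis using norm_ge_zero[of x] by linarith
    qed
    have "(\<Prod>b\<in>(Basis :: 'a set). inverse (wt x ^ 2)) \<le> (\<Prod>b\<in>Basis. inverse (1 + (x \<bullet> b)\<^sup>2))"
      by (intro prod_mono conjI le_imp_inverse_le sq) (auto simp: add_pos_nonneg)
    then show ?thesis by (simp add: power_mult power_inverse)
  qed
  have "(\<integral>\<^sup>+x. ennreal (norm (inverse (wt (x::'a) ^ (2 * DIM('a))))) \<partial>lborel)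
      \<le> (\<integral>\<^sup>+x. (\<Prod>b\<in>Basis. ennreal (inverse (1 + ((x::'a) \<bullet> b)\<^sup>2))) \<partial>lborel)"
    using le by (intro nn_integral_mono) (auto simp: prod_ennreal intro!: ennreal_leI)
  also have "\<dots> = (\<Prod>b\<in>(Basis::'a set). (\<integral>\<^sup>+x. ennreal (inverse (1 + x\<^sup>2)) \<partial>lborel))"
    by (rule nn_integral_lborel_prod) auto
  also have "\<dots> < \<infinity>"
  proof -
    have "(\<integral>\<^sup>+x. ennreal (inverse (1 + x\<^sup>2)) \<partial>lborel) = ennreal (LINT x|lborel. inverse (1 + x\<^sup>2))"
      by (rule nn_integral_eq_integral[OF int1]) auto
    then show ?thesis by (simp add: ennreal_power less_top[symmetric])
  qed
  finally show ?thesis by (intro integrableI_bounded) auto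
qed

lemma integrable_wt_bound:
  fixes f :: "'a::euclidean_space \<Rightarrow> 'b::{banach, second_countable_topology}"
  assumes "f \<in> borel_measurable borel" "\<And>x. wt x ^ (2 * DIM('a)) * norm (f x) \<le> C"
  shows "integrable lborel f"
proof (rule Bochner_Integration.integrable_bound)
  show "integrable lborel (\<lambda>x::'a. C * inverse (wt x ^ (2 * DIM('a))))"
    using integrable_inverse_wt by auto
  have "norm (f x) \<le> C * inverse (wt x ^ (2 * DIM('a)))" for x
    using assms(2)[of x] by (simp add: field_simps)
  then show "AE x in lborel. norm (f x) \<le> norm (C * inverse (wt x ^ (2 * DIM('a))))"
    by (smt (verit) AE_I2 norm_ge_zero real_norm_def)
qed (use assms in auto)

lemma integral_wt_bound:
  fixes f :: "'a::euclidean_space \<Rightarrow> 'b::{banach, second_countable_topology}"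
  assumes "f \<in> borel_measurable borel" "\<And>x. wt x ^ (2 * DIM('a)) * norm (f x) \<le> C"
  shows "norm (\<integral>x. f x \<partial>lborel) \<le> C * (\<integral>x. inverse (wt (x::'a) ^ (2 * DIM('a))) \<partial>lborel)"
proof -
  have "norm (\<integral>x. f x \<partial>lborel) \<le> (\<integral>x. C * inverse (wt (x::'a) ^ (2 * DIM('a))) \<partial>lborel)"
  proof (rule Bochner_Integration.integral_norm_bound_integral)
    show "norm (f x) \<le> C * inverse (wt x ^ (2 * DIM('a)))" for x
      using assms(2)[of x] by (simp add: field_simps)
  qed (use integrable_inverse_wt integrable_wt_bound[OF assms] in auto)
  then show ?thesis by simp
qed

lemma integral_lborel_affine:
  fixes f :: "'a::euclidean_space \<Rightarrow> 'b::{banach, second_countable_topology}"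
  assumes [measurable]: "f \<in> borel_measurable borel" and "c \<noteq> 0"
  shows "(\<integral>x. f x \<partial>lborel) = \<bar>c\<bar> ^ DIM('a) *\<^sub>R (\<integral>x. f (t + c *\<^sub>R x) \<partial>lborel)"
proof -
  have "(\<integral>x. f x \<partial>lborel) = (\<integral>x. f x \<partial>density (distr lborel borel (\<lambda>x. t + c *\<^sub>R x)) (\<lambda>_. ennreal (\<bar>c\<bar> ^ DIM('a))))"
    using lborel_affine[OF assms(2), of t] by (simp add: ennreal_power)
  also have "\<dots> = (\<integral>x. (\<bar>c\<bar> ^ DIM('a)) *\<^sub>R f (t + c *\<^sub>R x) \<partial>lborel)"
    by (subst integral_density; simp add: integral_distr)
  finally show ?thesis by simp
qed

lemma integral_lborel_translate:
  fixes f :: "'a::euclidean_space \<Rightarrow> 'b::{banach, second_countable_topology}"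
  assumes "f \<in> borel_measurable borel"
  shows "(\<integral>x. f (x + a) \<partial>lborel) = (\<integral>x. f x \<partial>lborel)"
  using integral_lborel_affine[OF assms, of 1 a] by (simp add: add.commute)

text \<open>Dominated convergence for the remainder of the first-order expansion divided by
  \<open>norm h\<close>. The mean value inequality on the ball bounds this quotient by a multiple of
  \<open>B\<close>, uniformly in the increment.\<close>

lemma has_derivative_integral:
  fixes H :: "'w \<Rightarrow> real ^ 'n::finite \<Rightarrow> complex"
  assumes diff: "\<And>w s. H w differentiable (at s)"
    and meas: "\<And>j. (\<lambda>w. partial_deriv j (H w) s0) \<in> borel_measurable M"
    and int: "\<And>s. integrable M (\<lambda>w. H w s)"
    and bound: "\<And>w j s. s \<in> ball s0 r \<Longrightarrow> cmod (partial_deriv j (H w) s) \<le> B w"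
    and B: "integrable M B" and r: "r > 0"
  shows "((\<lambda>s. \<integral>w. H w s \<partial>M) has_derivative
           (\<lambda>h. \<Sum>j\<in>UNIV. (h $ j) *\<^sub>R (\<integral>w. partial_deriv j (H w) s0 \<partial>M))) (at s0)"
proof -
  have s0: "s0 \<in> ball s0 r" using r by simp
  have intp: "integrable M (\<lambda>w. partial_deriv j (H w) s0)" for j
    by (rule Bochner_Integration.integrable_bound[OF B meas])
      (use bound[OF s0] in \<open>smt (verit) AE_I2 norm_ge_zero real_norm_def\<close>)
  define D where "D w h = (\<Sum>j\<in>UNIV. (h $ j) *\<^sub>R partial_deriv j (H w) s0)" for w h
  have intD: "integrable M (\<lambda>w. D w h)" for h
    unfolding D_def using intp by auto
  have D_int: "(\<integral>w. D w h \<partial>M) = (\<Sum>j\<in>UNIV. (h $ j) *\<^sub>R (\<integral>w. partial_deriv j (H w) s0 \<partial>M))" for h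
    unfolding D_def using intp by (subst Bochner_Integration.integral_sum) auto
  have linear_bound: "cmod (\<Sum>j\<in>UNIV. (h $ j) *\<^sub>R partial_deriv j (H w) s) \<le> real CARD('n) * B w * norm h"
    if "s \<in> ball s0 r" for w h s
  proof -
    have "cmod (\<Sum>j\<in>UNIV. (h $ j) *\<^sub>R partial_deriv j (H w) s) \<le> (\<Sum>j\<in>(UNIV::'n set). norm h * B w)"
      using bound[OF that] component_le_norm_cart[of h]
      by (intro sum_norm_le) (auto intro!: mult_mono order_trans[OF norm_ge_zero])
    then show ?thesis by (simp add: mult_ac)
  qed
  have H_bound: "cmod (H w (s0 + h) - H w s0 - D w h) \<le> 2 * real CARD('n) * B w * norm h"
    if "norm h < r" for w h
  proof -
    have B0: "B w \<ge> 0" using bound[OF s0] norm_ge_zero order_trans by blast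
    have "cmod (H w (s0 + h) - H w s0) \<le> real CARD('n) * B w * norm (s0 + h - s0)"
    proof (rule differentiable_bound[OF convex_ball[of s0 r]])
      show "(H w has_derivative (\<lambda>h. \<Sum>j\<in>UNIV. (h $ j) *\<^sub>R partial_deriv j (H w) s)) (at s within ball s0 r)" for s
        by (rule has_derivative_at_withinI[OF differentiable_has_derivative_partial[OF diff]])
      show "onorm (\<lambda>h. \<Sum>j\<in>UNIV. (h $ j) *\<^sub>R partial_deriv j (H w) s) \<le> real CARD('n) * B w" if "s \<in> ball s0 r" for s
        using linear_bound[OF that] by (intro onorm_bound) (auto simp: B0)
    qed (use that r in \<open>auto simp: dist_norm\<close>)
    moreover have "cmod (D w h) \<le> real CARD('n) * B w * norm h"
      unfolding D_def by (rule linear_bound[OF s0])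
    ultimately show ?thesis
      using norm_triangle_ineq4[of "H w (s0 + h) - H w s0" "D w h"] by simp
  qed
  show ?thesis
    unfolding has_derivative_at
  proof
    show "bounded_linear (\<lambda>h. \<Sum>j\<in>UNIV. (h $ j) *\<^sub>R (\<integral>w. partial_deriv j (H w) s0 \<partial>M))"
      by (intro bounded_linear_sum bounded_linear_scaleR_const bounded_linear_vec_nth)
    show "(\<lambda>h. cmod ((\<integral>w. H w (s0 + h) \<partial>M) - (\<integral>w. H w s0 \<partial>M) -
        (\<Sum>j\<in>UNIV. (h $ j) *\<^sub>R (\<integral>w. partial_deriv j (H w) s0 \<partial>M))) / norm h) \<midarrow>0\<rightarrow> 0"
      unfolding tendsto_at_iff_sequentially comp_def
    proof (intro allI impI)
      fix X :: "nat \<Rightarrow> real ^ 'n" assume X0: "\<forall>i. X i \<in> UNIV - {0}" and X: "X \<longlonglongrightarrow> 0"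
      define q where "q i w = (H w (s0 + X i) - H w s0 - D w (X i)) /\<^sub>R norm (X i)" for i w
      have "\<forall>\<^sub>F i in sequentially. norm (X i) < r"
        using tendstoD[OF X r] by (simp add: dist_norm)
      then obtain i0 where i0: "\<And>i. i \<ge> i0 \<Longrightarrow> norm (X i) < r" by (auto simp: eventually_sequentially)
      \<comment> \<open>Shifted by \<open>i0\<close> so that all increments lie within radius
        \<open>r\<close>, where the domination holds.\<close>
      have "(\<lambda>i. \<integral>w. q (i + i0) w \<partial>M) \<longlonglongrightarrow> (\<integral>w. 0 \<partial>M)"
      proof (rule integral_dominated_convergence[where w="\<lambda>w. 2 * real CARD('n) * B w"])
        show "AE w in M. (\<lambda>i. q (i + i0) w) \<longlonglongrightarrow> 0"
        proof (rule AE_I2)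
          fix w
          have "(\<lambda>h. norm (H w (s0 + h) - H w s0 - D w h) / norm h) \<midarrow>0\<rightarrow> 0"
            using differentiable_has_derivative_partial[OF diff[of w s0]]
            unfolding has_derivative_at D_def by blast
          then have "(\<lambda>i. norm (H w (s0 + X i) - H w s0 - D w (X i)) / norm (X i)) \<longlonglongrightarrow> 0"
            unfolding tendsto_at_iff_sequentially comp_def using X0 X by blast
          then have "(\<lambda>i. norm (q i w)) \<longlonglongrightarrow> 0"
            unfolding q_def by (simp add: divide_inverse mult.commute)
          then have "(\<lambda>i. q i w) \<longlonglongrightarrow> 0" by (rule tendsto_norm_zero_cancel)
          then show "(\<lambda>i. q (i + i0) w) \<longlonglongrightarrow> 0" by (rule LIMSEQ_ignore_initial_segment)
        qed
        show "AE w in M. norm (q (i + i0) w) \<le> 2 * real CARD('n) * B w" for i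
        proof (rule AE_I2)
          fix w
          have "norm (X (i + i0)) > 0" using X0 by auto
          moreover have "norm (q (i + i0) w) = cmod (H w (s0 + X (i + i0)) - H w s0 - D w (X (i + i0))) / norm (X (i + i0))"
            unfolding q_def by (simp add: divide_inverse mult.commute)
          ultimately show "norm (q (i + i0) w) \<le> 2 * real CARD('n) * B w"
            using H_bound[OF i0[of "i + i0"], of w] by (simp add: pos_divide_le_eq)
        qed
        show "(\<lambda>w. q (i + i0) w) \<in> borel_measurable M" for i
          unfolding q_def using int intD
          by (intro borel_measurable_scaleR borel_measurable_diff borel_measurable_const)
            (auto intro: borel_measurable_integrable)
      qed (use B in auto)
      then have "(\<lambda>i. \<integral>w. q i w \<partial>M) \<longlonglongrightarrow> 0" by (simp add: LIMSEQ_offset)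
      then have "(\<lambda>i. norm (\<integral>w. q i w \<partial>M)) \<longlonglongrightarrow> 0" by (rule tendsto_norm_zero)
      moreover have "(\<integral>w. q i w \<partial>M) = ((\<integral>w. H w (s0 + X i) \<partial>M) - (\<integral>w. H w s0 \<partial>M) - (\<integral>w. D w (X i) \<partial>M)) /\<^sub>R norm (X i)" for i
        unfolding q_def using int intD by simp
      ultimately show "(\<lambda>i. cmod ((\<integral>w. H w (s0 + X i) \<partial>M) - (\<integral>w. H w s0 \<partial>M) -
        (\<Sum>j\<in>UNIV. (X i $ j) *\<^sub>R (\<integral>w. partial_deriv j (H w) s0 \<partial>M))) / norm (X i)) \<longlonglongrightarrow> 0"
        by (simp add: D_int divide_inverse mult.commute)
    qed
  qed
qed

text \<open>Every iterated derivative of the integrand is dominated as well, so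
  \<open>has_derivative_integral\<close> applies at each order. The bounds hold for all
  \<open>s\<close>, so the radius used below is arbitrary.\<close>

lemma smooth_integral:
  fixes H :: "'w \<Rightarrow> real ^ 'n::finite \<Rightarrow> complex"
  assumes smooth: "\<And>w. smooth (H w)"
    and meas: "\<And>js s. (\<lambda>w. iter_deriv js (H w) s) \<in> borel_measurable M"
    and bound: "\<And>js. \<exists>B. integrable M B \<and> (\<forall>w s. cmod (iter_deriv js (H w) s) \<le> B w)"
  shows "smooth (\<lambda>s. \<integral>w. H w s \<partial>M)"
    and "iter_deriv js (\<lambda>s. \<integral>w. H w s \<partial>M) = (\<lambda>s. \<integral>w. iter_deriv js (H w) s \<partial>M)"
proof -
  have int: "integrable M (\<lambda>w. iter_deriv js (H w) s)" for js s
  proof -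
    obtain B where B: "integrable M B" "\<And>w s. cmod (iter_deriv js (H w) s) \<le> B w" using bound by blast
    then have "cmod (iter_deriv js (H w) s) \<le> norm (B w)" for w
      using order_trans[OF B(2) abs_ge_self] by simp
    then show ?thesis
      by (intro Bochner_Integration.integrable_bound[OF B(1) meas] AE_I2)
  qed
  have D: "((\<lambda>s. \<integral>w. iter_deriv js (H w) s \<partial>M) has_derivative
           (\<lambda>h. \<Sum>j\<in>UNIV. (h $ j) *\<^sub>R (\<integral>w. iter_deriv (j # js) (H w) s0 \<partial>M))) (at s0)" for js s0
  proof -
    have "\<exists>B. \<forall>j. integrable M (B j) \<and> (\<forall>w s. cmod (iter_deriv (j # js) (H w) s) \<le> B j w)"
      by (intro choice allI bound)
    then obtain B where B: "\<And>j. integrable M (B j)" "\<And>j w s. cmod (iter_deriv (j # js) (H w) s) \<le> B j w"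
      by blast
    show ?thesis unfolding iter_deriv_Cons
    proof (rule has_derivative_integral[where B="\<lambda>w. \<Sum>j\<in>UNIV. B j w" and r=1])
      show "cmod (partial_deriv j (iter_deriv js (H w)) s) \<le> (\<Sum>j\<in>UNIV. B j w)" for w j s
      proof -
        have "B j w \<le> (\<Sum>j\<in>UNIV. B j w)"
          using B(2) by (intro member_le_sum) (auto intro: order_trans[OF norm_ge_zero])
        then show ?thesis using B(2)[of j w s] by (simp add: iter_deriv_Cons)
      qed
      show "(\<lambda>w. partial_deriv j (iter_deriv js (H w)) s0) \<in> borel_measurable M" for j
        using meas[of "j # js" s0] by (simp add: iter_deriv_Cons)
    qed (use smooth B int in \<open>auto intro: smooth_iter_deriv_differentiable\<close>)
  qed
  show *: "iter_deriv js (\<lambda>s. \<integral>w. H w s \<partial>M) = (\<lambda>s. \<integral>w. iter_deriv js (H w) s \<partial>M)" for js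
  proof (induction js)
    case (Cons j js)
    show ?case unfolding iter_deriv_Cons[of j js "\<lambda>s. \<integral>w. H w s \<partial>M"] Cons
    proof
      fix s
      have "(\<Sum>i\<in>UNIV. (axis j (1::real) $ i) *\<^sub>R (\<integral>w. iter_deriv (i # js) (H w) s \<partial>M)) =
          (\<Sum>i\<in>UNIV. if i = j then \<integral>w. iter_deriv (i # js) (H w) s \<partial>M else 0)"
        by (intro sum.cong) (auto simp: axis_def)
      then show "partial_deriv j (\<lambda>s. \<integral>w. iter_deriv js (H w) s \<partial>M) s = (\<integral>w. iter_deriv (j # js) (H w) s \<partial>M)"
        by (subst has_derivative_partial_deriv[OF D]) simp
    qed
  qed auto
  show "smooth (\<lambda>s. \<integral>w. H w s \<partial>M)"
    unfolding smooth_def * differentiable_on_def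
    using D by (auto simp: differentiable_def intro: has_derivative_at_withinI)
qed

lemma continuous_on_integral:
  fixes H :: "'a::metric_space \<Rightarrow> 'w \<Rightarrow> complex"
  assumes cont: "\<And>w. continuous_on UNIV (\<lambda>x. H x w)"
    and meas: "\<And>x. H x \<in> borel_measurable M"
    and bound: "\<And>x w. cmod (H x w) \<le> B w" and B: "integrable M B"
  shows "continuous_on UNIV (\<lambda>x. \<integral>w. H x w \<partial>M)"
  unfolding continuous_on_sequentially comp_def
proof (intro ballI allI impI, elim conjE)
  fix X :: "nat \<Rightarrow> 'a" and x assume X: "X \<longlonglongrightarrow> x"
  show "(\<lambda>i. \<integral>w. H (X i) w \<partial>M) \<longlonglongrightarrow> (\<integral>w. H x w \<partial>M)"
  proof (rule integral_dominated_convergence[OF meas meas B])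
    show "AE w in M. (\<lambda>i. H (X i) w) \<longlonglongrightarrow> H x w"
      by (intro AE_I2 continuous_on_tendsto_compose[OF cont X]) auto
  qed (use bound in auto)
qed

lemma schwartz_measurable: "f \<in> schwartz \<Longrightarrow> f \<in> borel_measurable borel"
  by (intro smooth_measurable schwartz_smooth)

lemma schwartz_continuous_on: "f \<in> schwartz \<Longrightarrow> continuous_on S f"
  by (intro smooth_continuous_on schwartz_smooth)

lemma schwartz_integrable: assumes "f \<in> schwartz" shows "integrable lborel f"
proof -
  obtain C where "\<And>x. wt x ^ (2 * DIM(real ^ 'a)) * norm (f x) \<le> C"
    using schwartz_bound[OF assms, of "2 * DIM(real ^ 'a)"] by blast
  then show ?thesis by (intro integrable_wt_bound schwartz_measurable assms)
qed

text \<open>By translation invariance the integral of \<open>f (w + s)\<close> over \<open>w\<close>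
  does not depend on \<open>s\<close>; differentiating under the integral at \<open>s = 0\<close>
  gives the claim. This is the form of integration by parts used throughout.\<close>

lemma integral_partial_deriv_eq_0:
  fixes f :: "real ^ 'n::finite \<Rightarrow> complex"
  assumes f: "f \<in> schwartz"
  shows "(\<integral>x. partial_deriv j f x \<partial>lborel) = 0"
proof -
  define N where "N = 2 * DIM(real ^ 'n)"
  have "\<exists>C. \<forall>j. C j \<ge> 0 \<and> (\<forall>x. wt x ^ N * cmod (partial_deriv j f x) \<le> C j)"
    by (intro choice allI) (metis schwartz_bound schwartz_partial_deriv f)
  then obtain C where C: "\<And>j. C j \<ge> 0" "\<And>j x. wt x ^ N * cmod (partial_deriv j f x) \<le> C j" by blast
  \<comment> \<open>For \<open>norm s < 1\<close> the weights satisfy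
    \<open>wt w \<le> 2 * wt (w + s)\<close>, whence \<open>2 ^ N\<close>; the sum over
    \<open>j\<close> makes one bound serve all directions.\<close>
  define B where "B w = (2 ^ N * (\<Sum>j\<in>UNIV. C j)) * inverse (wt (w::real^'n) ^ N)" for w
  have tr: "partial_deriv j (\<lambda>s. f (w + s)) = (\<lambda>s. partial_deriv j f (w + s))" for w j
    using iter_deriv_translate[of "[j]" f w] by (simp add: iter_deriv_Cons add.commute)
  have "((\<lambda>s. \<integral>w. f (w + s) \<partial>lborel) has_derivative
      (\<lambda>h. \<Sum>j\<in>UNIV. (h $ j) *\<^sub>R (\<integral>w. partial_deriv j (\<lambda>s. f (w + s)) 0 \<partial>lborel))) (at 0)"
  proof (rule has_derivative_integral[where r=1 and B=B])
    show "(\<lambda>s. f (w + s)) differentiable (at s)" for w s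
      using smooth_differentiable[OF smooth_translate[OF schwartz_smooth[OF f], of w]]
      by (simp add: add.commute)
    show "(\<lambda>w. partial_deriv j (\<lambda>s. f (w + s)) 0) \<in> borel_measurable lborel" for j
      unfolding tr using schwartz_measurable[OF schwartz_partial_deriv[OF f]] by simp
    show "integrable lborel (\<lambda>w. f (w + s))" for s
      by (rule schwartz_integrable[OF schwartz_translate[OF f]])
    show "integrable lborel B" unfolding B_def N_def using integrable_inverse_wt[where 'a="real ^ 'n"] by auto
    fix w j and s :: "real ^ 'n" assume "s \<in> ball 0 1"
    then have "wt s \<le> 2" by (simp add: wt_def dist_norm)
    then have "wt (w + s) * wt s \<le> wt (w + s) * 2" by (intro mult_left_mono) auto
    then have "wt w \<le> wt (w + s) * 2" using wt_diff_le[of "w + s" s] order_trans by fastforce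
    then have "wt w ^ N \<le> wt (w + s) ^ N * 2 ^ N"
      unfolding power_mult_distrib[symmetric] by (intro power_mono) auto
    then have "wt w ^ N * cmod (partial_deriv j f (w + s)) \<le> 2 ^ N * (wt (w + s) ^ N * cmod (partial_deriv j f (w + s)))"
      by (metis (no_types, lifting) mult.assoc mult.commute mult_right_mono norm_ge_zero)
    also have "\<dots> \<le> 2 ^ N * (\<Sum>j\<in>UNIV. C j)"
      using C(1) order_trans[OF C(2) member_le_sum[of j UNIV C]]
      by (intro mult_left_mono) auto
    finally show "cmod (partial_deriv j (\<lambda>s. f (w + s)) s) \<le> B w"
      unfolding tr B_def by (simp add: field_simps)
  qed auto
  then have "partial_deriv j (\<lambda>s. \<integral>w. f (w + s) \<partial>lborel) 0 =
    (\<Sum>i\<in>UNIV. (axis j (1::real) $ i) *\<^sub>R (\<integral>w. partial_deriv i (\<lambda>s. f (w + s)) 0 \<partial>lborel))"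
    by (rule has_derivative_partial_deriv)
  also have "\<dots> = (\<Sum>i\<in>UNIV. if i = j then \<integral>w. partial_deriv i f w \<partial>lborel else 0)"
    by (intro sum.cong) (auto simp: axis_def tr)
  also have "\<dots> = (\<integral>w. partial_deriv j f w \<partial>lborel)" by simp
  also have "(\<lambda>s. \<integral>w. f (w + s) \<partial>lborel) = (\<lambda>s. \<integral>w. f w \<partial>lborel)"
    by (intro ext integral_lborel_translate schwartz_measurable f)
  finally show ?thesis by simp
qed


section \<open>Multipliers\<close>

text \<open>The bound for the function and those for its derivatives may be proved by different
  means. For the polynomial increments in \<open>ofam_poly_coord_diff\<close> this is decisive: only
  the order zero part needs the mean value theorem.\<close>

lemma ofamI_partial_deriv:
  assumes "\<And>p x. G p differentiable (at x)"
    and "\<exists>C\<ge>0. \<exists>N. \<forall>p x. cmod (G p x) \<le> C * \<mu> p * wt x ^ N"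
    and "\<And>j. ofam \<mu> (\<lambda>p. partial_deriv j (G p))"
  shows "ofam \<mu> G"
  unfolding ofam_def smooth_def
proof (intro conjI allI)
  fix p js show "iter_deriv js (G p) differentiable_on UNIV"
  proof (cases js rule: rev_cases)
    case (snoc ks j)
    then show ?thesis using ofam_smooth[OF assms(3)] by (auto simp: iter_deriv_snoc smooth_def)
  qed (use assms(1) in \<open>auto simp: differentiable_on_def intro: differentiable_at_withinI\<close>)
next
  fix js show "\<exists>C\<ge>0. \<exists>N. \<forall>p x. cmod (iter_deriv js (G p) x) \<le> C * \<mu> p * wt x ^ N"
  proof (cases js rule: rev_cases)
    case (snoc ks j)
    then show ?thesis using assms(3)[of j] by (auto simp: iter_deriv_snoc ofam_def)
  qed (use assms(2) in auto)
qed

lemma ofam_mult: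
  fixes h G :: "'p \<Rightarrow> real ^ 'n::finite \<Rightarrow> complex"
  assumes "ofam \<nu> h" "ofam \<mu> G"
  shows "ofam (\<lambda>p. \<nu> p * \<mu> p) (\<lambda>p x. h p x * G p x)"
proof -
  have "\<exists>C\<ge>0. \<exists>N. \<forall>p x. cmod (iter_deriv js (\<lambda>x. h p x * G p x) x) \<le> C * (\<nu> p * \<mu> p) * wt x ^ N" for js
    using assms
  proof (induction js arbitrary: h G rule: rev_induct)
    case Nil
    obtain C1 N1 where C1: "C1 \<ge> 0" "\<And>p x. cmod (h p x) \<le> C1 * \<nu> p * wt x ^ N1"
      using ofam_boundD[OF Nil(1)] by metis
    obtain C2 N2 where C2: "C2 \<ge> 0" "\<And>p x. cmod (G p x) \<le> C2 * \<mu> p * wt x ^ N2"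
      using ofam_boundD[OF Nil(2)] by metis
    have "cmod (h p x * G p x) \<le> (C1 * C2) * (\<nu> p * \<mu> p) * wt x ^ (N1 + N2)" for p x
    proof -
      have "cmod (h p x * G p x) \<le> (C1 * \<nu> p * wt x ^ N1) * (C2 * \<mu> p * wt x ^ N2)"
        unfolding norm_mult using C1(2)[of p x] C2(2) by (intro mult_mono) (auto intro: order_trans[OF norm_ge_zero])
      then show ?thesis by (simp add: mult_ac power_add)
    qed
    then show ?case using C1(1) C2(1) by (intro exI[of _ "C1 * C2"]) auto
  next
    case (snoc j js)
    obtain C1 N1 where C1: "C1 \<ge> 0" "\<And>p x. cmod (iter_deriv js (\<lambda>x. h p x * partial_deriv j (G p) x) x) \<le> C1 * (\<nu> p * \<mu> p) * wt x ^ N1"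
      using snoc.IH[OF snoc.prems(1) ofam_partial_deriv[OF snoc.prems(2)]] by blast
    obtain C2 N2 where C2: "C2 \<ge> 0" "\<And>p x. cmod (iter_deriv js (\<lambda>x. partial_deriv j (h p) x * G p x) x) \<le> C2 * (\<nu> p * \<mu> p) * wt x ^ N2"
      using snoc.IH[OF ofam_partial_deriv[OF snoc.prems(1)] snoc.prems(2)] by blast
    have "cmod (iter_deriv (js @ [j]) (\<lambda>x. h p x * G p x) x) \<le> (C1 + C2) * (\<nu> p * \<mu> p) * wt x ^ (N1 + N2)" for p x
    proof -
      have s: "smooth (h p)" "smooth (G p)" using snoc.prems by (auto intro: ofam_smooth)
      have step: "a \<le> C * M * wt x ^ (N1 + N2)" if "a \<le> C * M * wt x ^ N" "N \<le> N1 + N2" "0 \<le> a" for a C M N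
      proof -
        have "0 \<le> C * M"
          using order_trans[OF that(3,1)] by (simp add: zero_le_mult_iff) (use wt_pos[of x] in \<open>smt (verit) zero_less_power\<close>)
        then have "C * M * wt x ^ N \<le> C * M * wt x ^ (N1 + N2)"
          using that(2) by (intro mult_left_mono power_increasing) auto
        with that(1) show ?thesis by simp
      qed
      have "cmod (iter_deriv (js @ [j]) (\<lambda>x. h p x * G p x) x) \<le>
          cmod (iter_deriv js (\<lambda>x. h p x * partial_deriv j (G p) x) x) +
          cmod (iter_deriv js (\<lambda>x. partial_deriv j (h p) x * G p x) x)"
        unfolding iter_deriv_snoc partial_deriv_smooth_mult[OF s]
        using s by (subst iter_deriv_add)
          (auto intro: smooth_mult smooth_partial_deriv norm_triangle_ineq)
      also have "\<dots> \<le> (C1 + C2) * (\<nu> p * \<mu> p) * wt x ^ (N1 + N2)"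
        using step[OF C1(2)[of p x]] step[OF C2(2)[of p x]] by (simp add: algebra_simps)
      finally show ?thesis .
    qed
    then show ?case using C1(1) C2(1) by (intro exI[of _ "C1 + C2"]) auto
  qed
  then show ?thesis
    using assms unfolding ofam_def[of _ "\<lambda>p x. h p x * G p x"] by (auto intro: smooth_mult ofam_smooth)
qed

lemma coord_has_derivative: "((\<lambda>x. complex_of_real (x $ j)) has_derivative (\<lambda>h. complex_of_real (h $ j))) (at x)"
  by (intro has_derivative_of_real bounded_linear.has_derivative[OF bounded_linear_vec_nth] has_derivative_ident)

lemma ofam_coord: "ofam (\<lambda>_. 1) (\<lambda>_ (x::real^'n::finite). complex_of_real (x $ j))"
proof (rule ofamI_partial_deriv)
  fix i
  have "partial_deriv i (\<lambda>x::real^'n. complex_of_real (x $ j)) = (\<lambda>x. if i = j then 1 else 0)"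
    by (rule ext, subst has_derivative_partial_deriv[OF coord_has_derivative]) (simp add: axis_def)
  then show "ofam (\<lambda>_. 1) (\<lambda>_. partial_deriv i (\<lambda>x::real^'n. complex_of_real (x $ j)))"
    by (auto intro!: ofam_const)
next
  show "\<exists>C\<ge>0. \<exists>N. \<forall>p (x::real^'n). cmod (complex_of_real (x $ j)) \<le> C * 1 * wt x ^ N"
    by (intro exI[of _ 1] conjI exI[of _ 1]) (auto simp: wt_component_le)
qed (use coord_has_derivative in \<open>auto simp: differentiable_def\<close>)

text \<open>Every derivative of a solution \<open>E\<close> of \<open>\<partial>_j E = a_j E\<close> is \<open>E\<close> times a multiplier; this covers
  exponentials of imaginary polynomials.\<close>

lemma ofam_exponential:
  fixes E :: "real ^ 'n::finite \<Rightarrow> complex"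
  assumes diff: "\<And>x. E differentiable (at x)" and bound: "\<And>x. cmod (E x) \<le> 1"
    and a: "\<And>j. ofam (\<lambda>_::unit. 1) (\<lambda>_. a j)"
    and deriv: "\<And>j. partial_deriv j E = (\<lambda>x. a j x * E x)"
  shows "ofam (\<lambda>_::unit. 1) (\<lambda>_. E)"
proof -
  define Q where "Q = {\<lambda>x. P x * E x | P. ofam (\<lambda>_::unit. 1) (\<lambda>_. P)}"
  have Qd: "partial_deriv j (\<lambda>x. P x * E x) = (\<lambda>x. (P x * a j x + partial_deriv j P x) * E x)"
    "ofam (\<lambda>_::unit. 1) (\<lambda>_ x. P x * a j x + partial_deriv j P x)"
    if "ofam (\<lambda>_::unit. 1) (\<lambda>_. P)" for P j
  proof -
    show "partial_deriv j (\<lambda>x. P x * E x) = (\<lambda>x. (P x * a j x + partial_deriv j P x) * E x)"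
      using ofam_smooth[OF that] diff
      by (auto simp: partial_deriv_mult smooth_differentiable deriv algebra_simps)
    show "ofam (\<lambda>_::unit. 1) (\<lambda>_ x. P x * a j x + partial_deriv j P x)"
      using ofam_add[OF ofam_mult[OF that a[of j]] , of "\<lambda>_. partial_deriv j P"] ofam_partial_deriv[OF that]
      by simp
  qed
  have one: "ofam (\<lambda>_::unit. 1) (\<lambda>_ (x::real^'n). 1)" by (rule ofam_const) auto
  have smooth: "smooth f" if "f \<in> Q" for f
  proof (rule smooth_coinduct[of _ Q])
    show "h differentiable (at x)" if h: "h \<in> Q" for h x
    proof -
      obtain P where P: "h = (\<lambda>x. P x * E x)" "ofam (\<lambda>_::unit. 1) (\<lambda>_. P)"
        using h unfolding Q_def by auto
      show ?thesis
        unfolding P(1) by (intro differentiable_mult diff smooth_differentiable ofam_smooth[OF P(2)])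
    qed
    show "partial_deriv j h \<in> Q" if h: "h \<in> Q" for h j
    proof -
      obtain P where P: "h = (\<lambda>x. P x * E x)" "ofam (\<lambda>_::unit. 1) (\<lambda>_. P)"
        using h unfolding Q_def by auto
      show ?thesis
        unfolding P(1) Qd(1)[OF P(2)] Q_def
        by (intro CollectI exI[of _ "\<lambda>x. P x * a j x + partial_deriv j P x"] conjI refl Qd(2) P(2))
    qed
  qed (use that in auto)
  have bd: "\<exists>C\<ge>0. \<exists>N. \<forall>x. cmod (iter_deriv js (\<lambda>x. P x * E x) x) \<le> C * wt x ^ N"
    if "ofam (\<lambda>_::unit. 1) (\<lambda>_. P)" for js P
    using that
  proof (induction js arbitrary: P rule: rev_induct)
    case Nil
    obtain C N where C: "C \<ge> 0" "\<And>x. cmod (P x) \<le> C * wt x ^ N"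
      using ofam_boundD[OF Nil] by (metis mult.right_neutral)
    have "cmod (P x * E x) \<le> C * wt x ^ N" for x
      unfolding norm_mult using mult_left_le[OF bound[of x] norm_ge_zero[of "P x"]] C(2)[of x] by linarith
    then show ?case using C(1) by auto
  next
    case (snoc j js)
    show ?case unfolding iter_deriv_snoc Qd(1)[OF snoc.prems] by (rule snoc.IH[OF Qd(2)[OF snoc.prems]])
  qed
  have "E \<in> Q" unfolding Q_def using one by (auto intro!: exI[of _ "\<lambda>x. 1"])
  then show ?thesis unfolding ofam_def using smooth bd[OF one] by simp
qed

lemma cis_inner_has_derivative:
  "((\<lambda>x. c * cis (x \<bullet> \<eta>)) has_derivative (\<lambda>h. \<i> * complex_of_real (h \<bullet> \<eta>) * (c * cis (x \<bullet> \<eta>)))) (at x)"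
proof -
  have "((\<lambda>x. \<i> * complex_of_real (x \<bullet> \<eta>)) has_derivative (\<lambda>h. \<i> * complex_of_real (h \<bullet> \<eta>))) (at x)"
    by (intro has_derivative_mult_right has_derivative_of_real has_derivative_inner_left has_derivative_ident)
  from has_derivative_compose[OF this DERIV_exp[unfolded has_field_derivative_def]]
  have "((\<lambda>x. cis (x \<bullet> \<eta>)) has_derivative (\<lambda>h. cis (x \<bullet> \<eta>) * (\<i> * complex_of_real (h \<bullet> \<eta>)))) (at x)"
    unfolding cis_conv_exp .
  from has_derivative_mult_right[OF this, of c] show ?thesis by (simp add: mult_ac)
qed

lemma partial_deriv_cis_inner:
  "partial_deriv j (\<lambda>x. c * cis (x \<bullet> \<eta>)) = (\<lambda>x. \<i> * complex_of_real (\<eta> $ j) * c * cis (x \<bullet> \<eta>))"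
  by (rule ext, subst has_derivative_partial_deriv[OF cis_inner_has_derivative])
    (simp add: inner_axis' )

text \<open>The symbol of \<open>iter_deriv js\<close>. Derivatives of a Fourier transform use it at
  \<open>- x\<close>, because of the sign in the exponent.\<close>

definition freq_monomial :: "'n::finite list \<Rightarrow> real ^ 'n \<Rightarrow> complex" where
  "freq_monomial js \<eta> = prod_list (map (\<lambda>j. \<i> * complex_of_real (\<eta> $ j)) js)"

lemma iter_deriv_cis_inner:
  "iter_deriv js (\<lambda>x. c * cis (x \<bullet> \<eta>)) = (\<lambda>x. freq_monomial js \<eta> * c * cis (x \<bullet> \<eta>))"
proof (induction js)
  case (Cons j js)
  then show ?case unfolding iter_deriv_Cons Cons partial_deriv_cis_inner
    by (simp add: freq_monomial_def mult_ac)
qed (simp add: freq_monomial_def)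

lemma ofam_cis_inner: "ofam (\<lambda>_::unit. 1) (\<lambda>_ x. cis (x \<bullet> (\<eta>::real^'n::finite)))"
proof -
  have "ofam (\<lambda>_::unit. 1) (\<lambda>_ x. cis (x \<bullet> \<eta>))"
  proof (rule ofam_exponential[where a="\<lambda>j x. \<i> * complex_of_real (\<eta> $ j)"])
    show "(\<lambda>x. cis (x \<bullet> \<eta>)) differentiable (at x)" for x
      using cis_inner_has_derivative[of 1 \<eta> x] by (auto simp: differentiable_def)
    show "partial_deriv j (\<lambda>x. cis (x \<bullet> \<eta>)) = (\<lambda>x. \<i> * complex_of_real (\<eta> $ j) * cis (x \<bullet> \<eta>))" for j
      using partial_deriv_cis_inner[of j 1 \<eta>] by simp
    fix j
    have "ofam (\<lambda>_::unit. \<bar>\<eta> $ j\<bar>) (\<lambda>_ (x::real^'n). \<i> * complex_of_real (\<eta> $ j))"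
      by (rule ofam_const) (simp add: norm_mult)
    then show "ofam (\<lambda>_::unit. 1) (\<lambda>_ (x::real^'n). \<i> * complex_of_real (\<eta> $ j))"
      unfolding ofam_def by (auto) (meson abs_ge_zero mult_nonneg_nonneg)
  qed auto
  then show ?thesis .
qed

lemma schwartz_modulate: "f \<in> schwartz \<Longrightarrow> (\<lambda>x. cis (x \<bullet> \<eta>) * f x) \<in> schwartz"
  by (rule schwartz_mult_ofam[OF ofam_cis_inner])

lemma smooth_cis_inner: "smooth (\<lambda>x. c * cis (x \<bullet> \<eta>))"
  by (intro smooth_mult smooth_const ofam_smooth[OF ofam_cis_inner])


section \<open>The Fourier transform\<close>

lemma fourier_bound:
  "\<exists>K\<ge>0. \<forall>(f :: real ^ 'n::finite \<Rightarrow> complex) B \<xi>. f \<in> borel_measurable borel \<longrightarrow>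
     (\<forall>x. wt x ^ (2 * DIM(real ^ 'n)) * cmod (f x) \<le> B) \<longrightarrow> cmod (fourier f \<xi>) \<le> K * B"
proof -
  define c where "c = (2 * pi) powr (- real CARD('n) / 2)"
  define I where "I = (\<integral>x. inverse (wt (x::real^'n) ^ (2 * DIM(real ^ 'n))) \<partial>lborel)"
  have I: "I \<ge> 0" unfolding I_def by (intro Bochner_Integration.integral_nonneg) auto
  have c: "c \<ge> 0" unfolding c_def by simp
  have "cmod (fourier f \<xi>) \<le> (c * I) * B"
    if f: "f \<in> borel_measurable borel" "\<And>x. wt x ^ (2 * DIM(real ^ 'n)) * cmod (f x) \<le> B"
    for f :: "real ^ 'n \<Rightarrow> complex" and B \<xi>
  proof -
    have "cmod (\<integral>x. f x * cis (- (x \<bullet> \<xi>)) \<partial>lborel) \<le> B * I" unfolding I_def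
      by (rule integral_wt_bound) (use f in \<open>auto simp: norm_mult cis_conv_exp\<close>)
    then have "c * cmod (\<integral>x. f x * cis (- (x \<bullet> \<xi>)) \<partial>lborel) \<le> c * (B * I)" using c by (rule mult_left_mono)
    then show ?thesis unfolding fourier_def norm_mult norm_of_real c_def[symmetric] using c by (simp add: mult_ac)
  qed
  then show ?thesis using I c by (intro exI[of _ "c * I"]) auto
qed

lemma sfam_coord_mult: "sfam \<mu> G \<Longrightarrow> sfam \<mu> (\<lambda>p x. complex_of_real (x $ j) * G p x)"
  using sfam_mult[OF ofam_coord] by fastforce

lemma sfam_freq_monomial_mult: "sfam \<mu> G \<Longrightarrow> sfam \<mu> (\<lambda>p x. freq_monomial js (- x) * G p x)"
proof (induction js)
  case (Cons j js)
  from sfam_cmult[OF sfam_coord_mult[OF Cons.IH[OF Cons.prems], of j], of "- \<i>"]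
  show ?case by (simp add: freq_monomial_def mult_ac)
qed (simp add: freq_monomial_def)

lemma schwartz_freq_monomial_mult: "f \<in> schwartz \<Longrightarrow> (\<lambda>x. freq_monomial js (- x) * f x) \<in> schwartz"
  unfolding schwartz_iff_sfam by (rule sfam_freq_monomial_mult)

lemma
  fixes f :: "real ^ 'n::finite \<Rightarrow> complex"
  assumes f: "f \<in> schwartz"
  shows smooth_fourier: "smooth (fourier f)"
    and iter_deriv_fourier: "iter_deriv js (fourier f) = fourier (\<lambda>x. freq_monomial js (- x) * f x)"
proof -
  define c where "c = complex_of_real ((2 * pi) powr (- real CARD('n) / 2))"
  define H where "H x \<xi> = f x * cis (\<xi> \<bullet> (- x))" for x \<xi>
  have four: "fourier g = (\<lambda>\<xi>. c * (\<integral>x. g x * cis (\<xi> \<bullet> (- x)) \<partial>lborel))" for g :: "real ^ 'n \<Rightarrow> complex"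
    by (rule ext) (simp add: fourier_def c_def inner_commute)
  have iter: "iter_deriv js (H x) = (\<lambda>\<xi>. freq_monomial js (- x) * f x * cis (\<xi> \<bullet> (- x)))" for js x
    unfolding H_def by (rule iter_deriv_cis_inner)
  have smH: "smooth (H x)" for x
    unfolding H_def by (rule smooth_cis_inner)
  have meas: "(\<lambda>x. iter_deriv js (H x) \<xi>) \<in> borel_measurable lborel" for js \<xi>
    unfolding iter using schwartz_measurable[OF schwartz_freq_monomial_mult[OF f, of js]]
    by (simp add: cis_conv_exp)
  have bd: "\<exists>B. integrable lborel B \<and> (\<forall>x \<xi>. cmod (iter_deriv js (H x) \<xi>) \<le> B x)" for js
    unfolding iter using schwartz_integrable[OF schwartz_freq_monomial_mult[OF f, of js]]
    by (intro exI[of _ "\<lambda>x. cmod (freq_monomial js (- x) * f x)"] conjI integrable_norm) (auto simp: norm_mult)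
  note S = smooth_integral[of H, OF smH meas bd]
  show "smooth (fourier f)" unfolding four
    using smooth_mult[OF smooth_const S(1)] unfolding H_def .
  have "iter_deriv js (fourier f) = (\<lambda>\<xi>. c * iter_deriv js (\<lambda>\<xi>. \<integral>x. H x \<xi> \<partial>lborel) \<xi>)"
    unfolding four H_def[symmetric] by (rule iter_deriv_bounded_linear[OF bounded_linear_mult_right S(1)])
  then show "iter_deriv js (fourier f) = fourier (\<lambda>x. freq_monomial js (- x) * f x)"
    unfolding four S(2) iter by simp
qed

lemma fourier_partial_deriv:
  assumes f: "f \<in> schwartz"
  shows "fourier (partial_deriv j f) \<xi> = \<i> * complex_of_real (\<xi> $ j) * fourier f \<xi>"
proof -
  define e where "e x = cis (x \<bullet> (- \<xi>))" for x :: "real ^ 'a"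
  have e: "e x = 1 * cis (x \<bullet> (- \<xi>))" for x unfolding e_def by simp
  have sm: "smooth e" unfolding e_def by (rule ofam_smooth[OF ofam_cis_inner])
  have de: "partial_deriv j e = (\<lambda>x. - \<i> * complex_of_real (\<xi> $ j) * e x)"
    unfolding e by (subst partial_deriv_cis_inner) simp
  have S: "(\<lambda>x. e x * g x) \<in> schwartz" if "g \<in> schwartz" for g
    unfolding e_def by (rule schwartz_modulate[OF that])
  have "partial_deriv j (\<lambda>x. e x * f x) = (\<lambda>x. e x * partial_deriv j f x + (- \<i> * complex_of_real (\<xi> $ j)) * (e x * f x))"
    using partial_deriv_smooth_mult[OF sm schwartz_smooth[OF f], of j] unfolding de by (simp add: mult.assoc)
  then have "(\<integral>x. e x * partial_deriv j f x + (- \<i> * complex_of_real (\<xi> $ j)) * (e x * f x) \<partial>lborel) = 0"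
    using integral_partial_deriv_eq_0[OF S[OF f], of j] by simp
  then have "(\<integral>x. e x * partial_deriv j f x \<partial>lborel) + (- \<i> * complex_of_real (\<xi> $ j)) * (\<integral>x. e x * f x \<partial>lborel) = 0"
    using schwartz_integrable[OF S[OF f]] schwartz_integrable[OF S[OF schwartz_partial_deriv[OF f, of j]]]
    by (subst (asm) Bochner_Integration.integral_add) auto
  then show ?thesis unfolding fourier_def e_def by (simp add: mult_ac)
qed

lemma fourier_iter_deriv_replicate:
  assumes "f \<in> schwartz"
  shows "fourier (iter_deriv (replicate N j) f) \<xi> = (\<i> * complex_of_real (\<xi> $ j)) ^ N * fourier f \<xi>"
  by (induction N)
    (use assms in \<open>auto simp: iter_deriv_Cons fourier_partial_deriv schwartz_iter_deriv\<close>)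

lemma sfam_iter_deriv: "sfam \<mu> G \<Longrightarrow> sfam \<mu> (\<lambda>p. iter_deriv js (G p))"
  by (induction js) (auto simp: iter_deriv_Cons intro: sfam_partial_deriv)

lemma sfam_fourier_bounded:
  fixes G :: "'p \<Rightarrow> real ^ 'n::finite \<Rightarrow> complex"
  assumes "sfam \<mu> G"
  shows "\<exists>C\<ge>0. \<forall>p \<xi>. cmod (fourier (G p) \<xi>) \<le> C * \<mu> p"
proof -
  obtain K where K: "K \<ge> 0" "\<And>(f :: real ^ 'n \<Rightarrow> complex) B \<xi>. f \<in> borel_measurable borel \<Longrightarrow>
     (\<And>x. wt x ^ (2 * DIM(real ^ 'n)) * cmod (f x) \<le> B) \<Longrightarrow> cmod (fourier f \<xi>) \<le> K * B"
    using fourier_bound by blast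
  obtain C where C: "C \<ge> 0" "\<And>p x. wt x ^ (2 * DIM(real ^ 'n)) * cmod (G p x) \<le> C * \<mu> p"
    using sfam_boundD[OF assms] by blast
  have "cmod (fourier (G p) \<xi>) \<le> K * (C * \<mu> p)" for p \<xi>
    by (rule K(2)[OF schwartz_measurable[OF sfam_schwartz[OF assms]] C(2)])
  then show ?thesis using K C by (intro exI[of _ "K * C"]) (auto simp: mult.assoc)
qed

lemma sfam_fourier_decay:
  fixes G :: "'p \<Rightarrow> real ^ 'n::finite \<Rightarrow> complex"
  assumes G: "sfam \<mu> G"
  shows "\<exists>C\<ge>0. \<forall>p \<xi>. wt \<xi> ^ N * cmod (fourier (G p) \<xi>) \<le> C * \<mu> p"
proof -
  obtain C0 where C0: "C0 \<ge> 0" "\<And>p \<xi>. cmod (fourier (G p) \<xi>) \<le> C0 * \<mu> p"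
    using sfam_fourier_bounded[OF G] by blast
  have "\<exists>C. \<forall>j. C j \<ge> 0 \<and> (\<forall>p \<xi>. cmod (fourier (iter_deriv (replicate N j) (G p)) \<xi>) \<le> C j * \<mu> p)"
    by (intro choice allI sfam_fourier_bounded sfam_iter_deriv G)
  then obtain C where C: "\<And>j. C j \<ge> 0"
      "\<And>j p \<xi>. cmod (fourier (iter_deriv (replicate N j) (G p)) \<xi>) \<le> C j * \<mu> p" by blast
  define D where "D = C0 + (\<Sum>j\<in>UNIV. C j)"
  have D: "D \<ge> 0" "C0 \<le> D" "\<And>j. C j \<le> D"
    unfolding D_def using C0(1) C(1) member_le_sum[of _ UNIV C] by (auto simp: sum_nonneg add_increasing)
  have "wt \<xi> ^ N * cmod (fourier (G p) \<xi>) \<le> (real CARD('n) + 1) ^ Suc N * (D * \<mu> p)" for p \<xi>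
  proof (cases "\<mu> p \<ge> 0")
    case True
    show ?thesis
    proof (rule wt_mult_le_monomials)
      show "cmod (fourier (G p) \<xi>) \<le> D * \<mu> p"
        using C0(2)[of p \<xi>] mult_right_mono[OF D(2) True] by linarith
      show "\<bar>\<xi> $ j\<bar> ^ N * cmod (fourier (G p) \<xi>) \<le> D * \<mu> p" for j
        using C(2)[of j p \<xi>] mult_right_mono[OF D(3)[of j] True]
        unfolding fourier_iter_deriv_replicate[OF sfam_schwartz[OF G]]
        by (simp add: norm_mult norm_power)
    qed auto
  next
    \<comment> \<open>A negative weight forces the transform to vanish, its norm being at most
      \<open>C0 * \<mu> p\<close>. What remains is the sign of \<open>D * \<mu> p\<close>, which
      follows from the bounds themselves.\<close>
    case False
    then have "C0 * \<mu> p \<le> 0" using C0 by (simp add: mult_nonneg_nonpos)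
    then have "fourier (G p) \<xi> = 0" using C0(2)[of p \<xi>] by (smt (verit) norm_le_zero_iff)
    moreover have "C0 * \<mu> p \<ge> 0" using C0(2)[of p \<xi>] norm_ge_zero order_trans by blast
    moreover have "\<And>j. C j * \<mu> p \<ge> 0" using C(2)[of _ p \<xi>] norm_ge_zero order_trans by blast
    ultimately have "D * \<mu> p \<ge> 0" unfolding D_def by (simp add: algebra_simps sum_distrib_left sum_nonneg mult.commute)
    with \<open>fourier (G p) \<xi> = 0\<close> show ?thesis by simp
  qed
  then show ?thesis using D(1)
    by (intro exI[of _ "(real CARD('n) + 1) ^ Suc N * D"]) (auto simp: mult.assoc)
qed

lemma sfam_fourier: assumes G: "sfam \<mu> G" shows "sfam \<mu> (\<lambda>p. fourier (G p))"
  unfolding sfam_def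
proof (intro conjI allI)
  show "smooth (fourier (G p))" for p by (rule smooth_fourier[OF sfam_schwartz[OF G]])
  show "\<exists>C\<ge>0. \<forall>p x. wt x ^ N * cmod (iter_deriv js (fourier (G p)) x) \<le> C * \<mu> p" for js N
    unfolding iter_deriv_fourier[OF sfam_schwartz[OF G]]
    by (rule sfam_fourier_decay[OF sfam_freq_monomial_mult[OF G]])
qed

lemma schwartz_fourier: "f \<in> schwartz \<Longrightarrow> fourier f \<in> schwartz"
  unfolding schwartz_iff_sfam by (rule sfam_fourier)

text \<open>Through this identity all facts on the inverse transform follow from those on the direct
  one.\<close>

lemma inv_fourier_eq_cnj: "inv_fourier f x = cnj (fourier (\<lambda>y. cnj (f y)) x)"
proof -
  have "cnj (\<integral>y. cnj (f y) * cis (- (y \<bullet> x)) \<partial>lborel) = (\<integral>y. f y * cis (x \<bullet> y) \<partial>lborel)"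
    unfolding Bochner_Integration.integral_cnj[symmetric] by (simp add: cis_cnj inner_commute)
  then show ?thesis unfolding inv_fourier_def fourier_def by simp
qed

lemma sfam_inv_fourier: "sfam \<mu> G \<Longrightarrow> sfam \<mu> (\<lambda>p. inv_fourier (G p))"
  unfolding inv_fourier_eq_cnj[abs_def] by (intro sfam_cnj sfam_fourier)

lemma borel_measurable_cis [measurable]: "f \<in> borel_measurable M \<Longrightarrow> (\<lambda>x. cis (f x)) \<in> borel_measurable M"
  unfolding cis_conv_exp by measurable

lemma fourier_integrable: "f \<in> schwartz \<Longrightarrow> integrable lborel (\<lambda>x. f x * cis (- (x \<bullet> \<xi>)))"
  using schwartz_integrable[OF schwartz_modulate[of f "- \<xi>"]] by (simp add: mult.commute)

lemma fourier_add: "f \<in> schwartz \<Longrightarrow> g \<in> schwartz \<Longrightarrow> fourier (\<lambda>x. f x + g x) = (\<lambda>\<xi>. fourier f \<xi> + fourier g \<xi>)"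
  unfolding fourier_def by (simp add: distrib_right distrib_left fourier_integrable)

lemma fourier_cmult: "fourier (\<lambda>x. c * f x) = (\<lambda>\<xi>. c * fourier f \<xi>)"
  unfolding fourier_def by (simp add: mult.assoc mult.left_commute)

lemma inv_fourier_add: "f \<in> schwartz \<Longrightarrow> g \<in> schwartz \<Longrightarrow> inv_fourier (\<lambda>x. f x + g x) = (\<lambda>\<xi>. inv_fourier f \<xi> + inv_fourier g \<xi>)"
  unfolding inv_fourier_eq_cnj[abs_def] by (simp add: fourier_add schwartz_cnj)

lemma inv_fourier_cmult: "inv_fourier (\<lambda>x. c * f x) = (\<lambda>\<xi>. c * inv_fourier f \<xi>)"
  unfolding inv_fourier_eq_cnj[abs_def] by (simp add: fourier_cmult)

text \<open>The multiplication formula, by Fubini. It serves twice: against a scaled Gaussian in the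
  inversion theorem, and in the role of Plancherel in \<open>kernel_eq\<close>.\<close>

lemma integral_mult_fourier:
  fixes f g :: "real ^ 'n::finite \<Rightarrow> complex"
  assumes f: "integrable lborel f" and g: "integrable lborel g"
  shows "(\<integral>\<xi>. fourier f \<xi> * g \<xi> \<partial>lborel) = (\<integral>x. f x * fourier g x \<partial>lborel)"
proof -
  have [measurable]: "f \<in> borel_measurable borel" "g \<in> borel_measurable borel"
    using f g by (auto dest: borel_measurable_integrable)
  define F where "F x \<xi> = f x * g \<xi> * cis (- (x \<bullet> \<xi>))" for x \<xi>
  have int: "integrable (lborel \<Otimes>\<^sub>M lborel) (case_prod F)"
  proof (rule lborel_pair.Fubini_integrable)
    show "case_prod F \<in> borel_measurable (lborel \<Otimes>\<^sub>M lborel)"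
      unfolding F_def case_prod_beta' by measurable
    show "integrable lborel (\<lambda>x. \<integral>y. norm (case_prod F (x, y)) \<partial>lborel)"
      unfolding F_def by (simp add: norm_mult integrable_norm[OF f])
    show "AE x in lborel. integrable lborel (\<lambda>y. case_prod F (x, y))"
    proof (rule AE_I2)
      fix x
      show "integrable lborel (\<lambda>y. case_prod F (x, y))"
        by (rule Bochner_Integration.integrable_bound[of _ "\<lambda>y. f x * g y"])
          (use g in \<open>auto simp: F_def norm_mult\<close>)
    qed
  qed
  have "(\<integral>\<xi>. (\<integral>x. F x \<xi> \<partial>lborel) \<partial>lborel) = (\<integral>x. (\<integral>\<xi>. F x \<xi> \<partial>lborel) \<partial>lborel)"
    by (rule lborel_pair.Fubini_integral[OF int])
  moreover have "(\<integral>x. F x \<xi> \<partial>lborel) = g \<xi> * (\<integral>x. f x * cis (- (x \<bullet> \<xi>)) \<partial>lborel)" for \<xi>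
    unfolding F_def by (subst integral_mult_right_zero[symmetric]) (simp add: mult_ac)
  moreover have "(\<integral>\<xi>. F x \<xi> \<partial>lborel) = f x * (\<integral>\<xi>. g \<xi> * cis (- (\<xi> \<bullet> x)) \<partial>lborel)" for x
    unfolding F_def by (subst integral_mult_right_zero[symmetric]) (simp add: mult_ac inner_commute)
  ultimately have eq: "(\<integral>\<xi>. g \<xi> * (\<integral>x. f x * cis (- (x \<bullet> \<xi>)) \<partial>lborel) \<partial>lborel) =
      (\<integral>x. f x * (\<integral>\<xi>. g \<xi> * cis (- (\<xi> \<bullet> x)) \<partial>lborel) \<partial>lborel)"
    by simp
  define c where "c = complex_of_real ((2 * pi) powr (- real CARD('n) / 2))"
  have "(\<integral>\<xi>. fourier f \<xi> * g \<xi> \<partial>lborel) = (\<integral>\<xi>. c * (g \<xi> * (\<integral>x. f x * cis (- (x \<bullet> \<xi>)) \<partial>lborel)) \<partial>lborel)"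
    unfolding fourier_def c_def by (simp only: mult_ac)
  also have "\<dots> = c * (\<integral>\<xi>. g \<xi> * (\<integral>x. f x * cis (- (x \<bullet> \<xi>)) \<partial>lborel) \<partial>lborel)"
    by (rule integral_mult_right_zero)
  also have "\<dots> = (\<integral>x. c * (f x * (\<integral>\<xi>. g \<xi> * cis (- (\<xi> \<bullet> x)) \<partial>lborel)) \<partial>lborel)"
    unfolding eq by (rule integral_mult_right_zero[symmetric])
  also have "\<dots> = (\<integral>x. f x * fourier g x \<partial>lborel)"
    unfolding fourier_def c_def by (simp only: mult_ac)
  finally show ?thesis .
qed

lemma fourier_translate:
  assumes [measurable]: "f \<in> borel_measurable borel"
  shows "fourier (\<lambda>x. f (x - a)) \<xi> = cis (- (a \<bullet> \<xi>)) * fourier f \<xi>"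
proof -
  have "(\<integral>x. f (x - a) * cis (- (x \<bullet> \<xi>)) \<partial>lborel) = (\<integral>x. f (x + a - a) * cis (- ((x + a) \<bullet> \<xi>)) \<partial>lborel)"
    by (rule integral_lborel_translate[symmetric]) measurable
  also have "\<dots> = (\<integral>x. cis (- (a \<bullet> \<xi>)) * (f x * cis (- (x \<bullet> \<xi>))) \<partial>lborel)"
    by (intro Bochner_Integration.integral_cong) (auto simp: inner_add_left mult_ac cis_mult add.commute)
  also have "\<dots> = cis (- (a \<bullet> \<xi>)) * (\<integral>x. f x * cis (- (x \<bullet> \<xi>)) \<partial>lborel)"
    by (rule integral_mult_right_zero)
  finally show ?thesis unfolding fourier_def by (simp add: mult_ac)
qed

lemma fourier_modulate: "fourier (\<lambda>x. cis (x \<bullet> \<eta>) * f x) \<xi> = fourier f (\<xi> - \<eta>)"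
proof -
  have "cis (x \<bullet> \<eta>) * f x * cis (- (x \<bullet> \<xi>)) = f x * cis (- (x \<bullet> (\<xi> - \<eta>)))" for x
    by (simp add: inner_diff_right mult_ac cis_mult)
  then show ?thesis unfolding fourier_def by (simp only:)
qed


section \<open>Fourier inversion\<close>

lemma
  fixes f :: "'a::euclidean_space \<Rightarrow> real \<Rightarrow> complex"
  assumes f: "\<And>b. b \<in> Basis \<Longrightarrow> integrable lborel (f b)"
  shows integral_prod_Basis: "(\<integral>x. (\<Prod>b\<in>Basis. f b (x \<bullet> b)) \<partial>lborel) = (\<Prod>b\<in>Basis. \<integral>t. f b t \<partial>lborel)"
    and integrable_prod_Basis: "integrable lborel (\<lambda>x. \<Prod>b\<in>Basis. f b (x \<bullet> b))"
proof -
  interpret product_sigma_finite "\<lambda>_::'a. lborel :: real measure"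
    by (simp add: product_sigma_finite_def sigma_finite_lborel)
  have meas [measurable]: "b \<in> Basis \<Longrightarrow> f b \<in> borel_measurable borel" for b
    using f[of b] by (auto dest: borel_measurable_integrable)
  have meas2: "(\<lambda>x. \<Prod>b\<in>Basis. f b (x \<bullet> b)) \<in> borel_measurable borel"
    by measurable
  have coord: "(\<Prod>b\<in>Basis. f b ((\<Sum>b'\<in>Basis. x b' *\<^sub>R b') \<bullet> b)) = (\<Prod>b\<in>Basis. f b (x b))" for x
    by (intro prod.cong) auto
  have T: "(\<lambda>x. \<Sum>b\<in>Basis. x b *\<^sub>R b) \<in> measurable (\<Pi>\<^sub>M b\<in>(Basis::'a set). lborel) borel"
    by measurable
  show "(\<integral>x. (\<Prod>b\<in>Basis. f b (x \<bullet> b)) \<partial>lborel) = (\<Prod>b\<in>Basis. \<integral>t. f b t \<partial>lborel)"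
    using product_integral_prod[OF finite_Basis f]
    by (subst lborel_eq) (simp add: integral_distr[OF T meas2] coord)
  show "integrable lborel (\<lambda>x. \<Prod>b\<in>Basis. f b (x \<bullet> b))"
    using product_integrable_prod[OF finite_Basis f]
    by (subst lborel_eq) (simp add: integrable_distr_eq[OF T meas2] coord)
qed

text \<open>Written as a product of one-dimensional densities so that its transform comes from the
  characteristic function of the normal distribution. It has integral 1 and, in the unitary
  normalisation, is its own Fourier transform.\<close>

definition gauss :: "real ^ 'n::finite \<Rightarrow> real" where
  "gauss x = (\<Prod>b\<in>Basis. std_normal_density (x \<bullet> b))"

lemma std_normal_char:
  "(\<integral>x. complex_of_real (std_normal_density x) * cis (t * x) \<partial>lborel) = complex_of_real (exp (- (t\<^sup>2) / 2))"
proof -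
  have "complex_of_real (exp (- (t\<^sup>2) / 2)) = char std_normal_distribution t"
    by (simp add: char_std_normal_distribution)
  also have "\<dots> = (\<integral>x. std_normal_density x *\<^sub>R iexp (t * x) \<partial>lborel)"
    unfolding char_def by (subst integral_density) auto
  finally show ?thesis by (simp add: scaleR_conv_of_real cis_conv_exp)
qed

lemma sqrt_2pi_power: "sqrt (2 * pi) ^ n = (2 * pi) powr (real n / 2)"
  by (simp add: powr_half_sqrt[symmetric] powr_realpow[symmetric] powr_powr)

lemma gauss_eq: "gauss (x :: real ^ 'n::finite) = (2 * pi) powr (- real CARD('n) / 2) * (\<Prod>b\<in>Basis. exp (- ((x \<bullet> b)\<^sup>2) / 2))"
proof -
  have "gauss x = (\<Prod>b\<in>(Basis::(real^'n) set). inverse (sqrt (2 * pi))) * (\<Prod>b\<in>Basis. exp (- ((x \<bullet> b)\<^sup>2) / 2))"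
    unfolding gauss_def prod.distrib[symmetric]
    by (rule prod.cong[OF refl]) (simp only: std_normal_density_def inverse_eq_divide)
  also have "(\<Prod>b\<in>(Basis::(real^'n) set). inverse (sqrt (2 * pi))) = (2 * pi) powr (- real CARD('n) / 2)"
    by (simp add: power_inverse sqrt_2pi_power powr_minus)
  finally show ?thesis .
qed

lemma gauss_nonneg: "0 \<le> gauss x"
  unfolding gauss_def by (intro prod_nonneg) auto

lemma gauss_le: "gauss (x :: real ^ 'n::finite) \<le> (2 * pi) powr (- real CARD('n) / 2)"
proof -
  have "(\<Prod>b\<in>Basis. exp (- ((x \<bullet> b)\<^sup>2) / 2)) \<le> 1" by (intro prod_le_1) auto
  then show ?thesis unfolding gauss_eq by (intro mult_left_le) auto
qed

lemma gauss_measurable [measurable]: "gauss \<in> borel_measurable borel"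
  unfolding gauss_def[abs_def] by measurable

lemma gauss_continuous: "isCont gauss x"
  unfolding gauss_eq[abs_def] by (intro continuous_intros) auto

lemma gauss_scaled_integrable:
  assumes "\<epsilon> \<noteq> 0"
  shows "integrable lborel (\<lambda>x :: real ^ 'n::finite. complex_of_real (gauss (\<epsilon> *\<^sub>R x)))"
proof -
  have "integrable lborel (\<lambda>t. std_normal_density (0 + \<epsilon> * t))"
    by (rule lborel_integrable_real_affine[OF _ assms]) auto
  then have "integrable lborel (\<lambda>t. complex_of_real (std_normal_density (\<epsilon> * t)))" by simp
  from integrable_prod_Basis[where 'a="real ^ 'n", OF this]
  show ?thesis unfolding gauss_def by (simp add: of_real_prod)
qed

lemma gauss_fourier:
  "(\<integral>x. complex_of_real (gauss x) * cis (x \<bullet> y) \<partial>lborel) =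
     complex_of_real ((2 * pi) powr (real CARD('n) / 2) * gauss (y :: real ^ 'n::finite))"
proof -
  have int: "integrable lborel (\<lambda>t. complex_of_real (std_normal_density t) * cis (s * t))" for s
    by (rule Bochner_Integration.integrable_bound[of _ "\<lambda>t. std_normal_density t"])
      (auto simp: norm_mult)
  have eq: "complex_of_real (gauss x) * cis (x \<bullet> y) =
      (\<Prod>b\<in>Basis. complex_of_real (std_normal_density (x \<bullet> b)) * cis ((y \<bullet> b) * (x \<bullet> b)))" for x
  proof -
    have "cis (x \<bullet> y) = cis (\<Sum>b\<in>Basis. (y \<bullet> b) * (x \<bullet> b))"
      by (subst euclidean_inner) (simp add: mult.commute)
    also have "\<dots> = (\<Prod>b\<in>Basis. cis ((y \<bullet> b) * (x \<bullet> b)))"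
      unfolding cis_conv_exp by (simp add: exp_sum[symmetric] sum_distrib_left)
    finally show ?thesis unfolding gauss_def prod.distrib by (simp add: of_real_prod)
  qed
  have "(\<integral>x. complex_of_real (gauss x) * cis (x \<bullet> y) \<partial>lborel) =
      (\<Prod>b\<in>(Basis::(real^'n) set). complex_of_real (exp (- ((y \<bullet> b)\<^sup>2) / 2)))"
    unfolding eq by (subst integral_prod_Basis[OF int]) (simp add: std_normal_char)
  also have "\<dots> = complex_of_real ((2 * pi) powr (real CARD('n) / 2) * gauss y)"
    unfolding gauss_eq by (simp add: powr_minus of_real_prod)
  finally show ?thesis .
qed

lemma gauss_integral: "(\<integral>x. complex_of_real (gauss (x :: real ^ 'n::finite)) \<partial>lborel) = 1"
  using gauss_fourier[of "0 :: real ^ 'n"] by (simp add: gauss_eq powr_minus)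

text \<open>A wide modulated Gaussian on the frequency side becomes an approximate identity centred
  at \<open>x\<close>.\<close>

lemma fourier_gauss_scaled:
  fixes x y :: "real ^ 'n::finite"
  assumes e: "\<epsilon> > 0"
  shows "fourier (\<lambda>\<xi>. cis (\<xi> \<bullet> x) * complex_of_real (gauss (\<epsilon> *\<^sub>R \<xi>))) y =
    complex_of_real (inverse \<epsilon> ^ CARD('n) * gauss (inverse \<epsilon> *\<^sub>R (x - y)))"
proof -
  define G where "G \<xi> = complex_of_real (gauss (\<epsilon> *\<^sub>R \<xi>)) * cis (\<xi> \<bullet> (x - y))" for \<xi> :: "real ^ 'n"
  have [measurable]: "G \<in> borel_measurable borel" unfolding G_def by measurable
  have "cis (\<xi> \<bullet> x) * complex_of_real (gauss (\<epsilon> *\<^sub>R \<xi>)) * cis (- (\<xi> \<bullet> y)) = G \<xi>" for \<xi>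
    by (simp add: G_def inner_diff_right mult_ac cis_mult)
  then have "fourier (\<lambda>\<xi>. cis (\<xi> \<bullet> x) * complex_of_real (gauss (\<epsilon> *\<^sub>R \<xi>))) y =
      complex_of_real ((2 * pi) powr (- real CARD('n) / 2)) * (\<integral>\<xi>. G \<xi> \<partial>lborel)"
    unfolding fourier_def by (simp only:)
  also have "(\<integral>\<xi>. G \<xi> \<partial>lborel) = \<bar>inverse \<epsilon>\<bar> ^ DIM(real ^ 'n) *\<^sub>R (\<integral>\<xi>. G (0 + inverse \<epsilon> *\<^sub>R \<xi>) \<partial>lborel)"
    using e by (intro integral_lborel_affine) auto
  also have "(\<lambda>\<xi>. G (0 + inverse \<epsilon> *\<^sub>R \<xi>)) = (\<lambda>\<xi>. complex_of_real (gauss \<xi>) * cis (\<xi> \<bullet> (inverse \<epsilon> *\<^sub>R (x - y))))"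
    using e by (auto simp: G_def)
  finally show ?thesis
    unfolding gauss_fourier using e by (simp add: powr_minus scaleR_conv_of_real field_simps)
qed

text \<open>Gaussian summation. The inversion integral is damped by
  \<open>gauss (\<epsilon> *\<^sub>R \<xi>)\<close>, the multiplication formula moves the transform
  onto the Gaussian, and both sides converge by dominated convergence. The value of
  \<open>gauss\<close> at the origin supplies the factor in \<open>inv_fourier\<close>.\<close>

theorem inv_fourier_fourier:
  fixes f :: "real ^ 'n::finite \<Rightarrow> complex"
  assumes f: "f \<in> schwartz"
  shows "inv_fourier (fourier f) x = f x"
proof -
  define \<epsilon> where "\<epsilon> k = inverse (real (Suc k))" for k
  have e: "\<epsilon> k > 0" for k unfolding \<epsilon>_def by simp
  have elim: "\<epsilon> \<longlonglongrightarrow> 0" unfolding \<epsilon>_def by (rule LIMSEQ_inverse_real_of_nat)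
  define c where "c = (2 * pi) powr (- real CARD('n) / 2)"
  have g0: "gauss (0 :: real ^ 'n) = c" unfolding gauss_eq c_def by simp
  have [measurable]: "f \<in> borel_measurable borel" "fourier f \<in> borel_measurable borel"
    using f by (auto intro: schwartz_measurable schwartz_fourier)
  define g where "g k \<xi> = cis (\<xi> \<bullet> x) * complex_of_real (gauss (\<epsilon> k *\<^sub>R \<xi>))" for k \<xi>
  have gm [measurable]: "g k \<in> borel_measurable borel" for k
    unfolding g_def[abs_def] by measurable
  have gint: "integrable lborel (g k)" for k
    by (rule Bochner_Integration.integrable_bound[OF gauss_scaled_integrable[of "\<epsilon> k"]])
      (use e[of k] in \<open>auto simp: g_def norm_mult\<close>)
  have eq: "(\<integral>\<xi>. fourier f \<xi> * g k \<xi> \<partial>lborel) = (\<integral>s. f (x - \<epsilon> k *\<^sub>R s) * complex_of_real (gauss s) \<partial>lborel)" for k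
  proof -
    have "(\<integral>\<xi>. fourier f \<xi> * g k \<xi> \<partial>lborel) = (\<integral>y. f y * fourier (g k) y \<partial>lborel)"
      by (rule integral_mult_fourier[OF schwartz_integrable[OF f] gint])
    also have "\<dots> = (\<integral>y. f y * complex_of_real (inverse (\<epsilon> k) ^ CARD('n) * gauss (inverse (\<epsilon> k) *\<^sub>R (x - y))) \<partial>lborel)"
      unfolding g_def fourier_gauss_scaled[OF e] ..
    \<comment> \<open>The substitution \<open>y = x - \<epsilon> k *\<^sub>R s\<close> fixes the
      Gaussian and moves the scale into the argument of \<open>f\<close>.\<close>
    also have "\<dots> = \<bar>- \<epsilon> k\<bar> ^ DIM(real ^ 'n) *\<^sub>R (\<integral>s. f (x + (- \<epsilon> k) *\<^sub>R s) *
        complex_of_real (inverse (\<epsilon> k) ^ CARD('n) * gauss (inverse (\<epsilon> k) *\<^sub>R (x - (x + (- \<epsilon> k) *\<^sub>R s)))) \<partial>lborel)"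
      using e[of k] by (intro integral_lborel_affine) auto
    also have "\<dots> = (\<integral>s. complex_of_real (\<epsilon> k ^ CARD('n)) * (f (x + (- \<epsilon> k) *\<^sub>R s) *
        complex_of_real (inverse (\<epsilon> k) ^ CARD('n) * gauss (inverse (\<epsilon> k) *\<^sub>R (x - (x + (- \<epsilon> k) *\<^sub>R s))))) \<partial>lborel)"
      using e[of k] by (simp add: scaleR_conv_of_real)
    also have "\<dots> = (\<integral>s. f (x - \<epsilon> k *\<^sub>R s) * complex_of_real (gauss s) \<partial>lborel)"
      using e[of k] by (intro Bochner_Integration.integral_cong) (auto simp: power_inverse field_simps)
    finally show ?thesis .
  qed
  have "(\<lambda>k. \<integral>\<xi>. fourier f \<xi> * g k \<xi> \<partial>lborel) \<longlonglongrightarrow> (\<integral>\<xi>. fourier f \<xi> * (cis (\<xi> \<bullet> x) * complex_of_real c) \<partial>lborel)"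
  proof (rule integral_dominated_convergence[where w="\<lambda>\<xi>. cmod (fourier f \<xi>) * c"])
    show "AE \<xi> in lborel. (\<lambda>k. fourier f \<xi> * g k \<xi>) \<longlonglongrightarrow> fourier f \<xi> * (cis (\<xi> \<bullet> x) * complex_of_real c)"
    proof (rule AE_I2)
      fix \<xi> :: "real ^ 'n"
      have "(\<lambda>k. \<epsilon> k *\<^sub>R \<xi>) \<longlonglongrightarrow> 0 *\<^sub>R \<xi>" by (intro tendsto_intros elim)
      then have "(\<lambda>k. gauss (\<epsilon> k *\<^sub>R \<xi>)) \<longlonglongrightarrow> gauss (0 *\<^sub>R \<xi>)"
        by (rule isCont_tendsto_compose[OF gauss_continuous])
      then have "(\<lambda>k. gauss (\<epsilon> k *\<^sub>R \<xi>)) \<longlonglongrightarrow> gauss (0 :: real ^ 'n)" by simp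
      then show "(\<lambda>k. fourier f \<xi> * g k \<xi>) \<longlonglongrightarrow> fourier f \<xi> * (cis (\<xi> \<bullet> x) * complex_of_real c)"
        unfolding g_def g0 by (intro tendsto_intros)
    qed
    show "integrable lborel (\<lambda>\<xi>. cmod (fourier f \<xi>) * c)"
      using schwartz_integrable[OF schwartz_fourier[OF f]] by auto
    show "AE \<xi> in lborel. norm (fourier f \<xi> * g k \<xi>) \<le> cmod (fourier f \<xi>) * c" for k
      using gauss_le[where 'n='n] gauss_nonneg
      by (intro AE_I2) (auto simp: g_def norm_mult c_def abs_of_nonneg[OF gauss_nonneg] intro!: mult_left_mono)
  qed (auto simp: g_def)
  moreover have "(\<lambda>k. \<integral>s. f (x - \<epsilon> k *\<^sub>R s) * complex_of_real (gauss s) \<partial>lborel)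
      \<longlonglongrightarrow> (\<integral>s. f x * complex_of_real (gauss (s :: real ^ 'n)) \<partial>lborel)"
  proof -
    obtain C where C: "\<And>x. wt x ^ 0 * cmod (f x) \<le> C" using schwartz_bound[OF f, of 0] by blast
    show ?thesis
    proof (rule integral_dominated_convergence[where w="\<lambda>s. C * gauss s"])
      show "AE s in lborel. (\<lambda>k. f (x - \<epsilon> k *\<^sub>R s) * complex_of_real (gauss s)) \<longlonglongrightarrow> f x * complex_of_real (gauss s)"
      proof (rule AE_I2)
        fix s :: "real ^ 'n"
        have "(\<lambda>k. x - \<epsilon> k *\<^sub>R s) \<longlonglongrightarrow> x - 0 *\<^sub>R s" by (intro tendsto_intros elim)
        then have "(\<lambda>k. f (x - \<epsilon> k *\<^sub>R s)) \<longlonglongrightarrow> f x"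
          using continuous_on_tendsto_compose[OF schwartz_continuous_on[OF f, of UNIV]] by simp
        then show "(\<lambda>k. f (x - \<epsilon> k *\<^sub>R s) * complex_of_real (gauss s)) \<longlonglongrightarrow> f x * complex_of_real (gauss s)"
          by (intro tendsto_intros)
      qed
      show "integrable lborel (\<lambda>s::real^'n. C * gauss s)"
        using gauss_scaled_integrable[of 1, where 'n='n] by (simp add: complex_of_real_integrable_eq)
      show "AE s in lborel. norm (f (x - \<epsilon> k *\<^sub>R s) * complex_of_real (gauss s)) \<le> C * gauss s" for k
        using C gauss_nonneg by (intro AE_I2) (auto simp: norm_mult abs_of_nonneg[OF gauss_nonneg] intro!: mult_right_mono)
    qed auto
  qed
  ultimately have "(\<integral>\<xi>. fourier f \<xi> * (cis (\<xi> \<bullet> x) * complex_of_real c) \<partial>lborel) = (\<integral>s. f x * complex_of_real (gauss (s :: real ^ 'n)) \<partial>lborel)"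
    unfolding eq by (rule LIMSEQ_unique)
  also have "\<dots> = f x" unfolding integral_mult_right_zero gauss_integral by simp
  also have "(\<integral>\<xi>. fourier f \<xi> * (cis (\<xi> \<bullet> x) * complex_of_real c) \<partial>lborel) = (\<integral>\<xi>. complex_of_real c * (fourier f \<xi> * cis (x \<bullet> \<xi>)) \<partial>lborel)"
    by (simp add: mult_ac inner_commute)
  finally show ?thesis unfolding inv_fourier_def c_def by simp
qed

lemma fourier_inv_fourier:
  assumes f: "f \<in> schwartz"
  shows "fourier (inv_fourier f) x = f x"
proof -
  have "inv_fourier (fourier (\<lambda>y. cnj (f y))) x = cnj (f x)"
    by (rule inv_fourier_fourier[OF schwartz_cnj[OF f]])
  then have "cnj (inv_fourier (fourier (\<lambda>y. cnj (f y))) x) = f x" by simp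
  then show ?thesis by (simp add: inv_fourier_eq_cnj[abs_def])
qed


section \<open>Tempered distributions\<close>

text \<open>An increasing sequence of norms equivalent to the seminorms that generate
  \<open>schwartz_topology\<close>. Stated as an upper bound instead of a supremum, it carries no
  boundedness side condition.\<close>

definition sbound :: "nat \<Rightarrow> (real ^ 'n::finite \<Rightarrow> complex) \<Rightarrow> real \<Rightarrow> bool" where
  "sbound k f B \<longleftrightarrow> (\<forall>js x. length js \<le> k \<longrightarrow> wt x ^ k * cmod (iter_deriv js f x) \<le> B)"

lemma sbound_mono: "sbound k f B \<Longrightarrow> k' \<le> k \<Longrightarrow> B \<le> B' \<Longrightarrow> sbound k' f B'"
  unfolding sbound_def
  by (meson mult_right_mono norm_ge_zero order_trans power_increasing wt_ge_1)

lemma iter_deriv_cmult: "smooth f \<Longrightarrow> iter_deriv js (\<lambda>x. c * f x) = (\<lambda>x. c * iter_deriv js f x :: complex)"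
  by (rule iter_deriv_bounded_linear[OF bounded_linear_mult_right])

lemma sbound_cmult:
  assumes "sbound k f B" "smooth f" shows "sbound k (\<lambda>x. c * f x) (cmod c * B)"
  unfolding sbound_def
proof (intro allI impI)
  fix js :: "'a list" and x assume "length js \<le> k"
  then have "wt x ^ k * cmod (iter_deriv js f x) \<le> B" using assms(1) by (simp add: sbound_def)
  from mult_left_mono[OF this norm_ge_zero[of c]]
  show "wt x ^ k * cmod (iter_deriv js (\<lambda>x. c * f x) x) \<le> cmod c * B"
    using assms(2) by (simp add: iter_deriv_cmult norm_mult mult_ac)
qed

lemma schwartz_topspace: "topspace schwartz_topology = (schwartz :: (real ^ 'n::finite \<Rightarrow> complex) set)"
proof
  show "topspace schwartz_topology \<subseteq> (schwartz :: (real ^ 'n \<Rightarrow> complex) set)"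
    unfolding schwartz_topology_def topology_generated_by_topspace by blast
  show "(schwartz :: (real ^ 'n \<Rightarrow> complex) set) \<subseteq> topspace schwartz_topology"
  proof
    fix f :: "real ^ 'n \<Rightarrow> complex" assume f: "f \<in> schwartz"
    define X where "X = {g \<in> schwartz. schwartz_seminorm (\<lambda>_. 0) [] (\<lambda>x. g x - f x) < 1}"
    have "openin schwartz_topology X"
      unfolding schwartz_topology_def
      by (rule topology_generated_by_Basis) (use f zero_less_one X_def in blast)
    moreover have "f \<in> X" using f by (simp add: X_def schwartz_seminorm_def)
    ultimately show "f \<in> topspace schwartz_topology" using openin_subset by blast
  qed
qed

lemma seminorm_upper:
  assumes "f \<in> schwartz"
  shows "\<bar>monomial \<alpha> x\<bar> * cmod (iter_deriv js f x) \<le> schwartz_seminorm \<alpha> js f"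
proof -
  have "cmod (complex_of_real (monomial \<alpha> x) * iter_deriv js f x) \<le> schwartz_seminorm \<alpha> js f"
    unfolding schwartz_seminorm_def using assms by (intro cSUP_upper) (auto simp: schwartz_def)
  then show ?thesis by (simp add: norm_mult)
qed

lemma seminorm_least:
  assumes "\<And>x. \<bar>monomial \<alpha> x\<bar> * cmod (iter_deriv js f x) \<le> B"
  shows "schwartz_seminorm \<alpha> js f \<le> B"
  unfolding schwartz_seminorm_def using assms by (intro cSUP_least) (auto simp: norm_mult)

text \<open>Induction over the generation of the topology. A subbasic set may be centred at a
  function other than \<open>f\<close>; the slack in its strict inequality at \<open>f\<close> is
  what the neighbourhood of \<open>f\<close> uses.\<close>

lemma schwartz_topology_nbhd:
  fixes f :: "real ^ 'n::finite \<Rightarrow> complex"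
  assumes "openin schwartz_topology U" "f \<in> U"
  shows "\<exists>k. \<exists>\<delta>>0. \<forall>g\<in>schwartz. sbound k (\<lambda>x. g x - f x) \<delta> \<longrightarrow> g \<in> U"
proof -
  have "generate_topology_on {{g \<in> schwartz. schwartz_seminorm \<alpha> js (\<lambda>x. g x - f x) < \<epsilon>} | f \<alpha> js \<epsilon>.
        f \<in> (schwartz :: (real ^ 'n \<Rightarrow> complex) set) \<and> \<epsilon> > 0} U"
    using assms(1) unfolding schwartz_topology_def openin_topology_generated_by_iff .
  then show ?thesis using assms(2)
  proof (induction rule: generate_topology_on.induct)
    case (Int a b)
    obtain k1 d1 where 1: "d1 > 0" "\<And>g. g \<in> schwartz \<Longrightarrow> sbound k1 (\<lambda>x. g x - f x) d1 \<Longrightarrow> g \<in> a" using Int by auto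
    obtain k2 d2 where 2: "d2 > 0" "\<And>g. g \<in> schwartz \<Longrightarrow> sbound k2 (\<lambda>x. g x - f x) d2 \<Longrightarrow> g \<in> b" using Int by auto
    have "g \<in> a \<inter> b" if "g \<in> schwartz" "sbound (max k1 k2) (\<lambda>x. g x - f x) (min d1 d2)" for g
      using 1(2)[OF that(1) sbound_mono[OF that(2)]] 2(2)[OF that(1) sbound_mono[OF that(2)]] by auto
    then show ?case using 1(1) 2(1) by (intro exI[of _ "max k1 k2"] exI[of _ "min d1 d2"]) auto
  next
    case (UN K)
    then show ?case by blast
  next
    case (Basis s)
    then obtain f0 \<alpha> js \<epsilon> where s: "s = {g \<in> schwartz. schwartz_seminorm \<alpha> js (\<lambda>x. g x - f0 x) < \<epsilon>}"
      and f0: "f0 \<in> schwartz" by blast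
    have f: "f \<in> schwartz" "schwartz_seminorm \<alpha> js (\<lambda>x. f x - f0 x) < \<epsilon>" using Basis s by auto
    \<comment> \<open>Half of the slack, so that the final inequality stays strict.\<close>
    define \<delta> where "\<delta> = (\<epsilon> - schwartz_seminorm \<alpha> js (\<lambda>x. f x - f0 x)) / 2"
    define k where "k = max (\<Sum>j\<in>UNIV. \<alpha> j) (length js)"
    have "g \<in> s" if g: "g \<in> schwartz" "sbound k (\<lambda>x. g x - f x) \<delta>" for g
    proof -
      have "schwartz_seminorm \<alpha> js (\<lambda>x. g x - f0 x) \<le> schwartz_seminorm \<alpha> js (\<lambda>x. f x - f0 x) + \<delta>"
      proof (rule seminorm_least)
        fix x
        have "cmod (iter_deriv js (\<lambda>x. g x - f0 x) x) \<le> cmod (iter_deriv js (\<lambda>x. f x - f0 x) x) + cmod (iter_deriv js (\<lambda>x. g x - f x) x)"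
          using g f f0 norm_triangle_ineq[of "iter_deriv js f x - iter_deriv js f0 x" "iter_deriv js g x - iter_deriv js f x"]
          by (simp add: iter_deriv_diff schwartz_smooth)
        then have "\<bar>monomial \<alpha> x\<bar> * cmod (iter_deriv js (\<lambda>x. g x - f0 x) x) \<le>
            \<bar>monomial \<alpha> x\<bar> * cmod (iter_deriv js (\<lambda>x. f x - f0 x) x) + \<bar>monomial \<alpha> x\<bar> * cmod (iter_deriv js (\<lambda>x. g x - f x) x)"
          unfolding distrib_left[symmetric] by (intro mult_left_mono) auto
        moreover have "\<bar>monomial \<alpha> x\<bar> * cmod (iter_deriv js (\<lambda>x. f x - f0 x) x) \<le> schwartz_seminorm \<alpha> js (\<lambda>x. f x - f0 x)"
          by (intro seminorm_upper schwartz_diff f f0)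
        moreover have "\<bar>monomial \<alpha> x\<bar> * cmod (iter_deriv js (\<lambda>x. g x - f x) x) \<le> wt x ^ k * cmod (iter_deriv js (\<lambda>x. g x - f x) x)"
          using order_trans[OF monomial_le_wt[of \<alpha> x] power_increasing[of "\<Sum>j\<in>UNIV. \<alpha> j" k "wt x"]]
          by (intro mult_right_mono) (auto simp: k_def)
        moreover have "wt x ^ k * cmod (iter_deriv js (\<lambda>x. g x - f x) x) \<le> \<delta>"
          using g(2) unfolding sbound_def k_def by auto
        ultimately show "\<bar>monomial \<alpha> x\<bar> * cmod (iter_deriv js (\<lambda>x. g x - f0 x) x) \<le> schwartz_seminorm \<alpha> js (\<lambda>x. f x - f0 x) + \<delta>"
          by linarith
      qed
      also have "\<dots> < \<epsilon>" unfolding \<delta>_def using f(2) by (simp add: field_simps)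
      finally show ?thesis using g(1) s by simp
    qed
    moreover have "\<delta> > 0" unfolding \<delta>_def using f(2) by simp
    ultimately show ?case by blast
  qed auto
qed

locale schwartz_functional =
  fixes u :: "(real ^ 'n::finite \<Rightarrow> complex) \<Rightarrow> complex"
  assumes add: "f \<in> schwartz \<Longrightarrow> g \<in> schwartz \<Longrightarrow> u (\<lambda>x. f x + g x) = u f + u g"
    and cmult: "f \<in> schwartz \<Longrightarrow> u (\<lambda>x. c * f x) = c * u f"
begin

lemma zero: "u (\<lambda>x. 0) = 0"
  using cmult[OF schwartz_0, of 0] by simp

lemma diff: "f \<in> schwartz \<Longrightarrow> g \<in> schwartz \<Longrightarrow> u (\<lambda>x. f x - g x) = u f - u g"
  using add[OF _ schwartz_cmult[of g "-1"], of f] cmult[of g "-1"] by simp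

lemma sum: "(\<And>i. i \<in> I \<Longrightarrow> f i \<in> schwartz) \<Longrightarrow> u (\<lambda>x. \<Sum>i\<in>I. f i x) = (\<Sum>i\<in>I. u (f i))"
  by (induction I rule: infinite_finite_induct) (auto simp: zero add schwartz_sum)

lemma scaled_bound:
  assumes u: "\<And>f. f \<in> schwartz \<Longrightarrow> sbound k f 1 \<Longrightarrow> cmod (u f) \<le> C"
    and f: "f \<in> schwartz" and B: "sbound k f B" "B > 0"
  shows "cmod (u f) \<le> C * B"
proof -
  have "sbound k (\<lambda>x. complex_of_real (inverse B) * f x) (cmod (complex_of_real (inverse B)) * B)"
    by (rule sbound_cmult[OF B(1) schwartz_smooth[OF f]])
  then have "sbound k (\<lambda>x. complex_of_real (inverse B) * f x) 1" using B(2) by (simp add: norm_inverse)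
  from u[OF schwartz_cmult[OF f] this, unfolded cmult[OF f]]
  have "cmod (u f) * inverse B \<le> C" using B(2) by (simp add: norm_mult norm_inverse mult.commute)
  then show ?thesis using B(2) by (simp add: field_simps)
qed

text \<open>The converse of \<open>tempered_bound\<close>: finitely many subbasic sets already
  control \<open>sbound k\<close>, so boundedness on its unit ball makes the preimage of an open set
  a neighbourhood of each of its points.\<close>

lemma tempered:
  assumes u: "\<And>f. f \<in> schwartz \<Longrightarrow> sbound k f 1 \<Longrightarrow> cmod (u f) \<le> C"
  shows "u \<in> tempered_distributions"
proof -
  have "openin schwartz_topology {f \<in> topspace schwartz_topology. u f \<in> V}" if V: "open V" for V
    unfolding schwartz_topspace
  proof (subst openin_subopen, intro ballI)
    fix f assume "f \<in> {f \<in> schwartz. u f \<in> V}"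
    then have f: "f \<in> schwartz" "u f \<in> V" by auto
    then obtain e where e: "e > 0" "ball (u f) e \<subseteq> V" using V open_contains_ball by blast
    have "C \<ge> 0" using u[OF schwartz_0] by (simp add: zero sbound_def iter_deriv_const_0)
    define D where "D = (real CARD('n) + 1) ^ Suc k"
    have D: "D > 0" unfolding D_def by (intro zero_less_power) auto
    \<comment> \<open>\<open>D\<close> is the constant of \<open>wt_mult_le_monomials\<close>; the
      choice makes \<open>C * (D * \<eta>)\<close> at most \<open>e / 2\<close>, with
      \<open>C + 1\<close> because \<open>C\<close> may be 0.\<close>
    define \<eta> where "\<eta> = e / (2 * (C + 1) * D)"
    have \<eta>: "\<eta> > 0" unfolding \<eta>_def using e \<open>C \<ge> 0\<close> D by auto
    \<comment> \<open>The constant monomial and the pure powers are those required by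
      \<open>wt_mult_le_monomials\<close>.\<close>
    define A where "A = insert (\<lambda>i. 0) (range (\<lambda>j i::'n. if i = j then k else 0))"
    define L where "L = {js :: 'n list. length js \<le> k}"
    have fin: "finite (A \<times> L)"
      unfolding A_def L_def using finite_lists_length_le[of "UNIV :: 'n set" k] by auto
    define bs where "bs = (\<lambda>(\<alpha>, js). {g \<in> schwartz. schwartz_seminorm \<alpha> js (\<lambda>x. g x - f x) < \<eta>})"
    have op: "openin schwartz_topology (\<Inter>(bs ` (A \<times> L)))"
    proof (rule openin_Inter)
      show "bs ` (A \<times> L) \<noteq> {}" unfolding A_def L_def by (auto intro: exI[of _ "[]"])
      show "openin schwartz_topology X" if X: "X \<in> bs ` (A \<times> L)" for X
        unfolding schwartz_topology_def
      proof (rule topology_generated_by_Basis)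
        obtain \<alpha> js where "X = {g \<in> schwartz. schwartz_seminorm \<alpha> js (\<lambda>x. g x - f x) < \<eta>}"
          using X unfolding bs_def by auto
        then show "X \<in> {{g \<in> schwartz. schwartz_seminorm \<alpha> js (\<lambda>x. g x - f x) < \<epsilon>} |f \<alpha> js \<epsilon>. f \<in> schwartz \<and> 0 < \<epsilon>}"
          using f(1) \<eta> by blast
      qed
    qed (use fin in auto)
    have "f \<in> \<Inter>(bs ` (A \<times> L))"
      unfolding bs_def using f \<eta> by (auto simp: schwartz_seminorm_def iter_deriv_const_0)
    moreover have "\<Inter>(bs ` (A \<times> L)) \<subseteq> {f \<in> schwartz. u f \<in> V}"
    proof
      fix g assume g: "g \<in> \<Inter>(bs ` (A \<times> L))"
      have "((\<lambda>i. 0), []) \<in> A \<times> L" unfolding A_def L_def by simp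
      with g have "g \<in> bs ((\<lambda>i. 0), [])" by blast
      then have gs: "g \<in> schwartz" unfolding bs_def by simp
      note gf = schwartz_diff[OF gs f(1)]
      have less: "\<bar>monomial \<alpha> x\<bar> * cmod (iter_deriv js (\<lambda>x. g x - f x) x) \<le> \<eta>" if "\<alpha> \<in> A" "length js \<le> k" for \<alpha> js x
      proof -
        have "schwartz_seminorm \<alpha> js (\<lambda>x. g x - f x) < \<eta>"
          using g that unfolding bs_def L_def by auto
        with seminorm_upper[OF gf, of \<alpha> x js] show ?thesis by linarith
      qed
      have "sbound k (\<lambda>x. g x - f x) (D * \<eta>)"
        unfolding sbound_def D_def
      proof (intro allI impI wt_mult_le_monomials)
        fix js :: "'n list" and x assume js: "length js \<le> k"
        show "cmod (iter_deriv js (\<lambda>x. g x - f x) x) \<le> \<eta>"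
          using less[OF _ js, of "\<lambda>i. 0" x] by (simp add: A_def monomial_0)
        show "\<bar>x $ j\<bar> ^ k * cmod (iter_deriv js (\<lambda>x. g x - f x) x) \<le> \<eta>" for j
          using less[OF _ js, of "\<lambda>i. if i = j then k else 0" x] by (simp add: A_def monomial_single power_abs)
      qed auto
      then have "cmod (u (\<lambda>x. g x - f x)) \<le> C * (D * \<eta>)"
        using scaled_bound[of k C, OF u gf] D \<eta> by simp
      also have "C * (D * \<eta>) = (C / (C + 1)) * (e / 2)"
        unfolding \<eta>_def using D \<open>C \<ge> 0\<close> by (simp add: divide_simps)
      also have "\<dots> \<le> 1 * (e / 2)" using \<open>C \<ge> 0\<close> e(1) by (intro mult_right_mono) auto
      also have "1 * (e / 2) < e" using e(1) by simp
      finally have "u g \<in> ball (u f) e" by (simp add: diff[OF gs f(1)] dist_norm norm_minus_commute)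
      then show "g \<in> {f \<in> schwartz. u f \<in> V}" using e(2) gs by auto
    qed
    ultimately show "\<exists>T. openin schwartz_topology T \<and> f \<in> T \<and> T \<subseteq> {f \<in> schwartz. u f \<in> V}"
      using op by blast
  qed
  then have "continuous_map schwartz_topology euclidean u"
    unfolding continuous_map_def by auto
  then show ?thesis unfolding tempered_distributions_def using add cmult by auto
qed

end

lemma tempered_functional: "u \<in> tempered_distributions \<Longrightarrow> schwartz_functional u"
  unfolding tempered_distributions_def by unfold_locales auto

lemma tempered_bound:
  fixes u :: "(real ^ 'n::finite \<Rightarrow> complex) \<Rightarrow> complex"
  assumes "u \<in> tempered_distributions"
  shows "\<exists>k C. C \<ge> 0 \<and> (\<forall>f\<in>schwartz. sbound k f 1 \<longrightarrow> cmod (u f) \<le> C)"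
proof -
  interpret schwartz_functional u by (rule tempered_functional[OF assms])
  have "continuous_map schwartz_topology euclidean u" using assms unfolding tempered_distributions_def by auto
  then have "\<forall>V. open V \<longrightarrow> openin schwartz_topology {f \<in> schwartz. u f \<in> V}"
    unfolding continuous_map_def schwartz_topspace by simp
  from this[rule_format, OF open_ball]
  have "openin schwartz_topology {f \<in> schwartz. u f \<in> ball 0 1}" .
  moreover have "(\<lambda>x. 0) \<in> {f \<in> schwartz. u f \<in> ball 0 1}" by (simp add: schwartz_0 zero)
  ultimately have "\<exists>k. \<exists>\<delta>>0. \<forall>g\<in>schwartz. sbound k (\<lambda>x. g x - 0) \<delta> \<longrightarrow> g \<in> {f \<in> schwartz. u f \<in> ball 0 1}"
    by (rule schwartz_topology_nbhd)
  then obtain k \<delta> where d: "\<delta> > 0"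
      "\<And>g. g \<in> schwartz \<Longrightarrow> sbound k (\<lambda>x. g x - 0) \<delta> \<Longrightarrow> g \<in> {f \<in> schwartz. u f \<in> ball 0 1}"
    by blast
  have "cmod (u f) \<le> inverse \<delta>" if f: "f \<in> schwartz" "sbound k f 1" for f
  proof -
    have "sbound k (\<lambda>x. complex_of_real \<delta> * f x) \<delta>"
      using sbound_cmult[OF f(2) schwartz_smooth[OF f(1)], of "complex_of_real \<delta>"] d(1) by simp
    then have "cmod (u (\<lambda>x. complex_of_real \<delta> * f x)) < 1"
      using d(2)[OF schwartz_cmult[OF f(1)]] by simp
    then show ?thesis using d(1) by (simp add: cmult[OF f(1)] norm_mult field_simps)
  qed
  with d(1) show ?thesis by (intro exI[of _ k] exI[of _ "inverse \<delta>"]) auto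
qed

lemma sfam_sbound:
  fixes G :: "'p \<Rightarrow> real ^ 'n::finite \<Rightarrow> complex"
  assumes "sfam \<mu> G"
  shows "\<exists>C>0. \<forall>p. \<mu> p \<ge> 0 \<longrightarrow> sbound k (G p) (C * \<mu> p)"
proof -
  have "\<exists>C. \<forall>js. C js \<ge> 0 \<and> (\<forall>p x. wt x ^ k * cmod (iter_deriv js (G p) x) \<le> C js * \<mu> p)"
    by (intro choice allI) (metis sfamD[OF assms])
  then obtain C where C: "\<And>js. C js \<ge> 0" "\<And>js p x. wt x ^ k * cmod (iter_deriv js (G p) x) \<le> C js * \<mu> p"
    by blast
  define L where "L = {js :: 'n list. length js \<le> k}"
  have fin: "finite L"
    unfolding L_def using finite_lists_length_le[of "UNIV :: 'n set" k] by auto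
  define D where "D = 1 + (\<Sum>js\<in>L. C js)"
  have "sbound k (G p) (D * \<mu> p)" if "\<mu> p \<ge> 0" for p
    unfolding sbound_def
  proof (intro allI impI)
    fix js :: "'n list" and x assume "length js \<le> k"
    then have "C js \<le> D" unfolding D_def using member_le_sum[of js L C] C(1) fin by (auto simp: L_def)
    then show "wt x ^ k * cmod (iter_deriv js (G p) x) \<le> D * \<mu> p"
      using C(2)[where js=js and p=p and x=x] mult_right_mono[OF _ that] by (meson order_trans)
  qed
  moreover have "D > 0" unfolding D_def using sum_nonneg[of L C] C(1) by simp
  ultimately show ?thesis by blast
qed

lemma tempered_sfam_bound:
  assumes u: "u \<in> tempered_distributions" and G: "sfam \<mu> G" and \<mu>: "\<And>p. \<mu> p > 0"
  shows "\<exists>C\<ge>0. \<forall>p. cmod (u (G p)) \<le> C * \<mu> p"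
proof -
  interpret schwartz_functional u by (rule tempered_functional[OF u])
  obtain k C where C: "C \<ge> 0" "\<And>f. f \<in> schwartz \<Longrightarrow> sbound k f 1 \<Longrightarrow> cmod (u f) \<le> C"
    using tempered_bound[OF u] by blast
  obtain D where D: "D > 0" "\<And>p. \<mu> p \<ge> 0 \<Longrightarrow> sbound k (G p) (D * \<mu> p)"
    using sfam_sbound[OF G] by blast
  have "cmod (u (G p)) \<le> (C * D) * \<mu> p" for p
    using scaled_bound[of k C, OF C(2) sfam_schwartz[OF G] D(2)] D(1) \<mu>[of p] by (simp add: mult.assoc less_imp_le)
  then show ?thesis using C D by (intro exI[of _ "C * D"]) auto
qed

text \<open>\<open>S\<close> is bornological: it suffices that \<open>T\<close> maps bounded sequences to bounded sequences.\<close>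

lemma tempered_compose:
  fixes u :: "(real ^ 'n::finite \<Rightarrow> complex) \<Rightarrow> complex"
  assumes u: "u \<in> tempered_distributions"
    and Tadd: "\<And>f g. f \<in> schwartz \<Longrightarrow> g \<in> schwartz \<Longrightarrow> T (\<lambda>x. f x + g x) = (\<lambda>x. T f x + T g x)"
    and Tcmult: "\<And>f c. f \<in> schwartz \<Longrightarrow> T (\<lambda>x. c * f x) = (\<lambda>x. c * T f x)"
    and Tfam: "\<And>G :: nat \<Rightarrow> real ^ 'n \<Rightarrow> complex. sfam (\<lambda>_. 1) G \<Longrightarrow> sfam (\<lambda>_. 1) (\<lambda>k. T (G k))"
  shows "(\<lambda>f. u (T f)) \<in> tempered_distributions"
proof -
  interpret schwartz_functional u by (rule tempered_functional[OF u])
  have TS: "T f \<in> schwartz" if "f \<in> schwartz" for f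
    using sfam_schwartz[OF Tfam[OF schwartz_sfam[OF that]]] .
  interpret uT: schwartz_functional "\<lambda>f. u (T f)"
    by unfold_locales (simp_all add: Tadd Tcmult TS add cmult)
  have "\<exists>k. \<forall>f\<in>schwartz. sbound k f 1 \<longrightarrow> cmod (u (T f)) \<le> real k"
  proof (rule ccontr)
    assume "\<not> ?thesis"
    then have "\<forall>k. \<exists>f. f \<in> schwartz \<and> sbound k f 1 \<and> cmod (u (T f)) > real k"
      by (meson not_le)
    then obtain G where G: "\<And>k. G k \<in> schwartz" "\<And>k. sbound k (G k) 1" "\<And>k. cmod (u (T (G k))) > real k"
      by metis
    have "sfam (\<lambda>_. 1) G" unfolding sfam_def
    proof (intro conjI allI)
      show "smooth (G k)" for k using G(1) by (rule schwartz_smooth)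
      fix js :: "'n list" and N
      \<comment> \<open>From index \<open>m\<close> on, \<open>sbound k\<close> with bound 1 covers
        \<open>N\<close> and \<open>js\<close>; the finitely many earlier members contribute the sum
        of their own constants.\<close>
      define m where "m = max N (length js)"
      have "\<forall>k. \<exists>C\<ge>0. \<forall>x. wt x ^ N * cmod (iter_deriv js (G k) x) \<le> C"
        by (metis schwartz_iter_bound G(1))
      then obtain C where C: "\<And>k. C k \<ge> 0" "\<And>k x. wt x ^ N * cmod (iter_deriv js (G k) x) \<le> C k" by metis
      have "wt x ^ N * cmod (iter_deriv js (G k) x) \<le> 1 + (\<Sum>k<m. C k)" for k x
      proof (cases "k < m")
        case True
        then have "C k \<le> (\<Sum>k<m. C k)" using C(1) by (intro member_le_sum) auto
        then show ?thesis using C(2)[of x k] by linarith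
      next
        case False
        then have "length js \<le> k" "N \<le> k" unfolding m_def by auto
        then have "wt x ^ N * cmod (iter_deriv js (G k) x) \<le> wt x ^ k * cmod (iter_deriv js (G k) x)"
          by (intro mult_right_mono power_increasing) auto
        also have "\<dots> \<le> 1" using G(2)[of k] \<open>length js \<le> k\<close> by (simp add: sbound_def)
        finally show ?thesis using sum_nonneg[of "{..<m}" C] C(1) by simp
      qed
      then show "\<exists>C\<ge>0. \<forall>k x. wt x ^ N * cmod (iter_deriv js (G k) x) \<le> C * 1"
        using C(1) by (intro exI[of _ "1 + (\<Sum>k<m. C k)"]) (auto simp: sum_nonneg add_nonneg_nonneg)
    qed
    from tempered_sfam_bound[OF u Tfam[OF this]] obtain C where "\<And>k. cmod (u (T (G k))) \<le> C" by auto
    with G(3) show False by (metis (no_types, opaque_lifting) not_le order_less_trans reals_Archimedean2)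
  qed
  then show ?thesis using uT.tempered by blast
qed


section \<open>Interchanging a tempered distribution with an integral\<close>

text \<open>A Riemann sum of the functions \<open>\<Phi> w\<close> is a finite sum, so
  \<open>u\<close> maps it to the Riemann sum of the scalars \<open>u (\<Phi> w)\<close>. Uniform
  continuity in the weighted norms makes the former close to \<open>G\<close> in
  \<open>sbound k\<close>, and continuity of \<open>u\<close> transfers this.\<close>

lemma tempered_has_integral_cbox:
  fixes \<Phi> :: "'w::euclidean_space \<Rightarrow> real ^ 'n::finite \<Rightarrow> complex"
  assumes u: "u \<in> tempered_distributions"
    and S: "\<And>w. \<Phi> w \<in> schwartz" and G: "G \<in> schwartz"
    and cont: "continuous_on (cbox a b) (\<lambda>w. u (\<Phi> w))"
    and int: "\<And>js s. ((\<lambda>w. iter_deriv js (\<Phi> w) s) has_integral iter_deriv js G s) (cbox a b)"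
    and unif: "\<And>js N \<epsilon>. \<epsilon> > 0 \<Longrightarrow> \<exists>\<delta>>0. \<forall>w\<in>cbox a b. \<forall>w'\<in>cbox a b. dist w w' < \<delta> \<longrightarrow>
       (\<forall>s. wt s ^ N * cmod (iter_deriv js (\<Phi> w) s - iter_deriv js (\<Phi> w') s) \<le> \<epsilon>)"
  shows "((\<lambda>w. u (\<Phi> w)) has_integral u G) (cbox a b)"
proof -
  interpret schwartz_functional u by (rule tempered_functional[OF u])
  obtain k C where C: "C \<ge> 0" "\<And>f. f \<in> schwartz \<Longrightarrow> sbound k f 1 \<Longrightarrow> cmod (u f) \<le> C"
    using tempered_bound[OF u] by blast
  have bound: "cmod (u f) \<le> C * B" if "f \<in> schwartz" "sbound k f B" "B > 0" for f B
    by (rule scaled_bound[OF _ that]) (rule C(2))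
  define L where "L = {js :: 'n list. length js \<le> k}"
  have fin: "finite L"
    unfolding L_def using finite_lists_length_le[of "UNIV :: 'n set" k] by auto
  have unif': "\<exists>\<delta>>0. \<forall>w\<in>cbox a b. \<forall>w'\<in>cbox a b. dist w w' < \<delta> \<longrightarrow>
       (\<forall>js s. length js \<le> k \<longrightarrow> wt s ^ k * cmod (iter_deriv js (\<Phi> w) s - iter_deriv js (\<Phi> w') s) \<le> \<epsilon>)"
    if "\<epsilon> > 0" for \<epsilon>
  proof -
    have "\<exists>\<delta>. \<forall>js. \<delta> js > 0 \<and> (\<forall>w\<in>cbox a b. \<forall>w'\<in>cbox a b. dist w w' < \<delta> js \<longrightarrow>
       (\<forall>s. wt s ^ k * cmod (iter_deriv js (\<Phi> w) s - iter_deriv js (\<Phi> w') s) \<le> \<epsilon>))"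
      by (intro choice allI unif that)
    then obtain \<delta> where d: "\<And>js. \<delta> js > 0" "\<And>js w w' s. w \<in> cbox a b \<Longrightarrow> w' \<in> cbox a b \<Longrightarrow> dist w w' < \<delta> js \<Longrightarrow>
       wt s ^ k * cmod (iter_deriv js (\<Phi> w) s - iter_deriv js (\<Phi> w') s) \<le> \<epsilon>" by blast
    have "Min (\<delta> ` L) > 0" using fin d(1) by (subst Min_gr_iff) (auto simp: L_def intro: exI[of _ "[]"])
    moreover have "Min (\<delta> ` L) \<le> \<delta> js" if "length js \<le> k" for js
      using fin that by (intro Min_le) (auto simp: L_def)
    ultimately show ?thesis using d(2) by (intro exI[of _ "Min (\<delta> ` L)"]) force
  qed
  obtain J where J: "((\<lambda>w. u (\<Phi> w)) has_integral J) (cbox a b)"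
    using integrable_integral[OF integrable_continuous[OF cont]] by blast
  have "cmod (J - u G) \<le> e" if e: "e > 0" for e
  proof -
    define V where "V = measure lborel (cbox a b)"
    have V: "V \<ge> 0" unfolding V_def by simp
    define \<epsilon> where "\<epsilon> = e / (2 * (C + 1) * (V + 1))"
    have eps: "\<epsilon> > 0" unfolding \<epsilon>_def using e C(1) V by simp
    obtain \<delta> where d: "\<delta> > 0" "\<And>w w' js s. w \<in> cbox a b \<Longrightarrow> w' \<in> cbox a b \<Longrightarrow> dist w w' < \<delta> \<Longrightarrow>
       length js \<le> k \<Longrightarrow> wt s ^ k * cmod (iter_deriv js (\<Phi> w) s - iter_deriv js (\<Phi> w') s) \<le> \<epsilon>"
      using unif'[OF eps] by metis
    obtain \<gamma> where g: "gauge \<gamma>" "\<And>p. p tagged_division_of cbox a b \<Longrightarrow> \<gamma> fine p \<Longrightarrow>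
        norm ((\<Sum>(x,K)\<in>p. measure lborel K *\<^sub>R u (\<Phi> x)) - J) < e / 2"
      using has_integralD[OF J half_gt_zero[OF e]] by blast
    \<comment> \<open>One division serves both purposes: \<open>\<gamma>\<close> controls the scalar
      Riemann sum, and the balls control the oscillation of \<open>\<Phi>\<close> on each
      piece.\<close>
    have "gauge (\<lambda>x. \<gamma> x \<inter> ball x \<delta>)" using g(1) d(1) by (intro gauge_Int) auto
    then obtain p where p: "p tagged_division_of cbox a b" "(\<lambda>x. \<gamma> x \<inter> ball x \<delta>) fine p"
      using fine_division_exists by blast
    have pf: "\<gamma> fine p" "(\<lambda>x. ball x \<delta>) fine p" using p(2) by (auto simp: fine_Int)
    define R where "R = (\<lambda>s. \<Sum>(x,K)\<in>p. complex_of_real (measure lborel K) * \<Phi> x s)"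
    have RS: "(\<lambda>s. complex_of_real (measure lborel K) * \<Phi> x s) \<in> schwartz" for x K by (intro schwartz_cmult S)
    have R: "R \<in> schwartz" unfolding R_def case_prod_beta' by (intro schwartz_sum RS)
    have uR: "u R = (\<Sum>(x,K)\<in>p. measure lborel K *\<^sub>R u (\<Phi> x))"
      unfolding R_def case_prod_beta' by (subst sum[OF RS]) (simp add: cmult[OF S] scaleR_conv_of_real)
    have "sbound k (\<lambda>s. R s - G s) (\<epsilon> * (V + 1))"
      unfolding sbound_def
    proof (intro allI impI)
      fix js :: "'n list" and s assume js: "length js \<le> k"
      define h where "h w = iter_deriv js (\<Phi> w) s" for w
      have hint: "(h has_integral iter_deriv js G s) (cbox a b)" unfolding h_def by (rule int)
      have iR: "iter_deriv js R s = (\<Sum>(x,K)\<in>p. measure lborel K *\<^sub>R h x)"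
        unfolding R_def case_prod_beta' h_def
        by (subst iter_deriv_sum) (auto simp: iter_deriv_cmult schwartz_smooth S schwartz_smooth[OF RS] scaleR_conv_of_real)
      have "integral (cbox a b) h = (\<Sum>(x,K)\<in>p. integral K h)"
        by (rule integral_combine_tagged_division_topdown[OF _ p(1)]) (use hint in blast)
      then have iG: "iter_deriv js G s = (\<Sum>(x,K)\<in>p. integral K h)"
        using hint by (simp add: integral_unique)
      have piece: "cmod (measure lborel K *\<^sub>R h x - integral K h) \<le> (\<epsilon> / wt s ^ k) * measure lborel K" if xK: "(x, K) \<in> p" for x K
      proof -
        obtain c d where K: "K = cbox c d" using tagged_division_ofD(4)[OF p(1) xK] by blast
        have KB: "K \<subseteq> cbox a b" "x \<in> K" using tagged_division_ofD(2,3)[OF p(1) xK] by auto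
        have "h integrable_on cbox c d" using integrable_on_subcbox[OF has_integral_integrable[OF hint]] KB(1) K by blast
        then have "((\<lambda>w. h x - h w) has_integral (measure lborel (cbox c d) *\<^sub>R h x - integral (cbox c d) h)) (cbox c d)"
          by (intro has_integral_diff has_integral_const integrable_integral)
        then have "cmod (measure lborel (cbox c d) *\<^sub>R h x - integral (cbox c d) h) \<le> (\<epsilon> / wt s ^ k) * measure lborel (cbox c d)"
        proof (rule has_integral_bound[rotated])
          fix w assume "w \<in> cbox c d"
          then have w: "w \<in> cbox a b" "dist x w < \<delta>"
            using KB(1) K fineD[OF pf(2) xK] by auto
          have "wt s ^ k * cmod (h x - h w) \<le> \<epsilon>"
            unfolding h_def using KB w by (intro d(2) js) auto
          then show "cmod (h x - h w) \<le> \<epsilon> / wt s ^ k" by (simp add: field_simps)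
        qed (use eps in auto)
        then show ?thesis by (simp add: K)
      qed
      have "cmod (iter_deriv js R s - iter_deriv js G s) = cmod (\<Sum>(x,K)\<in>p. measure lborel K *\<^sub>R h x - integral K h)"
        unfolding iR iG by (simp add: sum_subtractf case_prod_beta')
      also have "\<dots> \<le> (\<Sum>(x,K)\<in>p. (\<epsilon> / wt s ^ k) * measure lborel K)"
        using piece by (intro sum_norm_le) auto
      also have "\<dots> = (\<epsilon> / wt s ^ k) * V"
        unfolding V_def additive_content_tagged_division[OF p(1), symmetric]
        by (simp add: sum_distrib_left case_prod_beta')
      also have "\<dots> \<le> (\<epsilon> / wt s ^ k) * (V + 1)" using eps by (intro mult_left_mono) auto
      finally show "wt s ^ k * cmod (iter_deriv js (\<lambda>s. R s - G s) s) \<le> \<epsilon> * (V + 1)"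
        by (simp add: iter_deriv_diff schwartz_smooth R G field_simps)
    qed
    from bound[OF schwartz_diff[OF R G] this]
    have "cmod (u R - u G) \<le> C * (\<epsilon> * (V + 1))" using eps V by (simp add: diff R G)
    also have "\<dots> \<le> e / 2"
    proof -
      have "C * (\<epsilon> * (V + 1)) = (C / (C + 1)) * (e / 2)"
        unfolding \<epsilon>_def using V C(1) by (simp add: divide_simps)
      also have "\<dots> \<le> 1 * (e / 2)" using C(1) e by (intro mult_right_mono) auto
      finally show ?thesis by simp
    qed
    finally have "cmod (u R - u G) \<le> e / 2" .
    moreover have "cmod (u R - J) < e / 2" unfolding uR by (rule g(2)[OF p(1) pf(1)])
    ultimately show ?thesis
      using norm_triangle_ineq[of "J - u R" "u R - u G"] by (simp add: norm_minus_commute)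
  qed
  then have "cmod (J - u G) \<le> 0" by (metis field_le_epsilon add_0)
  with J show ?thesis by simp
qed


text \<open>Compactness gives uniformity only for bounded \<open>s\<close>. The spare power in
  \<open>wt s ^ Suc N\<close> makes both terms small outside the ball of radius \<open>R\<close>,
  which is chosen as \<open>2 * C / \<epsilon>\<close> for this purpose.\<close>

lemma uniform_iter_deriv:
  fixes \<Phi> :: "'w::euclidean_space \<Rightarrow> real ^ 'n::finite \<Rightarrow> complex"
  assumes cont: "continuous_on UNIV (\<lambda>(w, s). iter_deriv js (\<Phi> w) s)"
    and bound: "\<And>w s. w \<in> cbox a b \<Longrightarrow> wt s ^ Suc N * cmod (iter_deriv js (\<Phi> w) s) \<le> C"
    and e: "\<epsilon> > 0"
  shows "\<exists>\<delta>>0. \<forall>w\<in>cbox a b. \<forall>w'\<in>cbox a b. dist w w' < \<delta> \<longrightarrow>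
       (\<forall>s. wt s ^ N * cmod (iter_deriv js (\<Phi> w) s - iter_deriv js (\<Phi> w') s) \<le> \<epsilon>)"
proof -
  define R where "R = max 1 (2 * C / \<epsilon>)"
  define h where "h = (\<lambda>(w, s). iter_deriv js (\<Phi> w) s)"
  have "uniformly_continuous_on (cbox a b \<times> cball 0 R) h"
    unfolding h_def
    by (intro compact_uniformly_continuous compact_Times compact_cbox compact_cball continuous_on_subset[OF cont]) auto
  moreover have "\<epsilon> / (1 + R) ^ N > 0" using e unfolding R_def by auto
  ultimately obtain \<delta> where d: "\<delta> > 0" "\<And>z z'. z \<in> cbox a b \<times> cball 0 R \<Longrightarrow> z' \<in> cbox a b \<times> cball 0 R \<Longrightarrow>
      dist z' z < \<delta> \<Longrightarrow> dist (h z') (h z) < \<epsilon> / (1 + R) ^ N"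
    unfolding uniformly_continuous_on_def by metis
  have "wt s ^ N * cmod (iter_deriv js (\<Phi> w) s - iter_deriv js (\<Phi> w') s) \<le> \<epsilon>"
    if w: "w \<in> cbox a b" "w' \<in> cbox a b" "dist w w' < \<delta>" for w w' s
  proof (cases "norm s \<le> R")
    case True
    have "dist (h (w, s)) (h (w', s)) < \<epsilon> / (1 + R) ^ N"
      using w True by (intro d(2)) (auto simp: dist_Pair_Pair)
    then have "cmod (iter_deriv js (\<Phi> w) s - iter_deriv js (\<Phi> w') s) < \<epsilon> / (1 + R) ^ N"
      by (simp add: h_def dist_norm)
    moreover have "wt s ^ N \<le> (1 + R) ^ N" using True by (intro power_mono) (auto simp: wt_def)
    ultimately have "wt s ^ N * cmod (iter_deriv js (\<Phi> w) s - iter_deriv js (\<Phi> w') s) \<le> (1 + R) ^ N * (\<epsilon> / (1 + R) ^ N)"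
      by (intro mult_mono) (auto simp: R_def)
    also have "\<dots> = \<epsilon>" using e by (auto simp: R_def)
    finally show ?thesis .
  next
    case False
    then have "2 * C / \<epsilon> \<le> wt s" by (simp add: R_def wt_def)
    then have Cs: "2 * C \<le> \<epsilon> * wt s" using e by (simp add: field_simps)
    have "wt s ^ N * cmod (iter_deriv js (\<Phi> w) s - iter_deriv js (\<Phi> w') s) \<le>
        wt s ^ N * (cmod (iter_deriv js (\<Phi> w) s) + cmod (iter_deriv js (\<Phi> w') s))"
      by (intro mult_left_mono norm_triangle_ineq4) auto
    then have "wt s * (wt s ^ N * cmod (iter_deriv js (\<Phi> w) s - iter_deriv js (\<Phi> w') s)) \<le>
        wt s * (wt s ^ N * (cmod (iter_deriv js (\<Phi> w) s) + cmod (iter_deriv js (\<Phi> w') s)))"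
      by (intro mult_left_mono) auto
    also have "\<dots> \<le> 2 * C" using bound[OF w(1), of s] bound[OF w(2), of s] by (simp add: algebra_simps)
    also note Cs
    finally show ?thesis using wt_pos[of s] by (simp add: mult.commute)
  qed
  with d(1) show ?thesis by blast
qed

text \<open>A continuous family in the Schwartz space whose seminorms grow polynomially in
  \<open>w\<close>, so that it can be integrated against rapidly decaying coefficients. It is
  instantiated by the conjugated phase space shifts of a window.\<close>

locale schwartz_integral =
  fixes F :: "'w::euclidean_space \<Rightarrow> real ^ 'n::finite \<Rightarrow> complex"
  assumes FS: "F w \<in> schwartz"
    and cont: "continuous_on UNIV (\<lambda>(w, s). iter_deriv js (F w) s)"
    and growth: "\<exists>C\<ge>0. \<exists>K. \<forall>w s. wt s ^ N * cmod (iter_deriv js (F w) s) \<le> C * wt w ^ K"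
begin

definition rapid :: "('w \<Rightarrow> complex) \<Rightarrow> bool" where
  "rapid b \<longleftrightarrow> b \<in> borel_measurable borel \<and> (\<forall>K. integrable lborel (\<lambda>w. cmod (b w) * wt w ^ K))"

definition synth :: "('w \<Rightarrow> complex) \<Rightarrow> real ^ 'n \<Rightarrow> complex" where
  "synth b s = (\<integral>w. b w * F w s \<partial>lborel)"

lemma iter_measurable [measurable]: "(\<lambda>w. iter_deriv js (F w) s) \<in> borel_measurable borel"
proof (rule borel_measurable_continuous_onI)
  have "continuous_on UNIV ((\<lambda>(w, s). iter_deriv js (F w) s) \<circ> (\<lambda>w. (w, s)))"
    by (intro continuous_on_compose continuous_intros continuous_on_subset[OF cont]) auto
  then show "continuous_on UNIV (\<lambda>w. iter_deriv js (F w) s)" by (simp add: comp_def)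
qed

lemma iter_mult: "iter_deriv js (\<lambda>s. b w * F w s) = (\<lambda>s. b w * iter_deriv js (F w) s)"
  by (rule iter_deriv_cmult[OF schwartz_smooth[OF FS]])

lemma rapid_bound:
  assumes b: "rapid b"
  shows "\<exists>B. integrable lborel B \<and> (\<forall>w s. cmod (iter_deriv js (\<lambda>s. b w * F w s) s) \<le> B w)"
proof -
  obtain C K where C: "C \<ge> 0" "\<And>w s. wt s ^ 0 * cmod (iter_deriv js (F w) s) \<le> C * wt w ^ K"
    using growth[of 0 js] by metis
  have "integrable lborel (\<lambda>w. C * (cmod (b w) * wt w ^ K))" using b unfolding rapid_def by auto
  moreover have "cmod (iter_deriv js (\<lambda>s. b w * F w s) s) \<le> C * (cmod (b w) * wt w ^ K)" for w s
    unfolding iter_mult norm_mult using mult_left_mono[OF C(2)[where w=w and s=s] norm_ge_zero[of "b w"]] by (simp add: mult_ac)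
  ultimately show ?thesis by blast
qed

lemma
  assumes b: "rapid b"
  shows synth_smooth: "smooth (synth b)"
    and iter_synth: "iter_deriv js (synth b) s = (\<integral>w. b w * iter_deriv js (F w) s \<partial>lborel)"
    and synth_integrable: "integrable lborel (\<lambda>w. b w * iter_deriv js (F w) s)"
proof -
  have [measurable]: "b \<in> borel_measurable borel" using b by (simp add: rapid_def)
  have sm: "smooth (\<lambda>s. b w * F w s)" for w by (intro schwartz_smooth schwartz_cmult FS)
  have meas: "(\<lambda>w. iter_deriv js (\<lambda>s. b w * F w s) s) \<in> borel_measurable lborel" for js s
    unfolding iter_mult by measurable
  note * = smooth_integral[of "\<lambda>w s. b w * F w s", OF sm meas rapid_bound[OF b]]
  show "smooth (synth b)" unfolding synth_def[abs_def] by (rule *(1))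
  show "iter_deriv js (synth b) s = (\<integral>w. b w * iter_deriv js (F w) s \<partial>lborel)"
    unfolding synth_def[abs_def] *(2) iter_mult ..
  obtain B where B: "integrable lborel B" "\<And>w s. cmod (iter_deriv js (\<lambda>s. b w * F w s) s) \<le> B w"
    using rapid_bound[OF b] by blast
  show "integrable lborel (\<lambda>w. b w * iter_deriv js (F w) s)"
  proof (rule Bochner_Integration.integrable_bound[OF B(1)])
    show "AE w in lborel. cmod (b w * iter_deriv js (F w) s) \<le> norm (B w)"
      using B(2) unfolding iter_mult by (intro AE_I2) (metis abs_ge_self order_trans real_norm_def)
  qed measurable
qed

lemma synth_seminorm:
  "\<exists>C\<ge>0. \<exists>K. \<forall>b. rapid b \<longrightarrow> (\<forall>s. wt s ^ N * cmod (iter_deriv js (synth b) s) \<le> C * (\<integral>w. cmod (b w) * wt w ^ K \<partial>lborel))"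
proof -
  obtain C K where C: "C \<ge> 0" "\<And>w s. wt s ^ N * cmod (iter_deriv js (F w) s) \<le> C * wt w ^ K"
    using growth[of N js] by metis
  have "wt s ^ N * cmod (iter_deriv js (synth b) s) \<le> C * (\<integral>w. cmod (b w) * wt w ^ K \<partial>lborel)" if b: "rapid b" for b s
  proof -
    have "cmod (iter_deriv js (synth b) s) \<le> (\<integral>w. (C / wt s ^ N) * (cmod (b w) * wt w ^ K) \<partial>lborel)"
      unfolding iter_synth[OF b]
    proof (rule Bochner_Integration.integral_norm_bound_integral[OF synth_integrable[OF b]])
      show "integrable lborel (\<lambda>w. (C / wt s ^ N) * (cmod (b w) * wt w ^ K))"
        using b unfolding rapid_def by auto
      fix w
      have "cmod (iter_deriv js (F w) s) \<le> C * wt w ^ K / wt s ^ N" using C(2)[where w=w and s=s] by (simp add: field_simps)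
      then show "cmod (b w * iter_deriv js (F w) s) \<le> (C / wt s ^ N) * (cmod (b w) * wt w ^ K)"
        unfolding norm_mult using mult_left_mono[OF _ norm_ge_zero[of "b w"]] by (force simp: mult_ac)
    qed
    also have "\<dots> = (C / wt s ^ N) * (\<integral>w. cmod (b w) * wt w ^ K \<partial>lborel)" by simp
    finally show ?thesis by (simp add: field_simps)
  qed
  with C(1) show ?thesis by blast
qed

lemma synth_schwartz: assumes b: "rapid b" shows "synth b \<in> schwartz"
  unfolding schwartz_iff_sfam sfam_def
proof (intro conjI allI)
  fix js N
  obtain C K where C: "C \<ge> 0" "\<And>s. wt s ^ N * cmod (iter_deriv js (synth b) s) \<le> C * (\<integral>w. cmod (b w) * wt w ^ K \<partial>lborel)"
    using synth_seminorm[of N js] b by blast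
  then show "\<exists>C\<ge>0. \<forall>p::unit. \<forall>s. wt s ^ N * cmod (iter_deriv js (synth b) s) \<le> C * 1"
    by (intro exI[of _ "C * (\<integral>w. cmod (b w) * wt w ^ K \<partial>lborel)"]) (auto intro!: mult_nonneg_nonneg Bochner_Integration.integral_nonneg)
qed (rule synth_smooth[OF b])

lemma wt_weight_mono: "rapid b \<Longrightarrow> K \<le> K' \<Longrightarrow> (\<integral>w. cmod (b w) * wt w ^ K \<partial>lborel) \<le> (\<integral>w. cmod (b w) * wt w ^ K' \<partial>lborel)"
  unfolding rapid_def by (intro integral_mono) (auto intro!: mult_left_mono power_increasing)

text \<open>The constants do not depend on \<open>b\<close>. Applied to the part of a coefficient
  outside a large box, this gives the tail estimate in \<open>tempered_synth\<close>.\<close>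

lemma tempered_synth_bound:
  assumes u: "u \<in> tempered_distributions"
  shows "\<exists>C\<ge>0. \<exists>K. \<forall>b. rapid b \<longrightarrow> cmod (u (synth b)) \<le> C * (\<integral>w. cmod (b w) * wt w ^ K \<partial>lborel)"
proof -
  interpret u: schwartz_functional u by (rule tempered_functional[OF u])
  obtain k C where C: "C \<ge> 0" "\<And>f. f \<in> schwartz \<Longrightarrow> sbound k f 1 \<Longrightarrow> cmod (u f) \<le> C"
    using tempered_bound[OF u] by blast
  define L where "L = {js :: 'n list. length js \<le> k}"
  have fin: "finite L"
    unfolding L_def using finite_lists_length_le[of "UNIV :: 'n set" k] by auto
  have "\<exists>D. \<forall>js. D js \<ge> 0 \<and> (\<exists>K. \<forall>b. rapid b \<longrightarrow> (\<forall>s. wt s ^ k * cmod (iter_deriv js (synth b) s) \<le> D js * (\<integral>w. cmod (b w) * wt w ^ K \<partial>lborel)))"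
    using synth_seminorm[of k] by (intro choice allI) blast
  then obtain D where D: "\<And>js. D js \<ge> 0" "\<And>js. \<exists>K. \<forall>b. rapid b \<longrightarrow> (\<forall>s. wt s ^ k * cmod (iter_deriv js (synth b) s) \<le> D js * (\<integral>w. cmod (b w) * wt w ^ K \<partial>lborel))"
    by blast
  have "\<forall>js. \<exists>K. \<forall>b. rapid b \<longrightarrow> (\<forall>s. wt s ^ k * cmod (iter_deriv js (synth b) s) \<le> D js * (\<integral>w. cmod (b w) * wt w ^ K \<partial>lborel))"
    using D(2) by (rule allI)
  from choice[OF this] obtain K where K: "\<And>js b s. rapid b \<Longrightarrow> wt s ^ k * cmod (iter_deriv js (synth b) s) \<le> D js * (\<integral>w. cmod (b w) * wt w ^ K js \<partial>lborel)"
    by blast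
  define D' where "D' = (\<Sum>js\<in>L. D js)"
  define K' where "K' = (\<Sum>js\<in>L. K js)"
  have D': "D' \<ge> 0" unfolding D'_def using D(1) by (rule sum_nonneg)
  have "cmod (u (synth b)) \<le> (C * D') * (\<integral>w. cmod (b w) * wt w ^ K' \<partial>lborel)" if b: "rapid b" for b
  proof -
    define I where "I = (\<integral>w. cmod (b w) * wt w ^ K' \<partial>lborel)"
    have I: "I \<ge> 0" unfolding I_def by (intro Bochner_Integration.integral_nonneg) auto
    have sb: "sbound k (synth b) (D' * I)" unfolding sbound_def
    proof (intro allI impI)
      fix js :: "'n list" and s assume "length js \<le> k"
      then have js: "js \<in> L" by (simp add: L_def)
      have "D js \<le> D'" "K js \<le> K'" unfolding D'_def K'_def using fin js D(1) by (auto intro!: member_le_sum)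
      then have "D js * (\<integral>w. cmod (b w) * wt w ^ K js \<partial>lborel) \<le> D' * I"
        unfolding I_def using D(1) D' wt_weight_mono[OF b]
        by (intro mult_mono) (auto intro!: Bochner_Integration.integral_nonneg)
      then show "wt s ^ k * cmod (iter_deriv js (synth b) s) \<le> D' * I" using K[OF b, of s js] by linarith
    qed
    \<comment> \<open>\<open>scaled_bound\<close> asks for a positive bound, but
      \<open>D' * I\<close> may be 0; hence the detour through an arbitrarily small
      \<open>e\<close>.\<close>
    have "cmod (u (synth b)) \<le> C * (D' * I) + e" if e: "e > 0" for e
    proof -
      define r where "r = e / (C + 1)"
      have r: "r > 0" "C * r \<le> e" unfolding r_def using e C(1) by (auto simp: field_simps)
      have "cmod (u (synth b)) \<le> C * (D' * I + r)"
      proof (rule u.scaled_bound[where k=k])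
        show "sbound k (synth b) (D' * I + r)" by (rule sbound_mono[OF sb]) (use r in auto)
        show "D' * I + r > 0" using D' I r(1) by (simp add: add_nonneg_pos)
      qed (use C(2) synth_schwartz[OF b] in auto)
      then show ?thesis using r(2) by (simp add: algebra_simps)
    qed
    then have "cmod (u (synth b)) \<le> C * (D' * I)" by (rule field_le_epsilon)
    then show ?thesis by (simp add: I_def mult.assoc)
  qed
  moreover have "C * D' \<ge> 0" using C(1) D' by simp
  ultimately show ?thesis by blast
qed

lemma tempered_growth:
  assumes u: "u \<in> tempered_distributions"
  shows "\<exists>C\<ge>0. \<exists>K. \<forall>w. cmod (u (F w)) \<le> C * wt w ^ K"
proof -
  interpret u: schwartz_functional u by (rule tempered_functional[OF u])
  obtain k C where C: "C \<ge> 0" "\<And>f. f \<in> schwartz \<Longrightarrow> sbound k f 1 \<Longrightarrow> cmod (u f) \<le> C"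
    using tempered_bound[OF u] by blast
  define L where "L = {js :: 'n list. length js \<le> k}"
  have fin: "finite L"
    unfolding L_def using finite_lists_length_le[of "UNIV :: 'n set" k] by auto
  have "\<exists>D. \<forall>js. D js \<ge> 0 \<and> (\<exists>K. \<forall>w s. wt s ^ k * cmod (iter_deriv js (F w) s) \<le> D js * wt w ^ K)"
    using growth[of k] by (intro choice allI) blast
  then obtain D where D: "\<And>js. D js \<ge> 0" "\<And>js. \<exists>K. \<forall>w s. wt s ^ k * cmod (iter_deriv js (F w) s) \<le> D js * wt w ^ K"
    by blast
  have "\<forall>js. \<exists>K. \<forall>w s. wt s ^ k * cmod (iter_deriv js (F w) s) \<le> D js * wt w ^ K"
    using D(2) by (rule allI)
  from choice[OF this] obtain K where K: "\<And>js w s. wt s ^ k * cmod (iter_deriv js (F w) s) \<le> D js * wt w ^ K js"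
    by blast
  define D' where "D' = 1 + (\<Sum>js\<in>L. D js)"
  define K' where "K' = (\<Sum>js\<in>L. K js)"
  have D': "D' > 0" unfolding D'_def using sum_nonneg[of L D] D(1) by simp
  have "cmod (u (F w)) \<le> C * (D' * wt w ^ K')" for w
  proof (rule u.scaled_bound[where k=k])
    show "sbound k (F w) (D' * wt w ^ K')" unfolding sbound_def
    proof (intro allI impI)
      fix js :: "'n list" and s assume "length js \<le> k"
      then have js: "js \<in> L" by (simp add: L_def)
      have "D js \<le> (\<Sum>js\<in>L. D js)" "K js \<le> K'" unfolding K'_def using fin js D(1) by (auto intro!: member_le_sum)
      then have "D js * wt w ^ K js \<le> D' * wt w ^ K'"
        using D(1) D' by (intro mult_mono power_increasing) (auto simp: D'_def)
      then show "wt s ^ k * cmod (iter_deriv js (F w) s) \<le> D' * wt w ^ K'"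
        using K[of s js w] by linarith
    qed
  qed (use C(2) FS D' in auto)
  then have "cmod (u (F w)) \<le> (C * D') * wt w ^ K'" for w by (simp add: mult.assoc)
  moreover have "C * D' \<ge> 0" using C(1) D' by simp
  ultimately show ?thesis by blast
qed

lemma rapid_indicator:
  assumes "rapid b" "A \<in> sets borel"
  shows "rapid (\<lambda>w. indicator A w * b w)"
  unfolding rapid_def
proof (intro conjI allI)
  have [measurable]: "b \<in> borel_measurable borel" "A \<in> sets borel" using assms by (auto simp: rapid_def)
  show "(\<lambda>w. indicator A w * b w) \<in> borel_measurable borel" by measurable
  show "integrable lborel (\<lambda>w. cmod (indicator A w * b w) * wt w ^ K)" for K
    by (rule Bochner_Integration.integrable_bound[of _ "\<lambda>w. cmod (b w) * wt w ^ K"])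
      (use assms(1) in \<open>auto simp: rapid_def indicator_def\<close>)
qed

text \<open>Continuity is local in \<open>w\<close>, so a box around the point reduces it to
  \<open>uniform_iter_deriv\<close>. Only derivatives of order at most \<open>k\<close> matter for
  \<open>u\<close>, hence a minimum over finitely many radii.\<close>

lemma tempered_functional_continuous:
  assumes u: "u \<in> tempered_distributions"
  shows "continuous_on UNIV (\<lambda>w. u (F w))"
proof -
  interpret u: schwartz_functional u by (rule tempered_functional[OF u])
  obtain k C where C: "C \<ge> 0" "\<And>f. f \<in> schwartz \<Longrightarrow> sbound k f 1 \<Longrightarrow> cmod (u f) \<le> C"
    using tempered_bound[OF u] by blast
  define L where "L = {js :: 'n list. length js \<le> k}"
  have fin: "finite L" "L \<noteq> {}"
    unfolding L_def using finite_lists_length_le[of "UNIV :: 'n set" k] by (auto intro: exI[of _ "[]"])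
  have unif: "\<exists>\<delta>>0. \<forall>w'. dist w w' < \<delta> \<longrightarrow>
     (\<forall>s. wt s ^ k * cmod (iter_deriv js (F w) s - iter_deriv js (F w') s) \<le> \<epsilon>)" if e: "\<epsilon> > 0" for w js \<epsilon>
  proof -
    obtain D K where D: "D \<ge> 0" "\<And>w s. wt s ^ Suc k * cmod (iter_deriv js (F w) s) \<le> D * wt w ^ K"
      using growth[of "Suc k" js] by metis
    obtain l r where lr: "cball w 1 \<subseteq> cbox l r" using bounded_subset_cbox_symmetric[OF bounded_cball] by metis
    have "bounded ((\<lambda>w. D * wt w ^ K) ` cbox l r)"
      by (intro compact_imp_bounded compact_continuous_image continuous_intros) auto
    then obtain E where E: "\<And>w. w \<in> cbox l r \<Longrightarrow> D * wt w ^ K \<le> E"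
      unfolding bounded_iff by (metis (no_types, lifting) abs_le_D1 image_eqI real_norm_def)
    obtain \<delta> where d: "\<delta> > 0" "\<forall>w\<in>cbox l r. \<forall>w'\<in>cbox l r. dist w w' < \<delta> \<longrightarrow>
       (\<forall>s. wt s ^ k * cmod (iter_deriv js (F w) s - iter_deriv js (F w') s) \<le> \<epsilon>)"
      using uniform_iter_deriv[OF cont _ e, of l r k js E] D(2) E by (meson order_trans)
    show ?thesis
    proof (intro exI[of _ "min \<delta> 1"] conjI allI impI)
      fix w' s assume "dist w w' < min \<delta> 1"
      then have "w \<in> cbox l r" "w' \<in> cbox l r" "dist w w' < \<delta>" using lr by auto
      then show "wt s ^ k * cmod (iter_deriv js (F w) s - iter_deriv js (F w') s) \<le> \<epsilon>" using d(2) by blast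
    qed (use d(1) in auto)
  qed
  show ?thesis unfolding continuous_on_iff
  proof (intro ballI allI impI)
    fix w and e :: real assume e: "e > 0"
    define \<epsilon> where "\<epsilon> = e / (2 * (C + 1))"
    have eps: "\<epsilon> > 0" unfolding \<epsilon>_def using e C(1) by simp
    have "\<exists>\<delta>. \<forall>js. \<delta> js > 0 \<and> (\<forall>w'. dist w w' < \<delta> js \<longrightarrow>
       (\<forall>s. wt s ^ k * cmod (iter_deriv js (F w) s - iter_deriv js (F w') s) \<le> \<epsilon>))"
      by (intro choice allI unif eps)
    then obtain \<delta> where d: "\<And>js. \<delta> js > 0" "\<And>js w' s. dist w w' < \<delta> js \<Longrightarrow>
       wt s ^ k * cmod (iter_deriv js (F w) s - iter_deriv js (F w') s) \<le> \<epsilon>" by blast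
    have "dist (u (F w')) (u (F w)) < e" if w': "dist w' w < Min (\<delta> ` L)" for w'
    proof -
      have "sbound k (\<lambda>x. F w x - F w' x) \<epsilon>"
        unfolding sbound_def
      proof (intro allI impI)
        fix js :: "'n list" and s assume "length js \<le> k"
        then have "Min (\<delta> ` L) \<le> \<delta> js" using fin by (intro Min_le) (auto simp: L_def)
        then show "wt s ^ k * cmod (iter_deriv js (\<lambda>x. F w x - F w' x) s) \<le> \<epsilon>"
          using d(2)[of w' js s] w' by (simp add: iter_deriv_diff schwartz_smooth FS dist_commute)
      qed
      then have "cmod (u (\<lambda>x. F w x - F w' x)) \<le> C * \<epsilon>"
        by (intro u.scaled_bound[where k=k]) (use C(2) eps FS in \<open>auto intro: schwartz_diff\<close>)
      then have "dist (u (F w')) (u (F w)) \<le> C * \<epsilon>" by (simp add: u.diff FS dist_norm norm_minus_commute)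
      also have "C * \<epsilon> = (C / (C + 1)) * (e / 2)" unfolding \<epsilon>_def using C(1) by (simp add: divide_simps)
      also have "\<dots> \<le> 1 * (e / 2)" using C(1) e by (intro mult_right_mono) auto
      also have "1 * (e / 2) < e" using e by simp
      finally show ?thesis .
    qed
    moreover have "Min (\<delta> ` L) > 0" using fin d(1) by (subst Min_gr_iff) auto
    ultimately show "\<exists>d>0. \<forall>x'\<in>UNIV. dist x' w < d \<longrightarrow> dist (u (F x')) (u (F w)) < e" by blast
  qed
qed

text \<open>The indicator enters only the coefficient of \<open>synth\<close>: on the box itself the
  integrand must stay continuous for the Riemann sums.\<close>

lemma tempered_synth_cbox:
  assumes u: "u \<in> tempered_distributions" and a: "rapid a" and acont: "continuous_on UNIV a"
  shows "((\<lambda>w. a w * u (F w)) has_integral u (synth (\<lambda>w. indicator (cbox l r) w * a w))) (cbox l r)"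
proof -
  interpret u: schwartz_functional u by (rule tempered_functional[OF u])
  define B where "B = (cbox l r :: 'w set)"
  have ai: "rapid (\<lambda>w. indicator B w * a w)" unfolding B_def by (intro rapid_indicator a) auto
  have S: "(\<lambda>s. a w * F w s) \<in> schwartz" for w by (intro schwartz_cmult FS)
  have c2: "continuous_on UNIV (\<lambda>(w, s). iter_deriv js (\<lambda>s. a w * F w s) s)" for js
  proof -
    have "continuous_on UNIV (\<lambda>z :: 'w \<times> (real ^ 'n). a (fst z) * (case z of (w, s) \<Rightarrow> iter_deriv js (F w) s))"
      by (intro continuous_on_mult cont continuous_on_compose2[OF acont] continuous_intros) auto
    then show ?thesis unfolding iter_mult by (simp add: case_prod_beta')
  qed
  have "((\<lambda>w. u (\<lambda>s. a w * F w s)) has_integral u (synth (\<lambda>w. indicator B w * a w))) (cbox l r)"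
  proof (rule tempered_has_integral_cbox[OF u S synth_schwartz[OF ai]])
    show "continuous_on (cbox l r) (\<lambda>w. u (\<lambda>s. a w * F w s))"
      unfolding u.cmult[OF FS]
      by (intro continuous_intros continuous_on_subset[OF acont] continuous_on_subset[OF tempered_functional_continuous[OF u]]) auto
  next
    fix js s
    have "((\<lambda>w. (indicator B w * a w) * iter_deriv js (F w) s) has_integral iter_deriv js (synth (\<lambda>w. indicator B w * a w)) s) UNIV"
      unfolding iter_synth[OF ai] by (rule has_integral_integral_lborel[OF synth_integrable[OF ai]])
    then have "((\<lambda>w. if w \<in> B then a w * iter_deriv js (F w) s else 0) has_integral iter_deriv js (synth (\<lambda>w. indicator B w * a w)) s) UNIV"
      by (rule has_integral_eq[rotated]) (auto simp: indicator_def)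
    then show "((\<lambda>w. iter_deriv js (\<lambda>s. a w * F w s) s) has_integral iter_deriv js (synth (\<lambda>w. indicator B w * a w)) s) (cbox l r)"
      unfolding iter_mult has_integral_restrict_UNIV B_def .
  next
    fix js :: "'n list" and N and \<epsilon> :: real assume e: "\<epsilon> > 0"
    obtain C K where C: "C \<ge> 0" "\<And>w s. wt s ^ Suc N * cmod (iter_deriv js (F w) s) \<le> C * wt w ^ K"
      using growth[of "Suc N" js] by metis
    have "continuous_on (cbox l r) (\<lambda>w. cmod (a w) * (C * wt w ^ K))"
      by (intro continuous_intros continuous_on_subset[OF acont]) auto
    then have "bounded ((\<lambda>w. cmod (a w) * (C * wt w ^ K)) ` cbox l r)"
      by (intro compact_imp_bounded compact_continuous_image) auto
    then obtain D where D: "\<And>w. w \<in> cbox l r \<Longrightarrow> cmod (a w) * (C * wt w ^ K) \<le> D"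
      unfolding bounded_iff by (metis (no_types, lifting) abs_le_D1 image_eqI real_norm_def)
    show "\<exists>\<delta>>0. \<forall>w\<in>cbox l r. \<forall>w'\<in>cbox l r. dist w w' < \<delta> \<longrightarrow>
       (\<forall>s. wt s ^ N * cmod (iter_deriv js (\<lambda>s. a w * F w s) s - iter_deriv js (\<lambda>s. a w' * F w' s) s) \<le> \<epsilon>)"
    proof (rule uniform_iter_deriv[OF c2 _ e])
      fix w s assume w: "w \<in> cbox l r"
      have "wt s ^ Suc N * cmod (iter_deriv js (\<lambda>s. a w * F w s) s) = cmod (a w) * (wt s ^ Suc N * cmod (iter_deriv js (F w) s))"
        unfolding iter_mult norm_mult by (simp only: mult_ac)
      also have "\<dots> \<le> cmod (a w) * (C * wt w ^ K)" by (intro mult_left_mono C(2)) auto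
      also have "\<dots> \<le> D" by (rule D[OF w])
      finally show "wt s ^ Suc N * cmod (iter_deriv js (\<lambda>s. a w * F w s) s) \<le> D" .
    qed
  qed
  then show ?thesis unfolding B_def by (simp add: u.cmult[OF FS])
qed

text \<open>Exhaustion by boxes. The scalar integrals converge by dominated convergence, since
  \<open>u (F w)\<close> grows polynomially; the values of \<open>u\<close> converge by the uniform
  bound for the coefficient outside the box.\<close>

theorem tempered_synth:
  assumes u: "u \<in> tempered_distributions" and a: "rapid a" and acont: "continuous_on UNIV a"
  shows "u (synth a) = (\<integral>w. a w * u (F w) \<partial>lborel)"
proof -
  interpret u: schwartz_functional u by (rule tempered_functional[OF u])
  have [measurable]: "a \<in> borel_measurable borel" using a by (simp add: rapid_def)
  have [measurable]: "(\<lambda>w. u (F w)) \<in> borel_measurable borel"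
    by (intro borel_measurable_continuous_onI tempered_functional_continuous u)
  obtain C K where C: "C \<ge> 0" "\<And>w. cmod (u (F w)) \<le> C * wt w ^ K" using tempered_growth[OF u] by metis
  have dom: "integrable lborel (\<lambda>w. C * (cmod (a w) * wt w ^ K))" using a by (auto simp: rapid_def)
  have le: "cmod (a w * u (F w)) \<le> C * (cmod (a w) * wt w ^ K)" for w
    using mult_left_mono[OF C(2)[of w] norm_ge_zero[of "a w"]] by (simp add: norm_mult mult_ac)
  have int: "integrable lborel (\<lambda>w. a w * u (F w))"
    by (rule Bochner_Integration.integrable_bound[OF dom])
      (use order_trans[OF le abs_ge_self] in auto)
  define B where "B m = (cbox (- real m *\<^sub>R One) (real m *\<^sub>R One) :: 'w set)" for m
  have Bm [measurable]: "B m \<in> sets borel" for m unfolding B_def by simp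
  have ev: "\<forall>\<^sub>F m in sequentially. w \<in> B m" for w
  proof -
    obtain m0 :: nat where m0: "norm w \<le> real m0" using real_arch_simple by blast
    have "w \<in> B m" if "m \<ge> m0" for m
    proof -
      have "\<bar>w \<bullet> b\<bar> \<le> real m" if "b \<in> Basis" for b
        using Basis_le_norm[OF that, of w] m0 \<open>m \<ge> m0\<close> by linarith
      then show ?thesis unfolding B_def mem_box by (auto simp: abs_le_iff inner_sum_left_Basis) (smt (verit))+
    qed
    then show ?thesis by (auto simp: eventually_sequentially)
  qed
  have eq: "u (synth (\<lambda>w. indicator (B m) w * a w)) = (\<integral>w. indicator (B m) w * (a w * u (F w)) \<partial>lborel)" for m
  proof -
    have i: "integrable lborel (\<lambda>w. indicator (B m) w * (a w * u (F w)))"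
      by (rule Bochner_Integration.integrable_bound[OF int]) (auto simp: indicator_def)
    have "((\<lambda>w. indicator (B m) w * (a w * u (F w))) has_integral (\<integral>w. indicator (B m) w * (a w * u (F w)) \<partial>lborel)) UNIV"
      by (rule has_integral_integral_lborel[OF i])
    then have "((\<lambda>w. if w \<in> B m then a w * u (F w) else 0) has_integral (\<integral>w. indicator (B m) w * (a w * u (F w)) \<partial>lborel)) UNIV"
      by (rule has_integral_eq[rotated]) (auto simp: indicator_def)
    then have "((\<lambda>w. a w * u (F w)) has_integral (\<integral>w. indicator (B m) w * (a w * u (F w)) \<partial>lborel)) (B m)"
      unfolding has_integral_restrict_UNIV .
    moreover have "((\<lambda>w. a w * u (F w)) has_integral u (synth (\<lambda>w. indicator (B m) w * a w))) (B m)"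
      unfolding B_def by (rule tempered_synth_cbox[OF u a acont])
    ultimately show ?thesis by (rule has_integral_unique[symmetric])
  qed
  have "(\<lambda>m. \<integral>w. indicator (B m) w * (a w * u (F w)) \<partial>lborel) \<longlonglongrightarrow> (\<integral>w. a w * u (F w) \<partial>lborel)"
  proof (rule integral_dominated_convergence[OF _ _ dom])
    show "AE w in lborel. (\<lambda>m. indicator (B m) w * (a w * u (F w))) \<longlonglongrightarrow> a w * u (F w)"
    proof (rule AE_I2)
      fix w
      have "\<forall>\<^sub>F m in sequentially. indicator (B m) w * (a w * u (F w)) = a w * u (F w)"
        using ev[of w] by eventually_elim simp
      then show "(\<lambda>m. indicator (B m) w * (a w * u (F w))) \<longlonglongrightarrow> a w * u (F w)" by (rule tendsto_eventually)
    qed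
    show "AE w in lborel. norm (indicator (B m) w * (a w * u (F w))) \<le> C * (cmod (a w) * wt w ^ K)" for m
      using le C(1) by (intro AE_I2) (auto simp: indicator_def)
  qed auto
  moreover have "(\<lambda>m. u (synth (\<lambda>w. indicator (B m) w * a w))) \<longlonglongrightarrow> u (synth a)"
  proof -
    obtain C' K' where C': "C' \<ge> 0" "\<And>b. rapid b \<Longrightarrow> cmod (u (synth b)) \<le> C' * (\<integral>w. cmod (b w) * wt w ^ K' \<partial>lborel)"
      using tempered_synth_bound[OF u] by metis
    define c where "c m w = indicator (- B m) w * a w" for m w
    have rc: "rapid (c m)" and rb: "rapid (\<lambda>w. indicator (B m) w * a w)" for m
      unfolding c_def by (auto intro!: rapid_indicator a)
    have "synth (c m) = (\<lambda>s. synth a s - synth (\<lambda>w. indicator (B m) w * a w) s)" for m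
    proof
      fix s
      have "(\<integral>w. a w * F w s - (indicator (B m) w * a w) * F w s \<partial>lborel) = synth a s - synth (\<lambda>w. indicator (B m) w * a w) s"
        unfolding synth_def
        using synth_integrable[OF a, of "[]" s] synth_integrable[OF rb, of m "[]" s]
        by (intro Bochner_Integration.integral_diff) auto
      moreover have "a w * F w s - (indicator (B m) w * a w) * F w s = c m w * F w s" for w
        by (auto simp: c_def indicator_def)
      ultimately show "synth (c m) s = synth a s - synth (\<lambda>w. indicator (B m) w * a w) s"
        unfolding synth_def[of "c m"] by simp
    qed
    then have "u (synth (c m)) = u (synth a) - u (synth (\<lambda>w. indicator (B m) w * a w))" for m
      by (simp add: u.diff synth_schwartz a rb)
    then have bd: "cmod (u (synth a) - u (synth (\<lambda>w. indicator (B m) w * a w))) \<le> C' * (\<integral>w. cmod (c m w) * wt w ^ K' \<partial>lborel)" for m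
      using C'(2)[OF rc] by metis
    have "(\<lambda>m. \<integral>w. cmod (c m w) * wt w ^ K' \<partial>lborel) \<longlonglongrightarrow> (\<integral>w. 0 \<partial>(lborel :: 'w measure))"
    proof (rule integral_dominated_convergence[where w="\<lambda>w. cmod (a w) * wt w ^ K'"])
      show "AE w in lborel. (\<lambda>m. cmod (c m w) * wt w ^ K') \<longlonglongrightarrow> 0"
      proof (rule AE_I2)
        fix w
        have "\<forall>\<^sub>F m in sequentially. cmod (c m w) * wt w ^ K' = 0"
          using ev[of w] by eventually_elim (simp add: c_def)
        then show "(\<lambda>m. cmod (c m w) * wt w ^ K') \<longlonglongrightarrow> 0" by (rule tendsto_eventually)
      qed
      show "AE w in lborel. norm (cmod (c m w) * wt w ^ K') \<le> cmod (a w) * wt w ^ K'" for m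
        by (intro AE_I2) (auto simp: c_def indicator_def)
    qed (use a in \<open>auto simp: rapid_def c_def\<close>)
    then have "(\<lambda>m. C' * (\<integral>w. cmod (c m w) * wt w ^ K' \<partial>lborel)) \<longlonglongrightarrow> 0"
      by (intro tendsto_mult_right_zero) simp
    then have "(\<lambda>m. u (synth a) - u (synth (\<lambda>w. indicator (B m) w * a w))) \<longlonglongrightarrow> 0"
      by (rule Lim_null_comparison[rotated]) (auto simp: bd)
    from tendsto_diff[OF tendsto_const[of "u (synth a)"] this] show ?thesis by simp
  qed
  ultimately show ?thesis unfolding eq by (rule LIMSEQ_unique[symmetric])
qed

end


section \<open>The short-time Fourier transform\<close>

text \<open>The phase space shift written \<open>\<pi>(w)\<close> in the overview, with the position
  first and the frequency second.\<close>

definition tfs :: "(real ^ 'n::finite \<Rightarrow> complex) \<Rightarrow> (real ^ 'n) \<times> (real ^ 'n) \<Rightarrow> real ^ 'n \<Rightarrow> complex" where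
  "tfs \<psi> w s = cis (s \<bullet> snd w) * \<psi> (s - fst w)"

text \<open>What \<open>stft\<close> gives for the distribution defined by integration against
  \<open>g\<close>; written as a Fourier transform so that inversion applies to it.\<close>

definition fstft :: "(real ^ 'n::finite \<Rightarrow> complex) \<Rightarrow> (real ^ 'n \<Rightarrow> complex) \<Rightarrow> (real ^ 'n) \<times> (real ^ 'n) \<Rightarrow> complex" where
  "fstft \<phi> g w = fourier (\<lambda>s. g s * cnj (\<phi> (s - fst w))) (snd w)"

lemma wt_fst_le: "wt (fst w) \<le> wt w" and wt_snd_le: "wt (snd w) \<le> wt w"
  unfolding wt_def using norm_fst_le[of "fst w" "snd w"] norm_snd_le[of "snd w" "fst w"] by simp_all

lemma schwartz_translate_minus: "f \<in> schwartz \<Longrightarrow> (\<lambda>x. f (x - a)) \<in> schwartz"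
  using schwartz_translate[of f "- a"] by simp

lemma schwartz_tfs: "\<psi> \<in> schwartz \<Longrightarrow> tfs \<psi> w \<in> schwartz"
  unfolding tfs_def[abs_def] by (intro schwartz_modulate schwartz_translate_minus)

text \<open>A derivative either produces a frequency factor or falls on the window. Continuity and
  growth of all derivatives follow by induction over the list for all windows at once.\<close>

lemma iter_deriv_tfs_snoc:
  assumes \<psi>: "\<psi> \<in> schwartz"
  shows "iter_deriv (js @ [j]) (tfs \<psi> w) s =
    \<i> * complex_of_real (snd w $ j) * iter_deriv js (tfs \<psi> w) s + iter_deriv js (tfs (partial_deriv j \<psi>) w) s"
proof -
  define e where "e s = cis (s \<bullet> snd w)" for s
  define f where "f s = \<psi> (s - fst w)" for s
  have sm: "smooth e" "smooth f"
    unfolding e_def f_def by (auto intro: ofam_smooth[OF ofam_cis_inner] schwartz_smooth schwartz_translate_minus \<psi>)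
  have de: "partial_deriv j e = (\<lambda>s. \<i> * complex_of_real (snd w $ j) * e s)"
    using partial_deriv_cis_inner[of j 1 "snd w"] unfolding e_def by simp
  have df: "partial_deriv j f = (\<lambda>s. partial_deriv j \<psi> (s - fst w))"
    using iter_deriv_translate[of "[j]" \<psi> "- fst w"] unfolding f_def by (simp add: iter_deriv_Cons)
  have "partial_deriv j (tfs \<psi> w) = (\<lambda>s. \<i> * complex_of_real (snd w $ j) * tfs \<psi> w s + tfs (partial_deriv j \<psi>) w s)"
    using partial_deriv_smooth_mult[OF sm, of j] unfolding tfs_def[abs_def] de df
    unfolding e_def f_def by (simp add: algebra_simps)
  then show ?thesis unfolding iter_deriv_snoc
    using schwartz_smooth[OF schwartz_tfs[OF \<psi>]] schwartz_smooth[OF schwartz_tfs[OF schwartz_partial_deriv[OF \<psi>]]]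
    by (simp add: iter_deriv_add iter_deriv_cmult smooth_mult)
qed

lemma iter_deriv_tfs_continuous:
  "\<psi> \<in> schwartz \<Longrightarrow> continuous_on UNIV (\<lambda>(w, s). iter_deriv js (tfs \<psi> w) s)"
proof (induction js arbitrary: \<psi> rule: rev_induct)
  case Nil
  have "continuous_on UNIV (\<lambda>z :: ((real ^ 'a) \<times> (real ^ 'a)) \<times> (real ^ 'a). cis (snd z \<bullet> snd (fst z)) * \<psi> (snd z - fst (fst z)))"
    unfolding cis_conv_exp
    by (intro continuous_intros continuous_on_compose2[OF schwartz_continuous_on[OF Nil, of UNIV]]) auto
  then show ?case by (simp add: tfs_def case_prod_beta')
next
  case (snoc j js)
  have "continuous_on UNIV (\<lambda>z :: ((real ^ 'a) \<times> (real ^ 'a)) \<times> (real ^ 'a).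
      \<i> * complex_of_real (snd (fst z) $ j) * (case z of (w, s) \<Rightarrow> iter_deriv js (tfs \<psi> w) s) +
      (case z of (w, s) \<Rightarrow> iter_deriv js (tfs (partial_deriv j \<psi>) w) s))"
    by (intro continuous_intros snoc.IH[OF snoc.prems] snoc.IH[OF schwartz_partial_deriv[OF snoc.prems]])
  then show ?case unfolding iter_deriv_tfs_snoc[OF snoc.prems] by (simp add: case_prod_beta')
qed

lemma iter_deriv_tfs_growth:
  "\<psi> \<in> schwartz \<Longrightarrow> \<exists>C\<ge>0. \<exists>K. \<forall>w s. wt s ^ N * cmod (iter_deriv js (tfs \<psi> w) s) \<le> C * wt w ^ K"
proof (induction js arbitrary: \<psi> rule: rev_induct)
  case Nil
  obtain C where C: "C \<ge> 0" "\<And>x. wt x ^ N * cmod (\<psi> x) \<le> C" using schwartz_bound[OF Nil] by blast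
  have "wt s ^ N * cmod (tfs \<psi> w s) \<le> C * wt w ^ N" for w s
  proof -
    have "wt s \<le> wt (s - fst w) * wt (fst w)" using wt_add_le[of "s - fst w" "fst w"] by simp
    also have "\<dots> \<le> wt (s - fst w) * wt w" by (intro mult_left_mono wt_fst_le) auto
    finally have "wt s ^ N \<le> (wt (s - fst w) * wt w) ^ N" by (intro power_mono) auto
    then have "wt s ^ N * cmod (\<psi> (s - fst w)) \<le> (wt (s - fst w) * wt w) ^ N * cmod (\<psi> (s - fst w))"
      by (rule mult_right_mono) auto
    also have "\<dots> = wt w ^ N * (wt (s - fst w) ^ N * cmod (\<psi> (s - fst w)))"
      by (simp add: power_mult_distrib)
    also have "\<dots> \<le> wt w ^ N * C" by (intro mult_left_mono C(2)) auto
    finally show ?thesis by (simp add: tfs_def norm_mult mult.commute)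
  qed
  then show ?case using C(1) unfolding iter_deriv_Nil by blast
next
  case (snoc j js)
  obtain C1 K1 where C1: "C1 \<ge> 0" "\<And>w s. wt s ^ N * cmod (iter_deriv js (tfs \<psi> w) s) \<le> C1 * wt w ^ K1"
    using snoc.IH[OF snoc.prems] by blast
  obtain C2 K2 where C2: "C2 \<ge> 0" "\<And>w s. wt s ^ N * cmod (iter_deriv js (tfs (partial_deriv j \<psi>) w) s) \<le> C2 * wt w ^ K2"
    using snoc.IH[OF schwartz_partial_deriv[OF snoc.prems]] by blast
  have "wt s ^ N * cmod (iter_deriv (js @ [j]) (tfs \<psi> w) s) \<le> (C1 + C2) * wt w ^ (Suc (K1 + K2))" for w s
  proof -
    have "cmod (iter_deriv (js @ [j]) (tfs \<psi> w) s) \<le>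
        \<bar>snd w $ j\<bar> * cmod (iter_deriv js (tfs \<psi> w) s) + cmod (iter_deriv js (tfs (partial_deriv j \<psi>) w) s)"
      unfolding iter_deriv_tfs_snoc[OF snoc.prems]
      by (rule order_trans[OF norm_triangle_ineq]) (simp add: norm_mult)
    then have "wt s ^ N * cmod (iter_deriv (js @ [j]) (tfs \<psi> w) s) \<le> wt s ^ N * \<dots>"
      by (rule mult_left_mono) auto
    also have "\<dots> = \<bar>snd w $ j\<bar> * (wt s ^ N * cmod (iter_deriv js (tfs \<psi> w) s)) +
        wt s ^ N * cmod (iter_deriv js (tfs (partial_deriv j \<psi>) w) s)" by (simp add: algebra_simps)
    also have "\<dots> \<le> wt w * (C1 * wt w ^ K1) + C2 * wt w ^ K2"
      by (rule add_mono[OF mult_mono[OF order_trans[OF wt_component_le wt_snd_le] C1(2)] C2(2)]) auto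
    also have "\<dots> = C1 * wt w ^ Suc K1 + C2 * wt w ^ K2" by simp
    also have "\<dots> \<le> C1 * wt w ^ (Suc (K1 + K2)) + C2 * wt w ^ (Suc (K1 + K2))"
      using C1(1) C2(1) by (intro add_mono mult_left_mono power_increasing) auto
    finally show ?thesis by (simp add: algebra_simps)
  qed
  moreover have "C1 + C2 \<ge> 0" using C1(1) C2(1) by simp
  ultimately show ?case by blast
qed

lemma schwartz_integral_tfs:
  assumes \<phi>: "\<phi> \<in> schwartz"
  shows "schwartz_integral (\<lambda>w s. cnj (tfs \<phi> w s))"
proof -
  have it: "iter_deriv js (\<lambda>s. cnj (tfs \<phi> w s)) = (\<lambda>s. cnj (iter_deriv js (tfs \<phi> w) s))" for js w
    by (intro iter_deriv_bounded_linear bounded_linear_cnj schwartz_smooth schwartz_tfs \<phi>)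
  show ?thesis
  proof
    show "(\<lambda>s. cnj (tfs \<phi> w s)) \<in> schwartz" for w by (intro schwartz_cnj schwartz_tfs \<phi>)
    show "continuous_on UNIV (\<lambda>(w, s). iter_deriv js (\<lambda>s. cnj (tfs \<phi> w s)) s)" for js
      unfolding it using continuous_on_cnj[OF iter_deriv_tfs_continuous[OF \<phi>, of js]] by (simp add: case_prod_beta')
    show "\<exists>C\<ge>0. \<exists>K. \<forall>w s. wt s ^ N * cmod (iter_deriv js (\<lambda>s. cnj (tfs \<phi> w s)) s) \<le> C * wt w ^ K" for js N
      unfolding it complex_mod_cnj by (rule iter_deriv_tfs_growth[OF \<phi>])
  qed
qed

lemma stft_eq: "stft \<phi> u x \<xi> = complex_of_real ((2 * pi) powr (- real CARD('n) / 2)) * u (\<lambda>s. cnj (tfs \<phi> (x, \<xi>) s))"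
  for \<phi> :: "real ^ 'n::finite \<Rightarrow> complex"
  by (simp add: stft_def pairing_def tfs_def)

section \<open>The reproducing formula of the short-time Fourier transform\<close>

definition norm_sq :: "(real ^ 'n::finite \<Rightarrow> complex) \<Rightarrow> complex" where
  "norm_sq \<phi> = (\<integral>x. \<phi> x * cnj (\<phi> x) \<partial>lborel)"

lemma schwartz_mult:
  "f \<in> schwartz \<Longrightarrow> g \<in> schwartz \<Longrightarrow> (\<lambda>x. f x * g x) \<in> schwartz"
  by (rule schwartz_mult_ofam[OF schwartz_ofam])

text \<open>A continuous function that vanishes almost everywhere vanishes, because a nonempty open
  set is not negligible.\<close>

lemma norm_sq_nonzero:
  assumes \<phi>: "\<phi> \<in> schwartz" "\<phi> \<noteq> (\<lambda>x. 0)"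
  shows "norm_sq \<phi> \<noteq> 0"
proof
  assume "norm_sq \<phi> = 0"
  have int: "integrable lborel (\<lambda>x. complex_of_real ((cmod (\<phi> x))\<^sup>2))"
    using schwartz_integrable[OF schwartz_mult[OF \<phi>(1) schwartz_cnj[OF \<phi>(1)]]]
    unfolding complex_norm_square .
  have "norm_sq \<phi> = complex_of_real (\<integral>x. (cmod (\<phi> x))\<^sup>2 \<partial>lborel)"
    unfolding norm_sq_def complex_norm_square[symmetric] by (rule integral_complex_of_real)
  with \<open>norm_sq \<phi> = 0\<close> have "(\<integral>x. (cmod (\<phi> x))\<^sup>2 \<partial>lborel) = 0" by simp
  moreover have "integrable lborel (\<lambda>x. (cmod (\<phi> x))\<^sup>2)"
    using int unfolding complex_of_real_integrable_eq .
  ultimately have ae: "AE x in lborel. \<phi> x = 0"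
    by (subst (asm) integral_nonneg_eq_0_iff_AE) auto
  define U where "U = {x. \<phi> x \<noteq> 0}"
  have "open U" unfolding U_def
    using open_Collect_neq[OF schwartz_continuous_on[OF \<phi>(1)] continuous_on_const] .
  moreover have "U \<noteq> {}" unfolding U_def using \<phi>(2) by auto
  ultimately have "\<not> negligible U" by (rule open_not_negligible)
  moreover have "U \<in> null_sets lborel"
    using ae \<open>open U\<close> unfolding U_def by (subst (asm) AE_iff_null) (auto simp: borel_open)
  then have "U \<in> null_sets lebesgue" by (rule null_sets_completionI)
  ultimately show False by (simp add: negligible_iff_null_sets)
qed

lemma fourier_tfs:
  assumes "\<phi> \<in> schwartz"
  shows "fourier (tfs \<phi> (x, \<xi>)) \<zeta> = cis (- (x \<bullet> (\<zeta> - \<xi>))) * fourier \<phi> (\<zeta> - \<xi>)"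
  unfolding tfs_def[abs_def] fst_conv snd_conv fourier_modulate
  by (rule fourier_translate[OF schwartz_measurable[OF assms]])

lemma fstft_integrand: "\<phi> \<in> schwartz \<Longrightarrow> g \<in> schwartz \<Longrightarrow> (\<lambda>s. g s * cnj (\<phi> (s - a))) \<in> schwartz"
  by (intro schwartz_mult schwartz_cnj schwartz_translate_minus)

lemma fstft_continuous:
  assumes \<phi>: "\<phi> \<in> schwartz" and g: "g \<in> schwartz"
  shows "continuous_on UNIV (fstft \<phi> g)"
proof -
  have [measurable]: "\<phi> \<in> borel_measurable borel" "g \<in> borel_measurable borel"
    using \<phi> g by (auto intro: schwartz_measurable)
  obtain C where C: "C \<ge> 0" "\<And>x. wt x ^ 0 * cmod (\<phi> x) \<le> C" using schwartz_bound[OF \<phi>, of 0] by blast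
  have "continuous_on UNIV (\<lambda>w. \<integral>s. g s * cnj (\<phi> (s - fst w)) * cis (- (s \<bullet> snd w)) \<partial>lborel)"
  proof (rule continuous_on_integral[where B="\<lambda>s. cmod (g s) * C"])
    show "continuous_on UNIV (\<lambda>w. g s * cnj (\<phi> (s - fst w)) * cis (- (s \<bullet> snd w)))" for s
      unfolding cis_conv_exp
      by (intro continuous_intros continuous_on_compose2[OF schwartz_continuous_on[OF \<phi>, of UNIV]]) auto
    show "cmod (g s * cnj (\<phi> (s - fst w)) * cis (- (s \<bullet> snd w))) \<le> cmod (g s) * C" for w s
      using C by (auto simp: norm_mult intro!: mult_left_mono)
    show "(\<lambda>s. g s * cnj (\<phi> (s - fst w)) * cis (- (s \<bullet> snd w))) \<in> borel_measurable lborel" for w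
      by (rule borel_measurable_times)
        (use schwartz_measurable[OF fstft_integrand[OF \<phi> g, of "fst w"]] in \<open>auto intro!: borel_measurable_cis\<close>)
    show "integrable lborel (\<lambda>s. cmod (g s) * C)" using schwartz_integrable[OF g] by auto
  qed
  then show ?thesis unfolding fstft_def[abs_def] fourier_def by (intro continuous_intros)
qed

lemma wt_prod_le: "wt w \<le> wt (fst w) * wt (snd w)"
proof -
  have "norm w \<le> norm (fst w) + norm (snd w)" using norm_Pair_le[of "fst w" "snd w"] by simp
  then show ?thesis unfolding wt_def by (simp add: algebra_simps) (smt (verit) mult_nonneg_nonneg norm_ge_zero)
qed

text \<open>The synthesis formula for \<open>g\<close> is first proved pointwise, and then
  \<open>u\<close> is moved under the integral by \<open>tempered_synth\<close>. The decay
  hypothesis makes the coefficient rapid; the kernel estimate supplies it in the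
  application.\<close>

lemma stft_reproducing:
  fixes \<phi> g :: "real ^ 'n::finite \<Rightarrow> complex"
  assumes u: "u \<in> tempered_distributions" and \<phi>: "\<phi> \<in> schwartz" and g: "g \<in> schwartz"
    and decay: "\<And>N. \<exists>C. \<forall>y \<eta>. wt y ^ N * wt \<eta> ^ N * cmod (fstft \<phi> g (y, \<eta>)) \<le> C"
  shows "norm_sq \<phi> * pairing u g = (\<integral>w. cnj (fstft \<phi> g w) * stft \<phi> u (fst w) (snd w) \<partial>lborel)"
proof -
  define c where "c = complex_of_real ((2 * pi) powr (- real CARD('n) / 2))"
  have c0: "c \<noteq> 0" unfolding c_def by simp
  have [measurable]: "\<phi> \<in> borel_measurable borel" "g \<in> borel_measurable borel"
    using \<phi> g by (auto intro: schwartz_measurable)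
  interpret S: schwartz_integral "\<lambda>w s. cnj (tfs \<phi> w s)" by (rule schwartz_integral_tfs[OF \<phi>])
  define a where "a w = cnj (fstft \<phi> g w)" for w
  have acont: "continuous_on UNIV a" unfolding a_def by (intro continuous_on_cnj fstft_continuous \<phi> g)
  then have am [measurable]: "a \<in> borel_measurable borel" by (rule borel_measurable_continuous_onI)
  have adecay: "\<exists>C. \<forall>w. wt w ^ N * cmod (a w) \<le> C" for N
  proof -
    obtain C where C: "\<And>y \<eta>. wt y ^ N * wt \<eta> ^ N * cmod (fstft \<phi> g (y, \<eta>)) \<le> C" using decay by blast
    have "wt w ^ N * cmod (a w) \<le> C" for w
    proof -
      have "wt w ^ N \<le> (wt (fst w) * wt (snd w)) ^ N" by (intro power_mono wt_prod_le) auto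
      then have "wt w ^ N * cmod (a w) \<le> (wt (fst w) * wt (snd w)) ^ N * cmod (a w)" by (rule mult_right_mono) auto
      also have "\<dots> \<le> C" using C[of "fst w" "snd w"] by (simp add: a_def power_mult_distrib)
      finally show ?thesis .
    qed
    then show ?thesis by blast
  qed
  have ar: "S.rapid a" unfolding S.rapid_def
  proof (intro conjI allI)
    fix K
    obtain C where C: "\<And>w. wt w ^ (2 * DIM((real ^ 'n) \<times> (real ^ 'n)) + K) * cmod (a w) \<le> C" using adecay by blast
    show "integrable lborel (\<lambda>w. cmod (a w) * wt w ^ K)"
      by (rule integrable_wt_bound[where C=C]) (use C in \<open>auto simp: power_add mult_ac\<close>)
  qed simp
  have synth: "S.synth a s = (norm_sq \<phi> / c) * cnj (g s)" for s
  proof -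
    define H where "H = (\<lambda>(y, \<eta>). a (y, \<eta>) * cnj (tfs \<phi> (y, \<eta>) s))"
    have "integrable lborel H"
      using S.synth_integrable[OF ar, of "[]" s] by (simp add: H_def case_prod_beta')
    then have Hint: "integrable (lborel \<Otimes>\<^sub>M lborel) H" by (simp add: lborel_prod)
    \<comment> \<open>At fixed \<open>y\<close>, Fourier inversion of \<open>\<psi>\<close> at the
      point \<open>s\<close> where the shifted window is evaluated leaves \<open>cnj (g s)\<close>
      times the squared modulus of \<open>\<phi> (s - y)\<close>; integrating over \<open>y\<close>
      then gives \<open>norm_sq \<phi>\<close>.\<close>
    have inner: "c * (\<integral>\<eta>. H (y, \<eta>) \<partial>lborel) = cnj (g s) * (\<phi> (s - y) * cnj (\<phi> (s - y)))" for y
    proof -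
      define \<psi> where "\<psi> s = g s * cnj (\<phi> (s - y))" for s
      have \<psi>: "\<psi> \<in> schwartz" unfolding \<psi>_def by (rule fstft_integrand[OF \<phi> g])
      have "H (y, \<eta>) = cnj (\<phi> (s - y)) * cnj (fourier \<psi> \<eta> * cis (s \<bullet> \<eta>))" for \<eta>
        by (simp add: H_def a_def fstft_def \<psi>_def[abs_def] tfs_def)
      then have "(\<integral>\<eta>. H (y, \<eta>) \<partial>lborel) = cnj (\<phi> (s - y)) * cnj (\<integral>\<eta>. fourier \<psi> \<eta> * cis (s \<bullet> \<eta>) \<partial>lborel)"
        by (simp only: integral_mult_right_zero Bochner_Integration.integral_cnj)
      then have "c * (\<integral>\<eta>. H (y, \<eta>) \<partial>lborel) = cnj (\<phi> (s - y)) * cnj (inv_fourier (fourier \<psi>) s)"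
        unfolding inv_fourier_def c_def by simp
      then show ?thesis unfolding inv_fourier_fourier[OF \<psi>] by (simp add: \<psi>_def mult_ac)
    qed
    have "c * S.synth a s = c * (\<integral>z. H z \<partial>(lborel \<Otimes>\<^sub>M lborel))"
      unfolding S.synth_def lborel_prod H_def by (simp add: case_prod_beta')
    also have "\<dots> = (\<integral>y. c * (\<integral>\<eta>. H (y, \<eta>) \<partial>lborel) \<partial>lborel)"
      by (simp add: lborel_pair.integral_fst'[OF Hint, symmetric])
    also have "\<dots> = cnj (g s) * (\<integral>y. \<phi> (s - y) * cnj (\<phi> (s - y)) \<partial>lborel)"
      unfolding inner by (rule integral_mult_right_zero)
    also have "(\<integral>y. \<phi> (s - y) * cnj (\<phi> (s - y)) \<partial>lborel) = norm_sq \<phi>"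
      using integral_lborel_affine[of "\<lambda>x. \<phi> x * cnj (\<phi> x)" "-1" s]
        schwartz_measurable[OF schwartz_mult[OF \<phi> schwartz_cnj[OF \<phi>]]] by (simp add: norm_sq_def)
    finally show ?thesis using c0 by (simp add: field_simps)
  qed
  interpret u: schwartz_functional u by (rule tempered_functional[OF u])
  have "(norm_sq \<phi> / c) * pairing u g = u (S.synth a)"
    unfolding synth[abs_def] pairing_def by (rule u.cmult[symmetric, OF schwartz_cnj[OF g]])
  also have "\<dots> = (\<integral>w. a w * u (\<lambda>s. cnj (tfs \<phi> w s)) \<partial>lborel)"
    by (rule S.tempered_synth[OF u ar acont])
  finally have "norm_sq \<phi> * pairing u g = c * (\<integral>w. a w * u (\<lambda>s. cnj (tfs \<phi> w s)) \<partial>lborel)"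
    using c0 by (simp add: field_simps)
  also have "\<dots> = (\<integral>w. c * (a w * u (\<lambda>s. cnj (tfs \<phi> w s))) \<partial>lborel)" by simp
  also have "\<dots> = (\<integral>w. cnj (fstft \<phi> g w) * stft \<phi> u (fst w) (snd w) \<partial>lborel)"
    unfolding stft_eq a_def c_def by (simp add: mult_ac)
  finally show ?thesis .
qed

lemma stft_growth:
  assumes u: "u \<in> tempered_distributions" and \<phi>: "\<phi> \<in> schwartz"
  shows "\<exists>C\<ge>0. \<exists>K. \<forall>x \<xi>. cmod (stft \<phi> u x \<xi>) \<le> C * wt x ^ K * wt \<xi> ^ K"
proof -
  interpret S: schwartz_integral "\<lambda>w s. cnj (tfs \<phi> w s)" by (rule schwartz_integral_tfs[OF \<phi>])
  obtain C K where C: "C \<ge> 0" "\<And>w. cmod (u (\<lambda>s. cnj (tfs \<phi> w s))) \<le> C * wt w ^ K"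
    using S.tempered_growth[OF u] by blast
  define c where "c = (2 * pi) powr (- real CARD('a) / 2)"
  have c: "c \<ge> 0" unfolding c_def by simp
  have "cmod (stft \<phi> u x \<xi>) \<le> (c * C) * wt x ^ K * wt \<xi> ^ K" for x \<xi>
  proof -
    have "cmod (stft \<phi> u x \<xi>) = c * cmod (u (\<lambda>s. cnj (tfs \<phi> (x, \<xi>) s)))"
      unfolding stft_eq c_def by (simp add: norm_mult)
    also have "\<dots> \<le> c * (C * wt (x, \<xi>) ^ K)" using C(2) c by (rule mult_left_mono)
    also have "\<dots> \<le> c * (C * (wt x * wt \<xi>) ^ K)"
      using wt_prod_le[of "(x, \<xi>)"] c C(1) by (intro mult_left_mono power_mono) auto
    finally show ?thesis by (simp add: power_mult_distrib mult_ac)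
  qed
  moreover have "c * C \<ge> 0" using c C(1) by simp
  ultimately show ?thesis by blast
qed


lemma stft_continuous:
  assumes u: "u \<in> tempered_distributions" and \<phi>: "\<phi> \<in> schwartz"
  shows "continuous_on UNIV (\<lambda>w. stft \<phi> u (fst w) (snd w))"
proof -
  interpret S: schwartz_integral "\<lambda>w s. cnj (tfs \<phi> w s)" by (rule schwartz_integral_tfs[OF \<phi>])
  show ?thesis unfolding stft_eq prod.collapse
    by (intro continuous_intros S.tempered_functional_continuous u)
qed


section \<open>Phases with polynomial gradient\<close>

lemma poly_growth:
  fixes Q :: "real poly"
  assumes "degree Q \<le> k"
  shows "\<exists>C\<ge>0. \<forall>x. \<bar>poly Q x\<bar> \<le> C * (1 + \<bar>x\<bar>) ^ k"
proof -
  have "\<bar>poly Q x\<bar> \<le> (\<Sum>i\<le>degree Q. \<bar>coeff Q i\<bar>) * (1 + \<bar>x\<bar>) ^ k" for x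
  proof -
    have "\<bar>poly Q x\<bar> \<le> (\<Sum>i\<le>degree Q. \<bar>coeff Q i * x ^ i\<bar>)" unfolding poly_altdef by (rule sum_abs)
    also have "\<dots> \<le> (\<Sum>i\<le>degree Q. \<bar>coeff Q i\<bar> * (1 + \<bar>x\<bar>) ^ k)"
    proof (rule sum_mono)
      fix i assume "i \<in> {..degree Q}"
      then have "\<bar>x\<bar> ^ i \<le> (1 + \<bar>x\<bar>) ^ k"
        using assms by (intro order_trans[OF power_mono[of "\<bar>x\<bar>" "1 + \<bar>x\<bar>"] power_increasing]) auto
      then show "\<bar>coeff Q i * x ^ i\<bar> \<le> \<bar>coeff Q i\<bar> * (1 + \<bar>x\<bar>) ^ k"
        unfolding abs_mult power_abs by (rule mult_left_mono) auto
    qed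
    finally show ?thesis by (simp add: sum_distrib_right)
  qed
  then show ?thesis by (intro exI[of _ "\<Sum>i\<le>degree Q. \<bar>coeff Q i\<bar>"]) (auto intro: sum_nonneg)
qed

lemma poly_mvt_abs:
  fixes Q :: "real poly"
  shows "\<exists>c. \<bar>c\<bar> \<le> \<bar>a\<bar> + \<bar>b\<bar> \<and> poly Q (b + a) - poly Q a = b * poly (pderiv Q) c"
proof (cases b "0::real" rule: linorder_cases)
  case less
  then obtain x where "b + a < x" "x < a" "poly Q a - poly Q (b + a) = (a - (b + a)) * poly (pderiv Q) x"
    using poly_MVT[of "b + a" a Q] by auto
  then show ?thesis by (intro exI[of _ x]) (auto simp: algebra_simps)
next
  case greater
  then obtain x where "a < x" "x < b + a" "poly Q (b + a) - poly Q a = (b + a - a) * poly (pderiv Q) x"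
    using poly_MVT[of a "b + a" Q] by auto
  then show ?thesis by (intro exI[of _ x]) auto
qed (auto intro: exI[of _ a])

lemma poly_coord_has_derivative_real:
  "((\<lambda>\<theta>. poly Q (\<theta> $ j + a)) has_derivative (\<lambda>h. h $ j * poly (pderiv Q) (\<theta> $ j + a))) (at \<theta>)"
  for Q :: "real poly"
proof -
  have "((\<lambda>\<theta>. \<theta> $ j + a) has_derivative (\<lambda>h. h $ j)) (at \<theta>)"
    by (auto intro!: derivative_eq_intros bounded_linear.has_derivative[OF bounded_linear_vec_nth])
  from has_derivative_compose[OF this poly_DERIV[unfolded has_field_derivative_def]]
  show ?thesis by (simp add: mult.commute)
qed

lemma poly_coord_has_derivative:
  "((\<lambda>\<theta>. complex_of_real (poly Q (\<theta> $ j + a))) has_derivative (\<lambda>h. complex_of_real (h $ j * poly (pderiv Q) (\<theta> $ j + a)))) (at \<theta>)"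
  by (rule has_derivative_of_real[OF poly_coord_has_derivative_real])

lemma partial_deriv_poly_coord:
  "partial_deriv i (\<lambda>\<theta>. complex_of_real (poly Q (\<theta> $ j + a))) =
    (\<lambda>\<theta>. if i = j then complex_of_real (poly (pderiv Q) (\<theta> $ j + a)) else 0)"
  by (rule ext, subst has_derivative_partial_deriv[OF poly_coord_has_derivative]) (simp add: axis_def)

lemma one_plus_abs_le_wt: "1 + \<bar>x $ j\<bar> \<le> wt (x :: real ^ 'n::finite)"
  using component_le_norm_cart[of x j] by (simp add: wt_def)

text \<open>The polynomial is recentred at the parameter \<xi>. Submultiplicativity of
  \<open>wt\<close> splits its growth into the weight in \<xi> and the admissible growth in
  \<theta>; derivatives lower the degree, which drives the induction.\<close>

lemma ofam_poly_coord:
  fixes Q :: "real poly"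
  assumes "degree Q \<le> k"
  shows "ofam (\<lambda>\<xi>. wt \<xi> ^ k) (\<lambda>\<xi> (\<theta> :: real ^ 'n::finite). complex_of_real (poly Q (\<theta> $ j + \<xi> $ j)))"
  using assms
proof (induction "degree Q" arbitrary: Q rule: less_induct)
  case less
  show ?case
  proof (rule ofamI_partial_deriv)
    show "(\<lambda>\<theta>. complex_of_real (poly Q (\<theta> $ j + \<xi> $ j))) differentiable at \<theta>" for \<xi> \<theta> :: "real ^ 'n"
      using poly_coord_has_derivative unfolding differentiable_def by blast
    obtain C where C: "C \<ge> 0" "\<And>x. \<bar>poly Q x\<bar> \<le> C * (1 + \<bar>x\<bar>) ^ k" using poly_growth[OF less.prems] by blast
    have "cmod (complex_of_real (poly Q (\<theta> $ j + \<xi> $ j))) \<le> C * wt \<xi> ^ k * wt \<theta> ^ k" for \<xi> \<theta> :: "real ^ 'n"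
    proof -
      have "1 + \<bar>\<theta> $ j + \<xi> $ j\<bar> \<le> wt \<theta> * wt \<xi>"
        using order_trans[OF one_plus_abs_le_wt[of "\<theta> + \<xi>" j] wt_add_le] by simp
      then have "(1 + \<bar>\<theta> $ j + \<xi> $ j\<bar>) ^ k \<le> (wt \<theta> * wt \<xi>) ^ k" by (intro power_mono) auto
      then have "C * (1 + \<bar>\<theta> $ j + \<xi> $ j\<bar>) ^ k \<le> C * (wt \<theta> * wt \<xi>) ^ k" using C(1) by (rule mult_left_mono)
      then show ?thesis using C(2)[of "\<theta> $ j + \<xi> $ j"] by (simp add: power_mult_distrib mult_ac)
    qed
    then show "\<exists>C\<ge>0. \<exists>N. \<forall>\<xi> \<theta>. cmod (complex_of_real (poly Q (\<theta> $ j + \<xi> $ j))) \<le> C * wt (\<xi> :: real ^ 'n) ^ k * wt (\<theta> :: real ^ 'n) ^ N"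
      using C(1) by blast
    fix i
    show "ofam (\<lambda>\<xi>. wt \<xi> ^ k) (\<lambda>\<xi>. partial_deriv i (\<lambda>\<theta> :: real ^ 'n. complex_of_real (poly Q (\<theta> $ j + \<xi> $ j))))"
    proof (cases "i = j \<and> degree Q > 0")
      case True
      then have "degree (pderiv Q) < degree Q" by (simp add: degree_pderiv)
      then show ?thesis using less.hyps[of "pderiv Q"] less.prems True by (simp add: partial_deriv_poly_coord)
    next
      case False
      then have "partial_deriv i (\<lambda>\<theta> :: real ^ 'n. complex_of_real (poly Q (\<theta> $ j + \<xi> $ j))) = (\<lambda>\<theta>. 0)" for \<xi> :: "real ^ 'n"
        using pderiv_eq_0_iff[of Q] by (cases "i = j") (auto simp: partial_deriv_poly_coord)
      then show ?thesis by (auto intro!: ofam_const)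
    qed
  qed
qed

text \<open>By the mean value theorem an increment of a polynomial of degree \<open>k + 1\<close>
  costs only \<open>wt \<xi> ^ k\<close>, at the price of a factor in \<theta>. This is the origin
  of the exponent \<open>m - 2\<close> in the kernel width.\<close>

lemma ofam_poly_coord_diff:
  fixes Q :: "real poly"
  assumes deg: "degree Q \<le> Suc k"
  shows "ofam (\<lambda>\<xi>. wt \<xi> ^ k) (\<lambda>\<xi> (\<theta> :: real ^ 'n::finite). complex_of_real (poly Q (\<theta> $ j + \<xi> $ j) - poly Q (\<xi> $ j)))"
proof (rule ofamI_partial_deriv)
  have eq: "(\<lambda>\<theta> :: real ^ 'n. complex_of_real (poly Q (\<theta> $ j + \<xi> $ j) - poly Q (\<xi> $ j))) =
      (\<lambda>\<theta>. complex_of_real (poly Q (\<theta> $ j + \<xi> $ j)) + (- complex_of_real (poly Q (\<xi> $ j))))" for \<xi> :: "real ^ 'n"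
    by auto
  have diff: "(\<lambda>\<theta>. complex_of_real (poly Q (\<theta> $ j + \<xi> $ j))) differentiable at \<theta>" for \<xi> \<theta> :: "real ^ 'n"
    using poly_coord_has_derivative unfolding differentiable_def by blast
  then show "(\<lambda>\<theta>. complex_of_real (poly Q (\<theta> $ j + \<xi> $ j) - poly Q (\<xi> $ j))) differentiable at \<theta>" for \<xi> \<theta> :: "real ^ 'n"
    unfolding eq by (intro differentiable_add) auto
  have deg': "degree (pderiv Q) \<le> k" using deg by (simp add: degree_pderiv)
  obtain C where C: "C \<ge> 0" "\<And>x. \<bar>poly (pderiv Q) x\<bar> \<le> C * (1 + \<bar>x\<bar>) ^ k" using poly_growth[OF deg'] by blast
  have "cmod (complex_of_real (poly Q (\<theta> $ j + \<xi> $ j) - poly Q (\<xi> $ j))) \<le> C * wt \<xi> ^ k * wt \<theta> ^ Suc k" for \<xi> \<theta> :: "real ^ 'n"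
  proof -
    obtain c where c: "\<bar>c\<bar> \<le> \<bar>\<xi> $ j\<bar> + \<bar>\<theta> $ j\<bar>" "poly Q (\<theta> $ j + \<xi> $ j) - poly Q (\<xi> $ j) = \<theta> $ j * poly (pderiv Q) c"
      using poly_mvt_abs by blast
    have "1 + \<bar>c\<bar> \<le> (1 + \<bar>\<xi> $ j\<bar>) * (1 + \<bar>\<theta> $ j\<bar>)" using c(1) mult_nonneg_nonneg[of "\<bar>\<xi> $ j\<bar>" "\<bar>\<theta> $ j\<bar>"] unfolding distrib_left distrib_right by linarith
    also have "\<dots> \<le> wt \<xi> * wt \<theta>" by (intro mult_mono one_plus_abs_le_wt) auto
    finally have "(1 + \<bar>c\<bar>) ^ k \<le> (wt \<xi> * wt \<theta>) ^ k" by (intro power_mono) auto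
    then have "C * (1 + \<bar>c\<bar>) ^ k \<le> C * (wt \<xi> * wt \<theta>) ^ k" using C(1) by (rule mult_left_mono)
    with C(2)[of c] have "\<bar>poly (pderiv Q) c\<bar> \<le> C * (wt \<xi> * wt \<theta>) ^ k" by linarith
    then have "\<bar>\<theta> $ j\<bar> * \<bar>poly (pderiv Q) c\<bar> \<le> wt \<theta> * (C * (wt \<xi> * wt \<theta>) ^ k)"
      by (intro mult_mono wt_component_le) auto
    then show ?thesis unfolding c(2) by (simp add: norm_mult power_mult_distrib mult_ac)
  qed
  then show "\<exists>C\<ge>0. \<exists>N. \<forall>\<xi> \<theta>. cmod (complex_of_real (poly Q (\<theta> $ j + \<xi> $ j) - poly Q (\<xi> $ j))) \<le> C * wt (\<xi> :: real ^ 'n) ^ k * wt (\<theta> :: real ^ 'n) ^ N"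
    using C(1) by blast
  fix i
  have "partial_deriv i (\<lambda>\<theta> :: real ^ 'n. complex_of_real (poly Q (\<theta> $ j + \<xi> $ j) - poly Q (\<xi> $ j))) =
      (\<lambda>\<theta>. if i = j then complex_of_real (poly (pderiv Q) (\<theta> $ j + \<xi> $ j)) else 0)" for \<xi> :: "real ^ 'n"
    unfolding eq by (rule ext, subst partial_deriv_add[OF diff differentiable_const]) (simp add: partial_deriv_poly_coord)
  then show "ofam (\<lambda>\<xi>. wt \<xi> ^ k) (\<lambda>\<xi>. partial_deriv i (\<lambda>\<theta> :: real ^ 'n. complex_of_real (poly Q (\<theta> $ j + \<xi> $ j) - poly Q (\<xi> $ j))))"
    using ofam_poly_coord[OF deg', of j] by (cases "i = j") (auto intro!: ofam_const)
qed

lemma ofam_const_weight: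
  assumes "ofam (\<lambda>_::unit. c) (\<lambda>_. h)" shows "ofam (\<lambda>_. 1) (\<lambda>_. h)"
  unfolding ofam_def
proof (intro conjI allI)
  fix js
  obtain C N where C: "C \<ge> 0" "\<And>x. cmod (iter_deriv js h x) \<le> C * c * wt x ^ N"
    using ofamD[OF assms, of js] by metis
  have "cmod (iter_deriv js h x) \<le> (C * \<bar>c\<bar>) * 1 * wt x ^ N" for x
  proof -
    have "C * c * wt x ^ N \<le> C * \<bar>c\<bar> * wt x ^ N" using C(1) by (intro mult_right_mono mult_left_mono) auto
    then show ?thesis using C(2)[of x] by simp
  qed
  moreover have "C * \<bar>c\<bar> \<ge> 0" using C(1) by simp
  ultimately show "\<exists>C\<ge>0. \<exists>N. \<forall>p x. cmod (iter_deriv js h x) \<le> C * 1 * wt x ^ N" by blast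
qed (rule ofam_smooth[OF assms])

text \<open>The \<open>j\<close>-th component of the gradient depends on the \<open>j\<close>-th
  coordinate alone. The number \<open>r\<close> bounds the growth of increments of the gradient, one
  less than the degree of the gradient; for the solution operator it is
  \<open>m - 2\<close>.\<close>

locale phase =
  fixes \<Phi> :: "real ^ 'n::finite \<Rightarrow> real" and D :: "'n \<Rightarrow> real poly" and r :: nat
  assumes \<Phi>_deriv: "(\<Phi> has_derivative (\<lambda>h. \<Sum>j\<in>UNIV. h $ j * poly (D j) (\<zeta> $ j))) (at \<zeta>)"
    and degree: "degree (D j) \<le> Suc r"
begin

definition osc :: "real ^ 'n \<Rightarrow> real ^ 'n \<Rightarrow> real ^ 'n \<Rightarrow> complex" where
  "osc \<xi> b \<theta> = cis (\<Phi> (\<theta> + \<xi>)) * cis (\<theta> \<bullet> b)"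

lemma norm_osc [simp]: "cmod (osc \<xi> b \<theta>) = 1"
  by (simp add: osc_def norm_mult)

lemma osc_has_derivative:
  "(osc \<xi> b has_derivative (\<lambda>h. \<i> * complex_of_real ((\<Sum>j\<in>UNIV. h $ j * poly (D j) (\<theta> $ j + \<xi> $ j)) + h \<bullet> b) * osc \<xi> b \<theta>)) (at \<theta>)"
proof -
  have "((\<lambda>\<theta>. \<theta> + \<xi>) has_derivative (\<lambda>h. h)) (at \<theta>)" by (auto intro!: derivative_eq_intros)
  from has_derivative_compose[OF this \<Phi>_deriv]
  have "((\<lambda>\<theta>. \<Phi> (\<theta> + \<xi>)) has_derivative (\<lambda>h. \<Sum>j\<in>UNIV. h $ j * poly (D j) (\<theta> $ j + \<xi> $ j))) (at \<theta>)" by simp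
  then have "((\<lambda>\<theta>. \<i> * complex_of_real (\<Phi> (\<theta> + \<xi>) + \<theta> \<bullet> b)) has_derivative
      (\<lambda>h. \<i> * complex_of_real ((\<Sum>j\<in>UNIV. h $ j * poly (D j) (\<theta> $ j + \<xi> $ j)) + h \<bullet> b))) (at \<theta>)"
    by (intro has_derivative_mult_right has_derivative_of_real has_derivative_add has_derivative_inner_left has_derivative_ident)
  from has_derivative_compose[OF this DERIV_exp[unfolded has_field_derivative_def]]
  have "((\<lambda>\<theta>. cis (\<Phi> (\<theta> + \<xi>) + \<theta> \<bullet> b)) has_derivative (\<lambda>h. cis (\<Phi> (\<theta> + \<xi>) + \<theta> \<bullet> b) *
      (\<i> * complex_of_real ((\<Sum>j\<in>UNIV. h $ j * poly (D j) (\<theta> $ j + \<xi> $ j)) + h \<bullet> b)))) (at \<theta>)"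
    unfolding cis_conv_exp .
  then show ?thesis unfolding osc_def cis_mult by (simp add: mult_ac)
qed

lemma partial_deriv_osc:
  "partial_deriv j (osc \<xi> b) = (\<lambda>\<theta>. \<i> * (complex_of_real (poly (D j) (\<theta> $ j + \<xi> $ j)) + complex_of_real (b $ j)) * osc \<xi> b \<theta>)"
proof
  fix \<theta>
  have "(\<Sum>i\<in>UNIV. axis j 1 $ i * poly (D i) (\<theta> $ i + \<xi> $ i)) = (\<Sum>i\<in>UNIV. if i = j then poly (D i) (\<theta> $ i + \<xi> $ i) else 0)"
    by (intro sum.cong) (auto simp: axis_def)
  then show "partial_deriv j (osc \<xi> b) \<theta> = \<i> * (complex_of_real (poly (D j) (\<theta> $ j + \<xi> $ j)) + complex_of_real (b $ j)) * osc \<xi> b \<theta>"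
    by (subst has_derivative_partial_deriv[OF osc_has_derivative]) (simp add: inner_axis')
qed

text \<open>Qualitative only: its constants may depend on \<xi> and \<open>b\<close>. It justifies
  the integrations by parts, whereas the uniform bounds come from \<open>shift_op\<close> and the
  modulus 1 of the oscillating factor.\<close>

lemma ofam_osc: "ofam (\<lambda>_::unit. 1) (\<lambda>_. osc \<xi> b)"
proof (rule ofam_exponential[where a="\<lambda>j \<theta>. \<i> * (complex_of_real (poly (D j) (\<theta> $ j + \<xi> $ j)) + complex_of_real (b $ j))"])
  show "osc \<xi> b differentiable at x" for x using osc_has_derivative by (auto simp: differentiable_def)
  fix j
  have 1: "ofam (\<lambda>_::unit. 1) (\<lambda>_ \<theta>. complex_of_real (poly (D j) (\<theta> $ j + \<xi> $ j)))"
    by (rule ofam_const_weight) (rule ofam_comp[OF ofam_poly_coord[OF degree], of "\<lambda>_. \<xi>"])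
  have "ofam (\<lambda>_::unit. \<bar>b $ j\<bar>) (\<lambda>_ (\<theta>::real^'n). complex_of_real (b $ j))" by (rule ofam_const) simp
  then have 2: "ofam (\<lambda>_::unit. 1) (\<lambda>_ (\<theta>::real^'n). complex_of_real (b $ j))" by (rule ofam_const_weight)
  have 3: "ofam (\<lambda>_::unit. 1) (\<lambda>_ (\<theta>::real^'n). \<i>)" by (rule ofam_const) simp
  show "ofam (\<lambda>_::unit. 1) (\<lambda>_ \<theta>. \<i> * (complex_of_real (poly (D j) (\<theta> $ j + \<xi> $ j)) + complex_of_real (b $ j)))"
    using ofam_mult[OF 3 ofam_add[OF 1 2]] by simp
qed (auto simp: partial_deriv_osc)

lemma ofam_cis_phase: "ofam (\<lambda>_::unit. 1) (\<lambda>_ \<zeta>. cis (\<Phi> \<zeta>))"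
  using ofam_osc[of 0 0] by (simp add: osc_def[abs_def])

text \<open>Integration by parts against the oscillating factor. Only the increment of the gradient from \<open>\<xi>\<close>
  to \<open>\<theta> + \<xi>\<close> enters, which costs \<open>wt \<xi> ^ r\<close>, one power less than the gradient itself.\<close>

definition shift_op :: "'n \<Rightarrow> real ^ 'n \<Rightarrow> (real ^ 'n \<Rightarrow> complex) \<Rightarrow> real ^ 'n \<Rightarrow> complex" where
  "shift_op j \<xi> G \<theta> = \<i> * partial_deriv j G \<theta> - complex_of_real (poly (D j) (\<theta> $ j + \<xi> $ j) - poly (D j) (\<xi> $ j)) * G \<theta>"

definition osc_integral :: "real ^ 'n \<Rightarrow> real ^ 'n \<Rightarrow> (real ^ 'n \<Rightarrow> complex) \<Rightarrow> complex" where
  "osc_integral \<xi> b G = (\<integral>\<theta>. osc \<xi> b \<theta> * G \<theta> \<partial>lborel)"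

definition grad :: "real ^ 'n \<Rightarrow> real ^ 'n" where
  "grad \<xi> = (\<chi> j. poly (D j) (\<xi> $ j))"

lemma osc_schwartz: "G \<in> schwartz \<Longrightarrow> (\<lambda>\<theta>. osc \<xi> b \<theta> * G \<theta>) \<in> schwartz"
  by (rule schwartz_mult_ofam[OF ofam_osc])

lemma sfam_shift_op:
  assumes G: "sfam \<mu> G" and pos: "\<And>p. \<mu> p \<ge> 0"
  shows "sfam (\<lambda>p. wt (X p) ^ r * \<mu> p) (\<lambda>p. shift_op j (X p) (G p))"
proof -
  have 1: "sfam (\<lambda>p. wt (X p) ^ r * \<mu> p) (\<lambda>p \<theta>. complex_of_real (poly (D j) (\<theta> $ j + X p $ j) - poly (D j) (X p $ j)) * G p \<theta>)"
    by (rule sfam_mult[OF ofam_comp[OF ofam_poly_coord_diff[OF degree], of X] G])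
  have 2: "sfam (\<lambda>p. wt (X p) ^ r * \<mu> p) (\<lambda>p \<theta>. \<i> * partial_deriv j (G p) \<theta>)"
  proof (rule sfam_cong_weight[OF sfam_cmult[OF sfam_partial_deriv[OF G]]])
    show "\<mu> p \<le> 1 * (wt (X p) ^ r * \<mu> p)" for p
      using mult_right_mono[OF one_le_power[OF wt_ge_1[of "X p"], of r] pos] by simp
  qed simp
  from sfam_add[OF 2 sfam_cmult[OF 1, of "-1"]] show ?thesis
    unfolding shift_op_def[abs_def] by simp
qed

lemma schwartz_shift_op: "G \<in> schwartz \<Longrightarrow> shift_op j \<xi> G \<in> schwartz"
  using sfam_schwartz[OF sfam_shift_op[of "\<lambda>_. 1" "\<lambda>_. G" "\<lambda>_. \<xi>"]] schwartz_sfam by fastforce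

text \<open>The gradient of the total phase splits into the constant \<open>b + grad \<xi>\<close>
  and the increment from \<xi> to \<open>\<theta> + \<xi>\<close>. Since the integral of a
  derivative vanishes, the constant part is traded for a derivative and the increment acting on the
  amplitude.\<close>

lemma osc_integral_shift_op:
  assumes G: "G \<in> schwartz"
  shows "complex_of_real ((b + grad \<xi>) $ j) * osc_integral \<xi> b G = osc_integral \<xi> b (shift_op j \<xi> G)"
proof -
  define h where "h \<theta> = complex_of_real ((b + grad \<xi>) $ j) * (osc \<xi> b \<theta> * G \<theta>)" for \<theta>
  define k where "k \<theta> = osc \<xi> b \<theta> * shift_op j \<xi> G \<theta>" for \<theta>
  have S: "h \<in> schwartz" "k \<in> schwartz" unfolding h_def k_def
    by (intro schwartz_cmult osc_schwartz schwartz_shift_op G)+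
  have "partial_deriv j (\<lambda>\<theta>. osc \<xi> b \<theta> * G \<theta>) = (\<lambda>\<theta>. \<i> * (h \<theta> - k \<theta>))"
    unfolding partial_deriv_smooth_mult[OF ofam_smooth[OF ofam_osc] schwartz_smooth[OF G]] partial_deriv_osc
      h_def k_def shift_op_def grad_def
    by (auto simp: algebra_simps)
  then have "(\<integral>\<theta>. \<i> * (h \<theta> - k \<theta>) \<partial>lborel) = 0"
    using integral_partial_deriv_eq_0[OF osc_schwartz[OF G], of j \<xi> b] by simp
  then have "(\<integral>\<theta>. h \<theta> \<partial>lborel) = (\<integral>\<theta>. k \<theta> \<partial>lborel)"
    using schwartz_integrable[OF S(1)] schwartz_integrable[OF S(2)] by simp
  then show ?thesis unfolding h_def k_def osc_integral_def by simp
qed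

lemma osc_integral_power:
  assumes G: "G \<in> schwartz"
  shows "(shift_op j \<xi> ^^ N) G \<in> schwartz"
    and "complex_of_real ((b + grad \<xi>) $ j) ^ N * osc_integral \<xi> b G = osc_integral \<xi> b ((shift_op j \<xi> ^^ N) G)"
proof -
  show *: "(shift_op j \<xi> ^^ N) G \<in> schwartz" for N by (induction N) (auto intro: schwartz_shift_op G)
  show "complex_of_real ((b + grad \<xi>) $ j) ^ N * osc_integral \<xi> b G = osc_integral \<xi> b ((shift_op j \<xi> ^^ N) G)"
    by (induction N) (auto simp: osc_integral_shift_op[OF *, symmetric] mult_ac)
qed

lemma sfam_shift_op_power:
  assumes G: "sfam \<mu> G" and pos: "\<And>p. \<mu> p \<ge> 0"
  shows "sfam (\<lambda>p. wt (X p) ^ (r * N) * \<mu> p) (\<lambda>p. (shift_op j (X p) ^^ N) (G p))"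
proof (induction N)
  case (Suc N)
  from sfam_shift_op[OF this, of X j] show ?case using pos by (simp add: power_add mult_ac)
qed (use G in auto)

lemma osc_integral_bounded:
  assumes G: "sfam \<mu> G"
  shows "\<exists>C\<ge>0. \<forall>p \<xi> b. cmod (osc_integral \<xi> b (G p)) \<le> C * \<mu> p"
proof -
  obtain C where C: "C \<ge> 0" "\<And>p x. wt x ^ (2 * DIM(real ^ 'n)) * cmod (G p x) \<le> C * \<mu> p"
    using sfam_boundD[OF G] by blast
  define I where "I = (\<integral>x. inverse (wt (x :: real ^ 'n) ^ (2 * DIM(real ^ 'n))) \<partial>lborel)"
  have "I \<ge> 0" unfolding I_def by (intro Bochner_Integration.integral_nonneg) auto
  have "cmod (osc_integral \<xi> b (G p)) \<le> (C * I) * \<mu> p" for p \<xi> b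
  proof -
    have "cmod (osc_integral \<xi> b (G p)) \<le> (C * \<mu> p) * I" unfolding osc_integral_def I_def
    proof (rule integral_wt_bound)
      show "(\<lambda>\<theta>. osc \<xi> b \<theta> * G p \<theta>) \<in> borel_measurable borel"
        by (rule schwartz_measurable[OF osc_schwartz[OF sfam_schwartz[OF G]]])
    qed (use C(2) in \<open>simp add: norm_mult\<close>)
    then show ?thesis by (simp add: mult_ac)
  qed
  moreover have "C * I \<ge> 0" using C(1) \<open>I \<ge> 0\<close> by simp
  ultimately show ?thesis by blast
qed

text \<open>\<open>N\<close> integrations by parts in each single direction, each costing
  \<open>wt (X p) ^ r\<close>, combine through \<open>wt_mult_le_monomials\<close>.\<close>

lemma osc_integral_decay:
  assumes G: "sfam \<mu> G" and pos: "\<And>p. \<mu> p \<ge> 0"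
  shows "\<exists>C\<ge>0. \<forall>p b. wt (b + grad (X p)) ^ N * cmod (osc_integral (X p) b (G p)) \<le> C * (wt (X p) ^ (r * N) * \<mu> p)"
proof -
  obtain C0 where C0: "C0 \<ge> 0" "\<And>p \<xi> b. cmod (osc_integral \<xi> b (G p)) \<le> C0 * \<mu> p"
    using osc_integral_bounded[OF G] by blast
  have "\<exists>C. \<forall>j. C j \<ge> 0 \<and> (\<forall>p \<xi> b. cmod (osc_integral \<xi> b ((shift_op j (X p) ^^ N) (G p))) \<le> C j * (wt (X p) ^ (r * N) * \<mu> p))"
    by (intro choice allI osc_integral_bounded sfam_shift_op_power G pos)
  then obtain C where C: "\<And>j. C j \<ge> 0"
      "\<And>j p \<xi> b. cmod (osc_integral \<xi> b ((shift_op j (X p) ^^ N) (G p))) \<le> C j * (wt (X p) ^ (r * N) * \<mu> p)" by blast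
  define E where "E = C0 + (\<Sum>j\<in>UNIV. C j)"
  have E: "E \<ge> 0" "C0 \<le> E" "\<And>j. C j \<le> E"
    unfolding E_def using C0(1) C(1) member_le_sum[of _ UNIV C] by (auto simp: sum_nonneg add_increasing)
  have "wt (b + grad (X p)) ^ N * cmod (osc_integral (X p) b (G p)) \<le> (real CARD('n) + 1) ^ Suc N * (E * (wt (X p) ^ (r * N) * \<mu> p))" for p b
  proof (rule wt_mult_le_monomials)
    have w: "0 \<le> wt (X p) ^ (r * N) * \<mu> p" using pos by simp
    have "1 * \<mu> p \<le> wt (X p) ^ (r * N) * \<mu> p" by (intro mult_right_mono one_le_power pos) auto
    then have "C0 * \<mu> p \<le> E * (wt (X p) ^ (r * N) * \<mu> p)" using E(2) C0(1) E(1) pos by (intro mult_mono) auto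
    then show "cmod (osc_integral (X p) b (G p)) \<le> E * (wt (X p) ^ (r * N) * \<mu> p)"
      using C0(2) order_trans by blast
    fix j
    have "\<bar>(b + grad (X p)) $ j\<bar> ^ N * cmod (osc_integral (X p) b (G p)) = cmod (osc_integral (X p) b ((shift_op j (X p) ^^ N) (G p)))"
      unfolding osc_integral_power(2)[OF sfam_schwartz[OF G], symmetric] norm_mult norm_power norm_of_real ..
    also have "\<dots> \<le> E * (wt (X p) ^ (r * N) * \<mu> p)"
      using C(2) mult_right_mono[OF E(3) w] order_trans by blast
    finally show "\<bar>(b + grad (X p)) $ j\<bar> ^ N * cmod (osc_integral (X p) b (G p)) \<le> E * (wt (X p) ^ (r * N) * \<mu> p)" .
  qed auto
  then show ?thesis using E(1)
    by (intro exI[of _ "(real CARD('n) + 1) ^ Suc N * E"]) (auto simp: mult.assoc)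
qed

end


section \<open>The solution operator\<close>

text \<open>A translation minus its first-order Taylor part lowers the degree by two. Taking this
  remainder commutes with \<open>pderiv\<close>, so induction on the degree applies.\<close>

lemma degree_shift_taylor:
  fixes p :: "real poly"
  assumes "degree p \<le> n"
  shows "degree (pcompose p [:a, 1:] - p - smult a (pderiv p)) \<le> n - 2"
    and "n \<le> 1 \<Longrightarrow> pcompose p [:a, 1:] - p - smult a (pderiv p) = 0"
proof -
  have zero: "pcompose p [:a, 1:] - p - smult a (pderiv p) = 0" if "degree p \<le> 1" for p :: "real poly"
  proof -
    have "p = [:coeff p 0, coeff p 1:]"
      using that by (auto simp: poly_eq_iff coeff_pCons coeff_eq_0 split: nat.split)
    then obtain c d where "p = [:c, d:]" by blast
    then show ?thesis by (simp add: pcompose_pCons pderiv_pCons algebra_simps)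
  qed
  show "n \<le> 1 \<Longrightarrow> pcompose p [:a, 1:] - p - smult a (pderiv p) = 0"
    using zero assms by simp
  show "degree (pcompose p [:a, 1:] - p - smult a (pderiv p)) \<le> n - 2"
    using assms
  proof (induction n arbitrary: p)
    case 0
    then show ?case using zero[of p] by simp
  next
    case (Suc n)
    define E where "E = pcompose p [:a, 1:] - p - smult a (pderiv p)"
    have E': "pderiv E = pcompose (pderiv p) [:a, 1:] - pderiv p - smult a (pderiv (pderiv p))"
      unfolding E_def by (simp add: pderiv_diff pderiv_pcompose pderiv_smult pderiv_pCons)
    have deg: "degree (pderiv p) \<le> n" using Suc.prems by (simp add: degree_pderiv)
    consider "n = 0" | "n = 1" | "n \<ge> 2" by linarith
    then show ?case
    proof cases
      case 1
      then show ?thesis using zero[of p] Suc.prems by simp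
    next
      \<comment> \<open>With truncated subtraction the induction hypothesis only says that
        \<open>pderiv E\<close> has degree 0, which would allow degree 1 for \<open>E\<close>. The
        exact vanishing for polynomials of degree at most 1 closes the gap.\<close>
      case 2
      then have "pderiv E = 0" unfolding E' using zero deg by simp
      then show ?thesis using 2 by (simp add: pderiv_eq_0_iff E_def)
    next
      case 3
      have "degree (pderiv E) \<le> n - 2" unfolding E' by (rule Suc.IH[OF deg])
      then show ?thesis using 3 unfolding E_def[symmetric] by (simp add: degree_pderiv)
    qed
  qed
qed

text \<open>The \<open>j\<close>-th component of the gradient of
  \<open>solution_phase v q \<tau>\<close>; the primitives \<open>q j\<close> disappear upon
  differentiation.\<close>

definition phase_poly :: "real ^ 'n::finite \<Rightarrow> ('n \<Rightarrow> real poly) \<Rightarrow> real \<Rightarrow> 'n \<Rightarrow> real poly" where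
  "phase_poly v p \<tau> j = smult (inverse (v $ j)) (pcompose (p j) [:- \<tau> * v $ j, 1:] - p j)"

lemma degree_phase_poly:
  assumes "degree (p j) \<le> Suc n"
  shows "degree (phase_poly v p \<tau> j) \<le> n"
proof -
  define a where "a = - \<tau> * v $ j"
  have "pcompose (p j) [:a, 1:] - p j = (pcompose (p j) [:a, 1:] - p j - smult a (pderiv (p j))) + smult a (pderiv (p j))"
    by simp
  also have "degree \<dots> \<le> n"
    using degree_shift_taylor(1)[OF assms, of a] assms
    by (intro degree_add_le order_trans[OF degree_smult_le]) (auto simp: degree_pderiv)
  finally show ?thesis unfolding phase_poly_def a_def[symmetric]
    using order_trans[OF degree_smult_le] by blast
qed

text \<open>At time \<open>- t\<close> the argument is shifted by \<open>t * v $ j\<close>. The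
  first Taylor term divided by \<open>v $ j\<close> is \<open>t\<close> times the derivative of
  \<open>p j\<close>, so \<open>v\<close> cancels and the stated leading term remains; everything
  else has degree at most \<open>m - 2\<close>.\<close>

lemma phase_poly_leading:
  fixes v :: "real ^ 'n::finite"
  assumes deg: "degree (p j) \<le> m" and m: "m \<ge> 2" and v: "v $ j \<noteq> 0"
  shows "\<exists>C\<ge>0. \<forall>z. \<bar>poly (phase_poly v p (- t) j) z - t * (real m * coeff (p j) m) * z ^ (m - 1)\<bar> \<le> C * (1 + \<bar>z\<bar>) ^ (m - 2)"
proof -
  define a where "a = t * v $ j"
  define E where "E = pcompose (p j) [:a, 1:] - p j - smult a (pderiv (p j))"
  define c where "c = t * (real m * coeff (p j) m)"
  define Q where "Q = phase_poly v p (- t) j - monom c (m - 1)"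
  have 1: "degree E \<le> m - 2" unfolding E_def by (rule degree_shift_taylor(1)[OF deg])
  have 2: "degree (smult t (pderiv (p j)) - monom c (m - 1)) \<le> m - 2"
  proof (rule degree_le, intro allI impI)
    fix i assume i: "m - 2 < i"
    then consider "i = m - 1" | "i \<ge> m" using m by linarith
    then show "coeff (smult t (pderiv (p j)) - monom c (m - 1)) i = 0"
    proof cases
      case 1
      then show ?thesis using m by (simp add: coeff_pderiv c_def)
    next
      case 2
      then have "coeff (p j) (Suc i) = 0" using deg by (intro coeff_eq_0) simp
      then show ?thesis using 2 m by (simp add: coeff_pderiv)
    qed
  qed
  have "phase_poly v p (- t) j = smult (inverse (v $ j)) (E + smult a (pderiv (p j)))"
    unfolding phase_poly_def E_def a_def by simp
  also have "\<dots> = smult (inverse (v $ j)) E + smult t (pderiv (p j))"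
  proof -
    have "inverse (v $ j) * a = t" using v by (simp add: a_def field_simps)
    then show ?thesis by (simp add: smult_add_right)
  qed
  finally have "Q = smult (inverse (v $ j)) E + (smult t (pderiv (p j)) - monom c (m - 1))"
    unfolding Q_def by simp
  then have "degree Q \<le> m - 2"
    using 1 2 by (auto intro!: degree_add_le order_trans[OF degree_smult_le])
  from poly_growth[OF this] show ?thesis unfolding Q_def by (simp add: poly_monom c_def)
qed

lemma powr_power_nat: "l \<ge> 1 \<Longrightarrow> (l powr a) ^ n = l powr (a * real n)" for l :: real
  by (simp add: powr_realpow[symmetric] powr_powr)

lemma scaled_abs_le:
  assumes "l \<ge> 1" "\<sigma> > 0" "norm (\<xi> :: real ^ 'n::finite) \<le> R"
  shows "(1 + \<bar>(l powr \<sigma> *\<^sub>R \<xi>) $ j\<bar>) ^ k \<le> (1 + R) ^ k * l powr (\<sigma> * real k)"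
proof -
  have ls: "1 \<le> l powr \<sigma>" using ge_one_powr_ge_zero[of l \<sigma>] assms by simp
  have "\<bar>\<xi> $ j\<bar> \<le> R" using component_le_norm_cart[of \<xi> j] assms(3) by linarith
  then have "\<bar>(l powr \<sigma> *\<^sub>R \<xi>) $ j\<bar> \<le> l powr \<sigma> * R" by (simp add: abs_mult mult_left_mono)
  then have "1 + \<bar>(l powr \<sigma> *\<^sub>R \<xi>) $ j\<bar> \<le> (1 + R) * l powr \<sigma>" using ls by (simp add: algebra_simps)
  then have "(1 + \<bar>(l powr \<sigma> *\<^sub>R \<xi>) $ j\<bar>) ^ k \<le> ((1 + R) * l powr \<sigma>) ^ k" by (intro power_mono) auto
  then show ?thesis by (simp add: power_mult_distrib powr_power_nat[OF assms(1)])
qed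

lemma gabor_WF_nonzero: "z \<in> gabor_WF \<phi> \<sigma> u \<Longrightarrow> z \<noteq> 0"
  by (simp add: gabor_WF_def)

text \<open>The number \<open>m\<close> enters as a common degree bound. A component of smaller
  degree has \<open>coeff (p j) m = 0\<close> and so drops out of the principal part by
  itself.\<close>

locale evolution =
  fixes v :: "real ^ 'n::finite" and p q :: "'n \<Rightarrow> real poly" and m :: nat
  assumes v: "v $ j \<noteq> 0" and deg: "degree (p j) \<le> m" and m: "m \<ge> 2" and q: "pderiv (q j) = p j"
begin

lemma phase: "phase (solution_phase v q \<tau>) (phase_poly v p \<tau>) (m - 2)"
proof
  fix \<zeta> j
  have "((\<lambda>\<xi>. \<Sum>j\<in>UNIV. inverse (v $ j) * (poly (q j) (\<xi> $ j + (- \<tau> * v $ j)) - poly (q j) (\<xi> $ j + 0))) has_derivative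
      (\<lambda>h. \<Sum>j\<in>UNIV. inverse (v $ j) * (h $ j * poly (pderiv (q j)) (\<zeta> $ j + (- \<tau> * v $ j)) - h $ j * poly (pderiv (q j)) (\<zeta> $ j + 0)))) (at \<zeta>)"
    by (intro has_derivative_sum has_derivative_mult_right has_derivative_diff poly_coord_has_derivative_real)
  moreover have "inverse (v $ j) * (h $ j * poly (pderiv (q j)) (\<zeta> $ j + (- \<tau> * v $ j)) - h $ j * poly (pderiv (q j)) (\<zeta> $ j + 0)) =
      h $ j * poly (phase_poly v p \<tau> j) (\<zeta> $ j)" for h j
    unfolding q phase_poly_def by (simp add: poly_pcompose algebra_simps)
  ultimately show "(solution_phase v q \<tau> has_derivative (\<lambda>h. \<Sum>j\<in>UNIV. h $ j * poly (phase_poly v p \<tau> j) (\<zeta> $ j))) (at \<zeta>)"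
    unfolding solution_phase_def[abs_def] by simp
  show "degree (phase_poly v p \<tau> j) \<le> Suc (m - 2)"
    using m deg[of j] by (intro degree_phase_poly) simp
qed

abbreviation multiplied :: "real \<Rightarrow> (real ^ 'n \<Rightarrow> complex) \<Rightarrow> real ^ 'n \<Rightarrow> complex" where
  "multiplied \<tau> f \<equiv> (\<lambda>\<xi>. cis (solution_phase v q \<tau> \<xi>) * fourier f \<xi>)"

lemma solution_op_eq: "solution_op v q \<tau> f = (\<lambda>x. cis (x \<bullet> (- \<tau> *\<^sub>R v)) * inv_fourier (multiplied \<tau> f) x)"
  by (simp add: solution_op_def[abs_def])

lemma ofam_multiplier: "ofam (\<lambda>_. 1) (\<lambda>_ \<xi>. cis (solution_phase v q \<tau> \<xi>))"
  by (rule ofam_comp[OF phase.ofam_cis_phase[OF phase]])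

lemma multiplied_schwartz: "f \<in> schwartz \<Longrightarrow> multiplied \<tau> f \<in> schwartz"
  by (intro schwartz_mult_ofam ofam_multiplier schwartz_fourier)

text \<open>With index type \<open>unit\<close> this is invariance of the Schwartz space; with
  \<open>nat\<close> it is the continuity required by \<open>tempered_compose\<close>.\<close>

lemma sfam_solution_op:
  assumes G: "sfam (\<lambda>_. 1) G"
  shows "sfam (\<lambda>_. 1) (\<lambda>k. solution_op v q \<tau> (G k))"
proof -
  have "sfam (\<lambda>k. 1 * 1) (\<lambda>k. multiplied \<tau> (G k))"
    by (rule sfam_mult[OF ofam_multiplier sfam_fourier[OF G]])
  then have "sfam (\<lambda>k. 1) (\<lambda>k. inv_fourier (multiplied \<tau> (G k)))"
    by (intro sfam_inv_fourier) simp
  from sfam_mult[OF ofam_comp[OF ofam_cis_inner[of "- \<tau> *\<^sub>R v"]] this]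
  show ?thesis unfolding solution_op_eq mult_1 .
qed

lemma solution_op_schwartz: "f \<in> schwartz \<Longrightarrow> solution_op v q \<tau> f \<in> schwartz"
  unfolding schwartz_iff_sfam by (rule sfam_solution_op)

lemma solution_op_add:
  assumes "f \<in> schwartz" "g \<in> schwartz"
  shows "solution_op v q \<tau> (\<lambda>x. f x + g x) = (\<lambda>x. solution_op v q \<tau> f x + solution_op v q \<tau> g x)"
proof -
  have "multiplied \<tau> (\<lambda>x. f x + g x) = (\<lambda>\<xi>. multiplied \<tau> f \<xi> + multiplied \<tau> g \<xi>)"
    unfolding fourier_add[OF assms] by (simp add: distrib_left)
  then show ?thesis unfolding solution_op_eq
    by (simp add: inv_fourier_add multiplied_schwartz assms distrib_left)
qed

lemma solution_op_cmult: "solution_op v q \<tau> (\<lambda>x. c * f x) = (\<lambda>x. c * solution_op v q \<tau> f x)"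
proof -
  have "multiplied \<tau> (\<lambda>x. c * f x) = (\<lambda>\<xi>. c * multiplied \<tau> f \<xi>)"
    unfolding fourier_cmult by (simp add: mult.left_commute)
  then show ?thesis unfolding solution_op_eq by (simp add: inv_fourier_cmult mult.left_commute)
qed

text \<open>On the Fourier side the operator multiplies by a phase and then translates by a multiple
  of \<open>v\<close>. Composing the times \<open>t\<close> and \<open>- t\<close>, the translations
  cancel, and so do the two phases, the second being evaluated at the translated point.\<close>

lemma solution_op_inverse:
  assumes f: "f \<in> schwartz"
  shows "solution_op v q (- t) (solution_op v q t f) = f"
proof
  fix x
  have F: "fourier (solution_op v q t f) \<zeta> = cis (solution_phase v q t (\<zeta> + t *\<^sub>R v)) * fourier f (\<zeta> + t *\<^sub>R v)" for \<zeta>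
    unfolding solution_op_eq fourier_modulate by (simp add: fourier_inv_fourier multiplied_schwartz f)
  have "solution_phase v q (- t) \<zeta> + solution_phase v q t (\<zeta> + t *\<^sub>R v) = 0" for \<zeta>
    unfolding solution_phase_def sum.distrib[symmetric] by (intro sum.neutral ballI) (simp add: algebra_simps)
  then have "multiplied (- t) (solution_op v q t f) \<zeta> = fourier f (\<zeta> + t *\<^sub>R v)" for \<zeta>
    unfolding F by (simp add: mult.assoc[symmetric] cis_mult)
  then have "multiplied (- t) (solution_op v q t f) = fourier (\<lambda>x. cis (x \<bullet> (- t *\<^sub>R v)) * f x)"
    unfolding fourier_modulate by simp
  then have "solution_op v q (- t) (solution_op v q t f) x = cis (x \<bullet> (t *\<^sub>R v)) * (cis (x \<bullet> (- t *\<^sub>R v)) * f x)"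
    by (subst solution_op_eq) (simp only: minus_minus inv_fourier_fourier[OF schwartz_modulate[OF f]])
  then show "solution_op v q (- t) (solution_op v q t f) x = f x"
    by (simp add: mult.assoc[symmetric] cis_mult)
qed

lemma solution_op_dist_tempered:
  assumes u: "u \<in> tempered_distributions"
  shows "solution_op_dist v q t u \<in> tempered_distributions"
proof -
  have "(\<lambda>f. u ((\<lambda>f x. cnj (solution_op v q (- t) (\<lambda>x. cnj (f x)) x)) f)) \<in> tempered_distributions"
  proof (rule tempered_compose[OF u])
    fix f g :: "real ^ 'n \<Rightarrow> complex" assume "f \<in> schwartz" "g \<in> schwartz"
    then show "(\<lambda>x. cnj (solution_op v q (- t) (\<lambda>x. cnj (f x + g x)) x)) =
        (\<lambda>x. cnj (solution_op v q (- t) (\<lambda>x. cnj (f x)) x) + cnj (solution_op v q (- t) (\<lambda>x. cnj (g x)) x))"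
      by (simp add: solution_op_add schwartz_cnj)
  next
    fix f :: "real ^ 'n \<Rightarrow> complex" and c
    show "(\<lambda>x. cnj (solution_op v q (- t) (\<lambda>x. cnj (c * f x)) x)) =
        (\<lambda>x. c * cnj (solution_op v q (- t) (\<lambda>x. cnj (f x)) x))"
      by (simp add: solution_op_cmult)
  next
    fix G :: "nat \<Rightarrow> real ^ 'n \<Rightarrow> complex" assume "sfam (\<lambda>_. 1) G"
    then show "sfam (\<lambda>_. 1) (\<lambda>k x. cnj (solution_op v q (- t) (\<lambda>x. cnj (G k x)) x))"
      by (intro sfam_cnj sfam_solution_op)
  qed
  then show ?thesis unfolding solution_op_dist_def[abs_def] pairing_def by simp
qed

section \<open>The phase space kernel of the solution operator\<close>

lemma stft_solution_op_dist:
  "stft \<phi> (solution_op_dist v q t u) x \<xi> =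
    complex_of_real ((2 * pi) powr (- real CARD('n) / 2)) * pairing u (solution_op v q (- t) (tfs \<phi> (x, \<xi>)))"
  unfolding stft_def pairing_solution_op_dist by (simp add: tfs_def[abs_def])

lemma stft_solution_op_dist_inverse:
  assumes "\<phi> \<in> schwartz"
  shows "stft \<phi> (solution_op_dist v q (- t) (solution_op_dist v q t u)) = stft \<phi> u"
proof (intro ext)
  fix x \<xi>
  have "solution_op v q (- t) (solution_op v q (- (- t)) (tfs \<phi> (x, \<xi>))) = tfs \<phi> (x, \<xi>)"
    using solution_op_inverse[OF schwartz_tfs[OF assms]] by simp
  then show "stft \<phi> (solution_op_dist v q (- t) (solution_op_dist v q t u)) x \<xi> = stft \<phi> u x \<xi>"
    unfolding stft_solution_op_dist pairing_solution_op_dist by (simp add: stft_def tfs_def[abs_def])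
qed

text \<open>The multiplication formula moves the pairing to the frequency side, where \<theta> is
  measured from \<xi>. The modulation by \<open>- \<tau> *\<^sub>R v\<close> in the solution
  operator is absorbed into the frequency of the second shift, whence
  \<open>\<xi> - \<eta> - \<tau> *\<^sub>R v\<close>. Leftover unimodular constants vanish in the
  modulus.\<close>

lemma kernel_eq:
  assumes \<phi>: "\<phi> \<in> schwartz"
  shows "cmod (fstft \<phi> (solution_op v q \<tau> (tfs \<phi> (x, \<xi>))) (y, \<eta>)) =
    (2 * pi) powr (- real CARD('n) / 2) * cmod (phase.osc_integral (solution_phase v q \<tau>) \<xi> (y - x)
      (\<lambda>\<theta>. cnj (fourier \<phi> (\<theta> + (\<xi> - \<eta> - \<tau> *\<^sub>R v))) * fourier \<phi> \<theta>))"
proof -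
  interpret P: phase "solution_phase v q \<tau>" "phase_poly v p \<tau>" "m - 2" by (rule phase)
  define c where "c = (2 * pi) powr (- real CARD('n) / 2)"
  define \<kappa> where "\<kappa> = \<xi> - \<eta> - \<tau> *\<^sub>R v"
  define A where "A = multiplied \<tau> (tfs \<phi> (x, \<xi>))"
  define b where "b = tfs \<phi> (y, \<eta> + \<tau> *\<^sub>R v)"
  have AS: "A \<in> schwartz" unfolding A_def by (intro multiplied_schwartz schwartz_tfs \<phi>)
  have bS: "b \<in> schwartz" unfolding b_def by (intro schwartz_tfs \<phi>)
  have integrand: "solution_op v q \<tau> (tfs \<phi> (x, \<xi>)) s * cnj (\<phi> (s - y)) * cis (- (s \<bullet> \<eta>)) = inv_fourier A s * cnj (b s)" for s
    unfolding solution_op_eq A_def[symmetric] b_def tfs_def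
    by (simp add: inner_add_right mult_ac cis_cnj cis_mult)
  have "fstft \<phi> (solution_op v q \<tau> (tfs \<phi> (x, \<xi>))) (y, \<eta>) = complex_of_real c * (\<integral>s. inv_fourier A s * cnj (b s) \<partial>lborel)"
    unfolding fstft_def fourier_def fst_conv snd_conv integrand c_def ..
  also have "(\<integral>s. inv_fourier A s * cnj (b s) \<partial>lborel) = cnj (\<integral>s. fourier (\<lambda>x. cnj (A x)) s * b s \<partial>lborel)"
    unfolding Bochner_Integration.integral_cnj[symmetric] by (simp add: inv_fourier_eq_cnj)
  also have "(\<integral>s. fourier (\<lambda>x. cnj (A x)) s * b s \<partial>lborel) = (\<integral>\<zeta>. cnj (A \<zeta>) * fourier b \<zeta> \<partial>lborel)"
    by (intro integral_mult_fourier schwartz_integrable schwartz_cnj AS bS)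
  also have "cnj \<dots> = (\<integral>\<zeta>. A \<zeta> * cnj (fourier b \<zeta>) \<partial>lborel)"
    unfolding Bochner_Integration.integral_cnj[symmetric] by simp
  also have "\<dots> = (\<integral>\<theta>. A (\<theta> + \<xi>) * cnj (fourier b (\<theta> + \<xi>)) \<partial>lborel)"
    by (intro integral_lborel_translate[symmetric] schwartz_measurable schwartz_mult schwartz_cnj schwartz_fourier AS bS)
  also have "\<dots> = (\<integral>\<theta>. cis (y \<bullet> \<kappa>) * (P.osc \<xi> (y - x) \<theta> * (cnj (fourier \<phi> (\<theta> + \<kappa>)) * fourier \<phi> \<theta>)) \<partial>lborel)"
  proof (rule Bochner_Integration.integral_cong[OF refl])
    fix \<theta>
    have k: "\<theta> + \<xi> - (\<eta> + \<tau> *\<^sub>R v) = \<theta> + \<kappa>" by (simp add: \<kappa>_def)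
    have "cis (- (x \<bullet> \<theta>)) * cis (y \<bullet> (\<theta> + \<kappa>)) = cis (y \<bullet> \<kappa>) * cis (\<theta> \<bullet> (y - x))"
      by (simp add: cis_mult inner_diff_right inner_add_right inner_commute algebra_simps)
    then have e: "cis (- (x \<bullet> \<theta>)) * (cis (y \<bullet> (\<theta> + \<kappa>)) * z) = cis (y \<bullet> \<kappa>) * (cis (\<theta> \<bullet> (y - x)) * z)" for z
      by (simp add: mult.assoc[symmetric])
    have "A (\<theta> + \<xi>) * cnj (fourier b (\<theta> + \<xi>)) = cis (solution_phase v q \<tau> (\<theta> + \<xi>)) *
        (cis (- (x \<bullet> \<theta>)) * (cis (y \<bullet> (\<theta> + \<kappa>)) * (cnj (fourier \<phi> (\<theta> + \<kappa>)) * fourier \<phi> \<theta>)))"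
      unfolding A_def b_def fourier_tfs[OF \<phi>] k by (simp add: cis_cnj mult_ac)
    then show "A (\<theta> + \<xi>) * cnj (fourier b (\<theta> + \<xi>)) =
        cis (y \<bullet> \<kappa>) * (P.osc \<xi> (y - x) \<theta> * (cnj (fourier \<phi> (\<theta> + \<kappa>)) * fourier \<phi> \<theta>))"
      unfolding e P.osc_def by (simp add: mult_ac)
  qed
  also have "\<dots> = cis (y \<bullet> \<kappa>) * P.osc_integral \<xi> (y - x) (\<lambda>\<theta>. cnj (fourier \<phi> (\<theta> + \<kappa>)) * fourier \<phi> \<theta>)"
    unfolding P.osc_integral_def by (rule integral_mult_right_zero)
  finally show ?thesis unfolding \<kappa>_def[symmetric] by (simp add: norm_mult c_def)
qed

definition grad :: "real \<Rightarrow> real ^ 'n \<Rightarrow> real ^ 'n" where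
  "grad \<tau> \<xi> = (\<chi> j. poly (phase_poly v p \<tau> j) (\<xi> $ j))"

text \<open>The amplitude is a product of two copies of the transformed window displaced by
  \<open>\<xi> - \<eta> - \<tau> *\<^sub>R v\<close>, so as a family it carries any inverse power of
  that displacement. The other factor is the decay of the oscillatory integral with this
  weight.\<close>

lemma kernel_bound:
  assumes \<phi>: "\<phi> \<in> schwartz"
  shows "\<exists>C\<ge>0. \<forall>x \<xi> y \<eta>. wt (y - x + grad \<tau> \<xi>) ^ N * wt (\<xi> - \<eta> - \<tau> *\<^sub>R v) ^ M *
    cmod (fstft \<phi> (solution_op v q \<tau> (tfs \<phi> (x, \<xi>))) (y, \<eta>)) \<le> C * wt \<xi> ^ ((m - 2) * N)"
proof -
  interpret P: phase "solution_phase v q \<tau>" "phase_poly v p \<tau>" "m - 2" by (rule phase)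
  have grad: "P.grad = grad \<tau>" by (auto simp: P.grad_def grad_def)
  define c where "c = (2 * pi) powr (- real CARD('n) / 2)"
  have c: "c \<ge> 0" unfolding c_def by simp
  define G where "G = (\<lambda>(\<xi> :: real ^ 'n, \<kappa>) \<theta>. cnj (fourier \<phi> (\<theta> + \<kappa>)) * fourier \<phi> \<theta>)"
  note F = schwartz_fourier[OF \<phi>]
  have "sfam (\<lambda>z. inverse (wt (snd z) ^ M) * 1) (\<lambda>z \<theta>. cnj (fourier \<phi> (\<theta> + snd z)) * fourier \<phi> \<theta>)"
    by (rule sfam_mult[OF ofam_comp[OF ofam_cnj[OF ofam_translate[OF F]], of snd] schwartz_sfam[OF F]])
  then have "sfam (\<lambda>z. inverse (wt (snd z) ^ M)) G" unfolding G_def by (simp add: case_prod_beta')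
  from P.osc_integral_decay[OF this, of fst N]
  obtain C where C: "C \<ge> 0" "\<And>z b. wt (b + grad \<tau> (fst z)) ^ N * cmod (P.osc_integral (fst z) b (G z)) \<le>
      C * (wt (fst z) ^ ((m - 2) * N) * inverse (wt (snd z) ^ M))"
    unfolding grad by auto
  have "wt (y - x + grad \<tau> \<xi>) ^ N * wt (\<xi> - \<eta> - \<tau> *\<^sub>R v) ^ M *
    cmod (fstft \<phi> (solution_op v q \<tau> (tfs \<phi> (x, \<xi>))) (y, \<eta>)) \<le> (c * C) * wt \<xi> ^ ((m - 2) * N)" for x \<xi> y \<eta>
  proof -
    define \<kappa> where "\<kappa> = \<xi> - \<eta> - \<tau> *\<^sub>R v"
    define J where "J = cmod (P.osc_integral \<xi> (y - x) (\<lambda>\<theta>. cnj (fourier \<phi> (\<theta> + \<kappa>)) * fourier \<phi> \<theta>))"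
    have "wt (y - x + grad \<tau> \<xi>) ^ N * J \<le> C * (wt \<xi> ^ ((m - 2) * N) * inverse (wt \<kappa> ^ M))"
      using C(2)[of "y - x" "(\<xi>, \<kappa>)"] by (simp add: G_def J_def)
    then have "(wt (y - x + grad \<tau> \<xi>) ^ N * J) * wt \<kappa> ^ M \<le> C * wt \<xi> ^ ((m - 2) * N)"
      by (simp add: field_simps)
    then have "c * ((wt (y - x + grad \<tau> \<xi>) ^ N * J) * wt \<kappa> ^ M) \<le> c * (C * wt \<xi> ^ ((m - 2) * N))"
      using c by (rule mult_left_mono)
    then show ?thesis unfolding kernel_eq[OF \<phi>] \<kappa>_def[symmetric] J_def c_def by (simp add: mult_ac)
  qed
  moreover have "c * C \<ge> 0" using c C(1) by simp
  ultimately show ?thesis by blast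
qed

text \<open>The kernel lives near \<open>y = x - grad \<tau> \<xi>\<close> and
  \<open>\<eta> = \<xi> - \<tau> *\<^sub>R v\<close>. Spending \<open>A\<close> further powers of
  decay replaces the weights in \<open>y\<close> and \<eta> by weights at these centres.\<close>

lemma kernel_bound_polynomial:
  assumes \<phi>: "\<phi> \<in> schwartz"
  shows "\<exists>C\<ge>0. \<forall>x \<xi> y \<eta>. wt (y - x + grad \<tau> \<xi>) ^ i * wt (\<xi> - \<eta> - \<tau> *\<^sub>R v) ^ j * (wt y ^ A * wt \<eta> ^ A *
    cmod (fstft \<phi> (solution_op v q \<tau> (tfs \<phi> (x, \<xi>))) (y, \<eta>))) \<le>
    C * (wt (x - grad \<tau> \<xi>) * wt (\<xi> - \<tau> *\<^sub>R v)) ^ A * wt \<xi> ^ ((m - 2) * (i + A))"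
proof -
  obtain C where C: "C \<ge> 0" "\<And>x \<xi> y \<eta>. wt (y - x + grad \<tau> \<xi>) ^ (i + A) * wt (\<xi> - \<eta> - \<tau> *\<^sub>R v) ^ (j + A) *
    cmod (fstft \<phi> (solution_op v q \<tau> (tfs \<phi> (x, \<xi>))) (y, \<eta>)) \<le> C * wt \<xi> ^ ((m - 2) * (i + A))"
    using kernel_bound[OF \<phi>, of \<tau> "i + A" "j + A"] by blast
  have "wt (y - x + grad \<tau> \<xi>) ^ i * wt (\<xi> - \<eta> - \<tau> *\<^sub>R v) ^ j * (wt y ^ A * wt \<eta> ^ A *
    cmod (fstft \<phi> (solution_op v q \<tau> (tfs \<phi> (x, \<xi>))) (y, \<eta>))) \<le>
    C * (wt (x - grad \<tau> \<xi>) * wt (\<xi> - \<tau> *\<^sub>R v)) ^ A * wt \<xi> ^ ((m - 2) * (i + A))" for x \<xi> y \<eta>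
  proof -
    define a where "a = wt (y - x + grad \<tau> \<xi>)"
    define b where "b = wt (\<xi> - \<eta> - \<tau> *\<^sub>R v)"
    define k where "k = cmod (fstft \<phi> (solution_op v q \<tau> (tfs \<phi> (x, \<xi>))) (y, \<eta>))"
    define X where "X = wt (x - grad \<tau> \<xi>)"
    define Y where "Y = wt (\<xi> - \<tau> *\<^sub>R v)"
    have nn: "a \<ge> 0" "b \<ge> 0" "k \<ge> 0" "X \<ge> 0" "Y \<ge> 0" unfolding a_def b_def k_def X_def Y_def by auto
    have "wt y \<le> a * X" unfolding a_def X_def using wt_add_le[of "y - x + grad \<tau> \<xi>" "x - grad \<tau> \<xi>"] by simp
    moreover have "wt \<eta> \<le> b * Y" unfolding b_def Y_def
      using wt_diff_le[of "\<xi> - \<tau> *\<^sub>R v" "\<xi> - \<eta> - \<tau> *\<^sub>R v"] by (simp add: mult.commute)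
    ultimately have "wt y ^ A * wt \<eta> ^ A \<le> (a * X) ^ A * (b * Y) ^ A"
      using nn by (intro mult_mono power_mono) auto
    then have "a ^ i * b ^ j * (wt y ^ A * wt \<eta> ^ A * k) \<le> a ^ i * b ^ j * ((a * X) ^ A * (b * Y) ^ A * k)"
      using nn by (intro mult_left_mono mult_right_mono) auto
    also have "\<dots> = (X * Y) ^ A * (a ^ (i + A) * b ^ (j + A) * k)"
      by (simp add: power_add power_mult_distrib mult_ac)
    also have "\<dots> \<le> (X * Y) ^ A * (C * wt \<xi> ^ ((m - 2) * (i + A)))"
      using C(2) nn unfolding a_def b_def k_def by (intro mult_left_mono) auto
    finally show ?thesis unfolding a_def b_def k_def X_def Y_def by (simp add: mult_ac)
  qed
  with C(1) show ?thesis by blast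
qed

lemma stft_solution_op_dist_reproducing:
  assumes u: "u \<in> tempered_distributions" and \<phi>: "\<phi> \<in> schwartz"
  shows "norm_sq \<phi> * stft \<phi> (solution_op_dist v q t u) x \<xi> =
    complex_of_real ((2 * pi) powr (- real CARD('n) / 2)) *
    (\<integral>w. cnj (fstft \<phi> (solution_op v q (- t) (tfs \<phi> (x, \<xi>))) w) * stft \<phi> u (fst w) (snd w) \<partial>lborel)"
proof -
  define g where "g = solution_op v q (- t) (tfs \<phi> (x, \<xi>))"
  have g: "g \<in> schwartz" unfolding g_def by (intro solution_op_schwartz schwartz_tfs \<phi>)
  have "\<exists>C. \<forall>y \<eta>. wt y ^ N * wt \<eta> ^ N * cmod (fstft \<phi> g (y, \<eta>)) \<le> C" for N
  proof -
    obtain C where "\<And>x \<xi> y \<eta>. wt (y - x + grad (- t) \<xi>) ^ 0 * wt (\<xi> - \<eta> - (- t) *\<^sub>R v) ^ 0 * (wt y ^ N * wt \<eta> ^ N *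
        cmod (fstft \<phi> (solution_op v q (- t) (tfs \<phi> (x, \<xi>))) (y, \<eta>))) \<le>
        C * (wt (x - grad (- t) \<xi>) * wt (\<xi> - (- t) *\<^sub>R v)) ^ N * wt \<xi> ^ ((m - 2) * (0 + N))"
      using kernel_bound_polynomial[OF \<phi>, of "- t" 0 0 N] by blast
    then show ?thesis unfolding g_def power_0 mult_1 by blast
  qed
  from stft_reproducing[OF u \<phi> g this]
  show ?thesis unfolding stft_solution_op_dist g_def[symmetric] by (simp add: mult.left_commute)
qed

text \<open>If the gradient of the phase is \<open>\<lambda> B(\<xi>)\<close> up to \<open>O(\<lambda>\<^sup>\<rho>)\<close> at the scaled frequency
  \<open>\<lambda>\<^sup>\<sigma> \<xi>\<close>, then on the anisotropic scale the kernel is concentrated where \<open>w\<close> is the image of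
  \<open>z\<close> under \<open>(x, \<xi>) \<mapsto> (x - B \<xi>, \<xi>)\<close>; its width \<open>\<lambda> powr (\<sigma> (m - 2))\<close> in \<open>x\<close> is negligible.\<close>

lemma gabor_WF_step:
  fixes B :: "real ^ 'n \<Rightarrow> real ^ 'n"
  assumes u: "u \<in> tempered_distributions" and \<phi>: "\<phi> \<in> schwartz" "\<phi> \<noteq> (\<lambda>x. 0)"
    and \<sigma>: "\<sigma> > 0" "\<sigma> * real (m - 2) < 1"
    and B: "continuous_on UNIV B" and \<rho>: "\<rho> < 1"
    and asym: "\<And>R. \<exists>C\<ge>0. \<forall>l\<ge>1. \<forall>\<xi>. norm \<xi> \<le> R \<longrightarrow>
      norm (grad (- t) (l powr \<sigma> *\<^sub>R \<xi>) - l *\<^sub>R B \<xi>) \<le> C * l powr \<rho>"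
    and z: "(x0, \<xi>0) \<in> gabor_WF \<phi> \<sigma> (solution_op_dist v q t u)"
    and nz: "(x0 - B \<xi>0, \<xi>0) \<noteq> 0"
  shows "(x0 - B \<xi>0, \<xi>0) \<in> gabor_WF \<phi> \<sigma> u"
proof (rule ccontr)
  define y0 where "y0 = x0 - B \<xi>0"
  define V where "V y \<eta> = cmod (stft \<phi> u y \<eta>)" for y \<eta>
  define V' where "V' x \<xi> = cmod (stft \<phi> (solution_op_dist v q t u) x \<xi>)" for x \<xi>
  define k where "k x \<xi> y \<eta> = cmod (fstft \<phi> (solution_op v q (- t) (tfs \<phi> (x, \<xi>))) (y, \<eta>))" for x \<xi> y \<eta>
  have k0: "k x \<xi> y \<eta> \<ge> 0" and V0: "V y \<eta> \<ge> 0" for x \<xi> y \<eta> unfolding k_def V_def by auto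
  assume "(x0 - B \<xi>0, \<xi>0) \<notin> gabor_WF \<phi> \<sigma> u"
  then obtain U where U: "open U" "(y0, \<xi>0) \<in> U" and bddU: "\<And>N. N \<ge> 0 \<Longrightarrow>
      bdd_above {l powr N * V (l *\<^sub>R y) ((l powr \<sigma>) *\<^sub>R \<eta>) | l y \<eta>. (y, \<eta>) \<in> U \<and> l > 0}"
    using nz unfolding gabor_WF_def V_def y0_def by auto
  obtain e where e: "e > 0" "ball (y0, \<xi>0) e \<subseteq> U" using U open_contains_ball by blast
  \<comment> \<open>A product of two balls of this radius fits into the ball of radius
    \<open>e\<close>.\<close>
  define \<epsilon> where "\<epsilon> = e / 2"
  have eps: "\<epsilon> > 0" unfolding \<epsilon>_def using e(1) by simp
  have inU: "(y, \<eta>) \<in> U" if "norm (y - y0) < \<epsilon>" "norm (\<eta> - \<xi>0) < \<epsilon>" for y \<eta>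
  proof -
    have "dist (y0, \<xi>0) (y, \<eta>) = norm (y - y0, \<eta> - \<xi>0)" by (subst dist_commute) (simp add: dist_norm)
    also have "\<dots> \<le> norm (y - y0) + norm (\<eta> - \<xi>0)" by (rule norm_Pair_le)
    also have "\<dots> < e" using that unfolding \<epsilon>_def by simp
    finally show ?thesis using e(2) by auto
  qed
  define R where "R = norm x0 + norm \<xi>0 + 1"
  have R: "R \<ge> 0" unfolding R_def by simp
  \<comment> \<open>The transported point stays within \<open>\<epsilon> / 4\<close> of
    \<open>y0\<close>, which leaves another \<open>\<epsilon> / 4\<close> for the error of the
    gradient asymptotics. The bound \<open>R\<close> makes all constants below uniform.\<close>
  define U' where "U' = {z. norm (fst z - B (snd z) - y0) < \<epsilon> / 4 \<and> norm (snd z - \<xi>0) < \<epsilon> / 2 \<and> norm (fst z) < R \<and> norm (snd z) < R}"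
  have "open U'" unfolding U'_def
    by (intro open_Collect_conj open_Collect_less continuous_intros continuous_on_compose2[OF B]) auto
  moreover have "(x0, \<xi>0) \<in> U'" unfolding U'_def using eps by (simp add: y0_def R_def add_nonneg_pos)
  moreover have "bdd_above {l powr N * V' (l *\<^sub>R x) ((l powr \<sigma>) *\<^sub>R \<xi>) | l x \<xi>. (x, \<xi>) \<in> U' \<and> l > 0}"
    if N: "N \<ge> 0" for N
  proof -
    \<comment> \<open>Scales up to 1 are harmless: the scaled points stay in a bounded set and
      \<open>l powr N\<close> is at most 1.\<close>
    have "\<exists>E1. \<forall>l x \<xi>. (x, \<xi>) \<in> U' \<longrightarrow> 0 < l \<longrightarrow> l \<le> 1 \<longrightarrow> l powr N * V' (l *\<^sub>R x) ((l powr \<sigma>) *\<^sub>R \<xi>) \<le> E1"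
    proof -
      obtain C K where C: "C \<ge> 0" "\<And>x \<xi>. V' x \<xi> \<le> C * wt x ^ K * wt \<xi> ^ K"
        using stft_growth[OF solution_op_dist_tempered[OF u] \<phi>(1)] unfolding V'_def by blast
      have "l powr N * V' (l *\<^sub>R x) ((l powr \<sigma>) *\<^sub>R \<xi>) \<le> C * (1 + R) ^ K * (1 + R) ^ K"
        if "(x, \<xi>) \<in> U'" "0 < l" "l \<le> 1" for l x \<xi>
      proof -
        have r: "norm x \<le> R" "norm \<xi> \<le> R" using that(1) unfolding U'_def by auto
        have p1: "l powr N \<le> 1" "l powr \<sigma> \<le> 1" using that N \<sigma>(1) by (auto intro: powr_le1)
        have "wt (l *\<^sub>R x) \<le> 1 + R"
          using mult_mono[OF that(3) r(1)] that(2) unfolding wt_def by simp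
        moreover have "wt ((l powr \<sigma>) *\<^sub>R \<xi>) \<le> 1 + R"
          using mult_mono[OF p1(2) r(2)] unfolding wt_def by simp
        ultimately have "C * wt (l *\<^sub>R x) ^ K * wt ((l powr \<sigma>) *\<^sub>R \<xi>) ^ K \<le> C * (1 + R) ^ K * (1 + R) ^ K"
          using C(1) R by (intro mult_mono power_mono) auto
        with C(2) have "V' (l *\<^sub>R x) ((l powr \<sigma>) *\<^sub>R \<xi>) \<le> C * (1 + R) ^ K * (1 + R) ^ K" using order_trans by blast
        moreover have "l powr N * V' (l *\<^sub>R x) ((l powr \<sigma>) *\<^sub>R \<xi>) \<le> 1 * V' (l *\<^sub>R x) ((l powr \<sigma>) *\<^sub>R \<xi>)"
          using p1(1) by (intro mult_right_mono) (auto simp: V'_def)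
        ultimately show ?thesis by simp
      qed
      then show ?thesis by blast
    qed
    then obtain E1 where E1: "\<And>l x \<xi>. (x, \<xi>) \<in> U' \<Longrightarrow> 0 < l \<Longrightarrow> l \<le> 1 \<Longrightarrow> l powr N * V' (l *\<^sub>R x) ((l powr \<sigma>) *\<^sub>R \<xi>) \<le> E1"
      by blast

    \<comment> \<open>\<open>s\<close> is the exponent of \<open>l\<close> that one power of
      position decay costs. One power of the weights in \<open>y\<close> and \<eta> costs
      \<open>\<mu>\<close>: 1 for the position, \<sigma> for the frequency, and \<open>s\<close> for
      the extra integration by parts.\<close>
    define s where "s = \<sigma> * real (m - 2)"
    define \<mu> where "\<mu> = 1 + \<sigma> + s"
    have s: "0 \<le> s" "s < 1" unfolding s_def using \<sigma> by auto
    have \<mu>: "\<mu> \<ge> 0" unfolding \<mu>_def using \<sigma>(1) s by simp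
    obtain Ca where Ca: "Ca \<ge> 0" "\<And>l \<xi>. l \<ge> 1 \<Longrightarrow> norm \<xi> \<le> R \<Longrightarrow>
        norm (grad (- t) (l powr \<sigma> *\<^sub>R \<xi>) - l *\<^sub>R B \<xi>) \<le> Ca * l powr \<rho>" using asym[of R] by blast
    have "bounded (B ` cball 0 R)"
      by (intro compact_imp_bounded compact_continuous_image continuous_on_subset[OF B]) auto
    then obtain b0 where "\<forall>w\<in>B ` cball 0 R. norm w \<le> b0" unfolding bounded_iff by blast
    then have b0: "norm (B \<xi>) \<le> b0" if "norm \<xi> \<le> R" for \<xi> using that by simp
    define T where "T = norm (t *\<^sub>R v)"
    define c1 where "c1 = 1 + R + b0 + Ca"
    define c2 where "c2 = 1 + R + T"
    have b00: "b0 \<ge> 0" using b0[of 0] R order_trans[OF norm_ge_zero] by auto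
    have cpos: "c1 \<ge> 0" "c2 \<ge> 0" unfolding c1_def c2_def T_def using b00 Ca(1) R by auto
    have lrho: "l powr \<rho> \<le> l" if "l \<ge> 1" for l :: real
      using powr_mono[of \<rho> 1 l] \<rho> that by simp
    have lsig: "1 \<le> l powr \<sigma>" if "l \<ge> 1" for l :: real
      using ge_one_powr_ge_zero[of l \<sigma>] \<sigma>(1) that by simp
    have bx: "wt (l *\<^sub>R x - grad (- t) (l powr \<sigma> *\<^sub>R \<xi>)) \<le> c1 * l" if "l \<ge> 1" "(x, \<xi>) \<in> U'" for l x \<xi>
    proof -
      have r: "norm x \<le> R" "norm \<xi> \<le> R" using that(2) unfolding U'_def by auto
      have "norm (l *\<^sub>R x - grad (- t) (l powr \<sigma> *\<^sub>R \<xi>)) =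
          norm (l *\<^sub>R x - l *\<^sub>R B \<xi> - (grad (- t) (l powr \<sigma> *\<^sub>R \<xi>) - l *\<^sub>R B \<xi>))" by simp
      also have "\<dots> \<le> norm (l *\<^sub>R x) + norm (l *\<^sub>R B \<xi>) + norm (grad (- t) (l powr \<sigma> *\<^sub>R \<xi>) - l *\<^sub>R B \<xi>)"
        by (intro order_trans[OF norm_triangle_ineq4] add_right_mono norm_triangle_ineq4)
      also have "\<dots> \<le> l * R + l * b0 + Ca * l"
      proof (intro add_mono)
        show "norm (l *\<^sub>R x) \<le> l * R" "norm (l *\<^sub>R B \<xi>) \<le> l * b0"
          using r b0[OF r(2)] that(1) by (auto intro!: mult_left_mono)
        show "norm (grad (- t) (l powr \<sigma> *\<^sub>R \<xi>) - l *\<^sub>R B \<xi>) \<le> Ca * l"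
          using Ca(2)[OF that(1) r(2)] mult_left_mono[OF lrho[OF that(1)] Ca(1)] by linarith
      qed
      finally show ?thesis using that(1) unfolding wt_def c1_def by (simp add: algebra_simps)
    qed
    have bxi: "wt (l powr \<sigma> *\<^sub>R \<xi> - (- t) *\<^sub>R v) \<le> c2 * l powr \<sigma>" "wt (l powr \<sigma> *\<^sub>R \<xi>) \<le> (1 + R) * l powr \<sigma>"
      if "l \<ge> 1" "(x, \<xi>) \<in> U'" for l x \<xi>
    proof -
      have r: "norm \<xi> \<le> R" using that(2) unfolding U'_def by auto
      have 1: "norm (l powr \<sigma> *\<^sub>R \<xi>) \<le> l powr \<sigma> * R" using r by (simp add: mult_left_mono)
      have 2: "T \<le> T * l powr \<sigma>" using mult_left_mono[OF lsig[OF that(1)], of T] by (simp add: T_def)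
      have "norm (l powr \<sigma> *\<^sub>R \<xi> - (- t) *\<^sub>R v) \<le> norm (l powr \<sigma> *\<^sub>R \<xi>) + T"
        unfolding T_def using norm_triangle_ineq4[of "l powr \<sigma> *\<^sub>R \<xi>" "(- t) *\<^sub>R v"] by simp
      with 1 2 lsig[OF that(1)] show "wt (l powr \<sigma> *\<^sub>R \<xi> - (- t) *\<^sub>R v) \<le> c2 * l powr \<sigma>"
        unfolding wt_def c2_def by (simp add: algebra_simps)
      from 1 lsig[OF that(1)] show "wt (l powr \<sigma> *\<^sub>R \<xi>) \<le> (1 + R) * l powr \<sigma>"
        unfolding wt_def by (simp add: algebra_simps)
    qed
    define a where "a l x \<xi> y = wt (y - l *\<^sub>R x + grad (- t) (l powr \<sigma> *\<^sub>R \<xi>))" for l x \<xi> y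
    define b where "b l \<xi> \<eta> = wt (l powr \<sigma> *\<^sub>R \<xi> - \<eta> - (- t) *\<^sub>R v)" for l \<xi> \<eta>
    define Q where "Q A l x \<xi> y \<eta> = wt y ^ A * wt \<eta> ^ A * k (l *\<^sub>R x) (l powr \<sigma> *\<^sub>R \<xi>) y \<eta>" for A l x \<xi> y \<eta>
    have Q0: "Q A l x \<xi> y \<eta> \<ge> 0" for A l x \<xi> y \<eta> unfolding Q_def by (auto simp: k0)
    have star: "\<exists>C\<ge>0. \<forall>l x \<xi> y \<eta>. l \<ge> 1 \<longrightarrow> (x, \<xi>) \<in> U' \<longrightarrow>
        a l x \<xi> y ^ i * b l \<xi> \<eta> ^ j * Q A l x \<xi> y \<eta> \<le> C * l powr (\<mu> * real A + s * real i)" for A i j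
    proof -
      obtain C where C: "C \<ge> 0" "\<And>x \<xi> y \<eta>. wt (y - x + grad (- t) \<xi>) ^ i * wt (\<xi> - \<eta> - (- t) *\<^sub>R v) ^ j *
          (wt y ^ A * wt \<eta> ^ A * k x \<xi> y \<eta>) \<le>
          C * (wt (x - grad (- t) \<xi>) * wt (\<xi> - (- t) *\<^sub>R v)) ^ A * wt \<xi> ^ ((m - 2) * (i + A))"
        using kernel_bound_polynomial[OF \<phi>(1), of "- t" i j A] unfolding k_def by blast
      define C' where "C' = C * (c1 * c2) ^ A * (1 + R) ^ ((m - 2) * (i + A))"
      have "a l x \<xi> y ^ i * b l \<xi> \<eta> ^ j * Q A l x \<xi> y \<eta> \<le> C' * l powr (\<mu> * real A + s * real i)"
        if l: "l \<ge> 1" and xx: "(x, \<xi>) \<in> U'" for l x \<xi> y \<eta>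
      proof -
        have "a l x \<xi> y ^ i * b l \<xi> \<eta> ^ j * Q A l x \<xi> y \<eta> \<le>
          C * (wt (l *\<^sub>R x - grad (- t) (l powr \<sigma> *\<^sub>R \<xi>)) * wt (l powr \<sigma> *\<^sub>R \<xi> - (- t) *\<^sub>R v)) ^ A * wt (l powr \<sigma> *\<^sub>R \<xi>) ^ ((m - 2) * (i + A))"
          unfolding a_def b_def Q_def by (rule C(2))
        also have "\<dots> \<le> C * ((c1 * l) * (c2 * l powr \<sigma>)) ^ A * ((1 + R) * l powr \<sigma>) ^ ((m - 2) * (i + A))"
          using C(1) cpos l R
          by (intro mult_mono power_mono bx[OF l xx] bxi(1)[OF l xx] bxi(2)[OF l xx] mult_nonneg_nonneg zero_le_power) auto
        also have "\<dots> = C' * ((l powr 1) ^ A * (l powr \<sigma>) ^ A * (l powr \<sigma>) ^ ((m - 2) * (i + A)))"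
          unfolding C'_def using l by (simp add: power_mult_distrib mult_ac)
        also have "(l powr 1) ^ A * (l powr \<sigma>) ^ A * (l powr \<sigma>) ^ ((m - 2) * (i + A)) = l powr (\<mu> * real A + s * real i)"
          unfolding powr_power_nat[OF l] powr_add[symmetric] \<mu>_def s_def of_nat_mult of_nat_add
          by (simp only: algebra_simps mult_1)
        finally show ?thesis .
      qed
      moreover have "C' \<ge> 0" unfolding C'_def using C(1) cpos R by simp
      ultimately show ?thesis by blast
    qed

    \<comment> \<open>If \<open>y / l\<close> is away from \<open>y0\<close>, then \<open>y\<close>
      is at distance of order \<open>l\<close> from the centre of the kernel. For large
      \<open>l\<close> the gradient error is absorbed; for the remaining bounded range the trivial
      bound \<open>1 \<le> a l x \<xi> y\<close> suffices.\<close>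
    have pos_case: "\<exists>c3>0. \<forall>l x \<xi> y. l \<ge> 1 \<longrightarrow> (x, \<xi>) \<in> U' \<longrightarrow> norm ((1 / l) *\<^sub>R y - y0) \<ge> \<epsilon> \<longrightarrow> c3 * l \<le> a l x \<xi> y"
    proof -
      \<comment> \<open>Beyond this size the gradient error \<open>Ca * l powr \<rho>\<close> is at
        most \<open>l * (\<epsilon> / 4)\<close>; here \<open>\<rho> < 1\<close> enters.\<close>
      define l0 where "l0 = 1 + (4 * Ca / \<epsilon>) powr (1 / (1 - \<rho>))"
      have l0: "l0 \<ge> 1" unfolding l0_def by simp
      define c3 where "c3 = min (\<epsilon> / 2) (1 / l0)"
      have "c3 * l \<le> a l x \<xi> y" if l: "l \<ge> 1" and xx: "(x, \<xi>) \<in> U'" and y: "norm ((1 / l) *\<^sub>R y - y0) \<ge> \<epsilon>" for l x \<xi> y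
      proof (cases "Ca * l powr \<rho> \<le> l * (\<epsilon> / 4)")
        case True
        have r: "norm \<xi> \<le> R" "norm (x - B \<xi> - y0) < \<epsilon> / 4" using xx unfolding U'_def by auto
        define g where "g = grad (- t) (l powr \<sigma> *\<^sub>R \<xi>)"
        have eq: "l *\<^sub>R ((1 / l) *\<^sub>R y - y0) = (y - l *\<^sub>R x + g) + (l *\<^sub>R (x - B \<xi> - y0) - (g - l *\<^sub>R B \<xi>))"
          using l by (simp add: algebra_simps)
        have "l * \<epsilon> \<le> norm (l *\<^sub>R ((1 / l) *\<^sub>R y - y0))" using y l by simp
        also have "\<dots> \<le> norm (y - l *\<^sub>R x + g) + (norm (l *\<^sub>R (x - B \<xi> - y0)) + norm (g - l *\<^sub>R B \<xi>))"
          unfolding eq by (intro order_trans[OF norm_triangle_ineq] add_left_mono norm_triangle_ineq4)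
        also have "\<dots> \<le> norm (y - l *\<^sub>R x + g) + (l * (\<epsilon> / 4) + l * (\<epsilon> / 4))"
          using r(2) l Ca(2)[OF l r(1)] True unfolding g_def by (intro add_mono) (auto intro: mult_left_mono)
        finally have "l * (\<epsilon> / 2) \<le> a l x \<xi> y" unfolding a_def wt_def g_def by (simp add: algebra_simps)
        moreover have "c3 * l \<le> (\<epsilon> / 2) * l" using l by (intro mult_right_mono) (auto simp: c3_def)
        ultimately show ?thesis by (simp add: mult.commute)
      next
        case False
        then have "l * (\<epsilon> / 4) < Ca * l powr \<rho>" by simp
        then have "l / l powr \<rho> < 4 * Ca / \<epsilon>" using l eps by (simp add: field_simps)
        then have "l powr (1 - \<rho>) \<le> 4 * Ca / \<epsilon>" using l by (simp add: powr_diff)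
        then have "(l powr (1 - \<rho>)) powr (1 / (1 - \<rho>)) \<le> (4 * Ca / \<epsilon>) powr (1 / (1 - \<rho>))"
          using \<rho> by (intro powr_mono2) auto
        then have "l \<le> l0" using \<rho> l unfolding l0_def by (simp add: powr_powr)
        then have "(1 / l0) * l \<le> 1" using l0 by simp
        moreover have "c3 * l \<le> (1 / l0) * l" using l by (intro mult_right_mono) (auto simp: c3_def)
        moreover have "1 \<le> a l x \<xi> y" by (simp add: a_def)
        ultimately show ?thesis by linarith
      qed
      moreover have "c3 > 0" unfolding c3_def using eps l0 by simp
      ultimately show ?thesis by blast
    qed
    then obtain c3 where c3: "c3 > 0" "\<And>l x \<xi> y. l \<ge> 1 \<Longrightarrow> (x, \<xi>) \<in> U' \<Longrightarrow> norm ((1 / l) *\<^sub>R y - y0) \<ge> \<epsilon> \<Longrightarrow> c3 * l \<le> a l x \<xi> y"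
      by blast

    \<comment> \<open>The frequency displacement \<open>t *\<^sub>R v\<close> does not scale with
      \<open>l\<close>, so it costs only the constant factor
      \<open>wt (t *\<^sub>R v)\<close>.\<close>
    define c4 where "c4 = \<epsilon> / (2 * wt (t *\<^sub>R v))"
    have c40: "c4 > 0" unfolding c4_def using eps by simp
    have c4: "c4 * l powr \<sigma> \<le> b l \<xi> \<eta>"
      if l: "l \<ge> 1" and xx: "(x, \<xi>) \<in> U'" and eta: "norm ((1 / l powr \<sigma>) *\<^sub>R \<eta> - \<xi>0) \<ge> \<epsilon>" for l x \<xi> \<eta>
    proof -
      have r: "norm (\<xi> - \<xi>0) < \<epsilon> / 2" using xx unfolding U'_def by auto
      define L where "L = l powr \<sigma>"
      have L: "L > 0" unfolding L_def using l by simp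
      have "norm ((1 / L) *\<^sub>R \<eta> - \<xi>0) \<le> norm (\<xi> - (1 / L) *\<^sub>R \<eta>) + norm (\<xi> - \<xi>0)"
        using norm_triangle_ineq[of "(1 / L) *\<^sub>R \<eta> - \<xi>" "\<xi> - \<xi>0"] by (simp add: norm_minus_commute)
      then have "\<epsilon> / 2 \<le> norm (\<xi> - (1 / L) *\<^sub>R \<eta>)" using eta r unfolding L_def by linarith
      then have "L * (\<epsilon> / 2) \<le> L * norm (\<xi> - (1 / L) *\<^sub>R \<eta>)" using L by (intro mult_left_mono) auto
      also have "\<dots> = norm (L *\<^sub>R (\<xi> - (1 / L) *\<^sub>R \<eta>))" using L by simp
      also have "L *\<^sub>R (\<xi> - (1 / L) *\<^sub>R \<eta>) = (L *\<^sub>R \<xi> - \<eta> - (- t) *\<^sub>R v) - t *\<^sub>R v" using L by (simp add: algebra_simps)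
      also have "norm \<dots> \<le> wt \<dots>" by (rule norm_le_wt)
      also have "\<dots> \<le> b l \<xi> \<eta> * wt (t *\<^sub>R v)" unfolding b_def L_def by (rule wt_diff_le)
      finally show ?thesis unfolding c4_def L_def by (simp add: field_simps)
    qed

    \<comment> \<open>The power for which \<open>inverse (wt w ^ d)\<close> is integrable over phase
      space.\<close>
    define d where "d = 2 * DIM((real ^ 'n) \<times> (real ^ 'n))"
    have "\<exists>E. \<forall>l x \<xi> y \<eta>. l \<ge> 1 \<longrightarrow> (x, \<xi>) \<in> U' \<longrightarrow> Q d l x \<xi> y \<eta> * V y \<eta> \<le> E * l powr (- N)"
    proof -
      obtain Cu K where Cu: "Cu \<ge> 0" "\<And>y \<eta>. V y \<eta> \<le> Cu * wt y ^ K * wt \<eta> ^ K"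
        using stft_growth[OF u \<phi>(1)] unfolding V_def by blast
      \<comment> \<open>\<open>d\<close> powers for the integration over phase space,
        \<open>K\<close> to absorb the growth of the transform of \<open>u\<close>.\<close>
      define A where "A = d + K"
      \<comment> \<open>The gain \<open>l powr ((1 - s) * i)\<close> in position, and below
        \<open>l powr (\<sigma> * j)\<close> in frequency, must outweigh the cost
        \<open>\<mu> * A\<close> and still leave the requested decay \<open>N\<close>. This is where
        \<open>s < 1\<close> is indispensable.\<close>
      obtain i :: nat where "(N + \<mu> * real A) / (1 - s) \<le> real i" using real_arch_simple by blast
      then have i: "N + \<mu> * real A \<le> (1 - s) * real i" using s by (simp add: field_simps)
      obtain j :: nat where "(N + \<mu> * real A) / \<sigma> \<le> real j" using real_arch_simple by blast
      then have j: "N + \<mu> * real A \<le> \<sigma> * real j" using \<sigma>(1) by (simp add: field_simps)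
      \<comment> \<open>Inside the scaled neighbourhood the kernel is merely bounded by
        \<open>l powr (\<mu> * d)\<close>; the excess is paid for by the decay of the transform of
        \<open>u\<close>.\<close>
      define N' where "N' = N + \<mu> * real d"
      have N': "N' \<ge> 0" unfolding N'_def using N \<mu> by simp
      obtain Ci where Ci: "Ci \<ge> 0" "\<And>l x \<xi> y \<eta>. l \<ge> 1 \<Longrightarrow> (x, \<xi>) \<in> U' \<Longrightarrow>
          a l x \<xi> y ^ i * b l \<xi> \<eta> ^ 0 * Q A l x \<xi> y \<eta> \<le> Ci * l powr (\<mu> * real A + s * real i)"
        using star[of i 0 A] by blast
      obtain Cj where Cj: "Cj \<ge> 0" "\<And>l x \<xi> y \<eta>. l \<ge> 1 \<Longrightarrow> (x, \<xi>) \<in> U' \<Longrightarrow>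
          a l x \<xi> y ^ 0 * b l \<xi> \<eta> ^ j * Q A l x \<xi> y \<eta> \<le> Cj * l powr (\<mu> * real A + s * real 0)"
        using star[of 0 j A] by blast
      obtain Cd where Cd: "Cd \<ge> 0" "\<And>l x \<xi> y \<eta>. l \<ge> 1 \<Longrightarrow> (x, \<xi>) \<in> U' \<Longrightarrow>
          a l x \<xi> y ^ 0 * b l \<xi> \<eta> ^ 0 * Q d l x \<xi> y \<eta> \<le> Cd * l powr (\<mu> * real d + s * real 0)"
        using star[of 0 0 d] by blast
      obtain CU where CU: "\<And>l y \<eta>. (y, \<eta>) \<in> U \<Longrightarrow> l > 0 \<Longrightarrow> l powr N' * V (l *\<^sub>R y) ((l powr \<sigma>) *\<^sub>R \<eta>) \<le> CU"
        using bddU[OF N'] unfolding bdd_above_def by blast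
      have outside: "Q d l x \<xi> y \<eta> * V y \<eta> \<le> Cu * Q A l x \<xi> y \<eta>" for l x \<xi> y \<eta>
      proof -
        have "Q d l x \<xi> y \<eta> * V y \<eta> \<le> Q d l x \<xi> y \<eta> * (Cu * wt y ^ K * wt \<eta> ^ K)"
          by (intro mult_left_mono Cu(2) Q0)
        also have "\<dots> = Cu * Q A l x \<xi> y \<eta>" unfolding Q_def A_def by (simp add: power_add mult_ac)
        finally show ?thesis .
      qed
      have lm: "l powr r \<le> l powr (- N)" if "l \<ge> 1" "r \<le> - N" for l r :: real
        using that by (intro powr_mono) auto
      define E where "E = Cu * (Ci / c3 ^ i) + Cu * (Cj / c4 ^ j) + Cd * \<bar>CU\<bar>"
      have En: "Cu * (Ci / c3 ^ i) \<ge> 0" "Cu * (Cj / c4 ^ j) \<ge> 0" "Cd * \<bar>CU\<bar> \<ge> 0"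
        using Cu(1) Ci(1) Cj(1) Cd(1) c3(1) c40 by auto
      have "Q d l x \<xi> y \<eta> * V y \<eta> \<le> E * l powr (- N)" if l: "l \<ge> 1" and xx: "(x, \<xi>) \<in> U'" for l x \<xi> y \<eta>
      proof -
        \<comment> \<open>Far in position, far in frequency, or inside the scaled \<open>U\<close>:
          the first two cases use kernel decay, the last one the hypothesis on
          \<open>u\<close>.\<close>
        consider "norm ((1 / l) *\<^sub>R y - y0) \<ge> \<epsilon>" | "norm ((1 / l powr \<sigma>) *\<^sub>R \<eta> - \<xi>0) \<ge> \<epsilon>"
          | "norm ((1 / l) *\<^sub>R y - y0) < \<epsilon>" "norm ((1 / l powr \<sigma>) *\<^sub>R \<eta> - \<xi>0) < \<epsilon>" by linarith
        then have "\<exists>E'. Q d l x \<xi> y \<eta> * V y \<eta> \<le> E' * l powr (- N) \<and> E' \<le> E"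
        proof cases
          case 1
          have "(c3 * l) ^ i * Q A l x \<xi> y \<eta> \<le> a l x \<xi> y ^ i * Q A l x \<xi> y \<eta>"
            using c3(2)[OF l xx 1] c3(1) l Q0 by (intro mult_right_mono power_mono) auto
          also have "\<dots> \<le> Ci * l powr (\<mu> * real A + s * real i)" using Ci(2)[OF l xx, of y \<eta>] by simp
          finally have "c3 ^ i * (l powr real i * Q A l x \<xi> y \<eta>) \<le> Ci * l powr (\<mu> * real A + s * real i)"
            using l by (simp add: power_mult_distrib powr_realpow mult_ac)
          then have "Q A l x \<xi> y \<eta> \<le> (Ci / c3 ^ i) * (l powr (\<mu> * real A + s * real i) / l powr real i)"
            using c3(1) l by (simp add: field_simps)
          also have "\<dots> \<le> (Ci / c3 ^ i) * l powr (- N)"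
            unfolding powr_diff[symmetric] using i Ci(1) c3(1) l
            by (intro mult_left_mono lm) (auto simp: algebra_simps)
          finally have "Cu * Q A l x \<xi> y \<eta> \<le> Cu * ((Ci / c3 ^ i) * l powr (- N))" using Cu(1) by (rule mult_left_mono)
          then have "Q d l x \<xi> y \<eta> * V y \<eta> \<le> (Cu * (Ci / c3 ^ i)) * l powr (- N)"
            using outside[of l x \<xi> y \<eta>] by (simp add: mult.assoc)
          then show ?thesis using En by (intro exI[of _ "Cu * (Ci / c3 ^ i)"] conjI) (simp_all add: E_def)
        next
          case 2
          have "(c4 * l powr \<sigma>) ^ j * Q A l x \<xi> y \<eta> \<le> b l \<xi> \<eta> ^ j * Q A l x \<xi> y \<eta>"
            using c4[OF l xx 2] c40 l Q0 by (intro mult_right_mono power_mono) auto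
          also have "\<dots> \<le> Cj * l powr (\<mu> * real A)" using Cj(2)[OF l xx, of y \<eta>] by simp
          finally have "c4 ^ j * (l powr (\<sigma> * real j) * Q A l x \<xi> y \<eta>) \<le> Cj * l powr (\<mu> * real A)"
            by (simp add: power_mult_distrib powr_power_nat[OF l] mult_ac)
          then have "Q A l x \<xi> y \<eta> \<le> (Cj / c4 ^ j) * (l powr (\<mu> * real A) / l powr (\<sigma> * real j))"
            using c40 l by (simp add: field_simps)
          also have "\<dots> \<le> (Cj / c4 ^ j) * l powr (- N)"
            unfolding powr_diff[symmetric] using j Cj(1) c40 l
            by (intro mult_left_mono lm) (auto simp: algebra_simps)
          finally have "Cu * Q A l x \<xi> y \<eta> \<le> Cu * ((Cj / c4 ^ j) * l powr (- N))" using Cu(1) by (rule mult_left_mono)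
          then have "Q d l x \<xi> y \<eta> * V y \<eta> \<le> (Cu * (Cj / c4 ^ j)) * l powr (- N)"
            using outside[of l x \<xi> y \<eta>] by (simp add: mult.assoc)
          then show ?thesis using En by (intro exI[of _ "Cu * (Cj / c4 ^ j)"] conjI) (simp_all add: E_def)
        next
          case 3
          have "l powr N' * V (l *\<^sub>R ((1 / l) *\<^sub>R y)) ((l powr \<sigma>) *\<^sub>R ((1 / l powr \<sigma>) *\<^sub>R \<eta>)) \<le> CU"
            using l by (intro CU inU 3) auto
          then have "l powr N' * V y \<eta> \<le> \<bar>CU\<bar>" using l by simp
          then have VU: "V y \<eta> \<le> \<bar>CU\<bar> * l powr (- N')" using l by (simp add: powr_minus field_simps)
          have "Q d l x \<xi> y \<eta> \<le> Cd * l powr (\<mu> * real d)" using Cd(2)[OF l xx, of y \<eta>] by simp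
          then have "Q d l x \<xi> y \<eta> * V y \<eta> \<le> (Cd * l powr (\<mu> * real d)) * (\<bar>CU\<bar> * l powr (- N'))"
            using VU Cd(1) by (intro mult_mono) (auto simp: V0)
          also have "\<dots> = Cd * \<bar>CU\<bar> * (l powr (\<mu> * real d) * l powr (- N'))" by simp
          also have "l powr (\<mu> * real d) * l powr (- N') = l powr (- N)"
            unfolding powr_add[symmetric] N'_def by simp
          finally show ?thesis using En by (intro exI[of _ "Cd * \<bar>CU\<bar>"] conjI) (simp_all add: E_def)
        qed
        then show ?thesis using mult_right_mono[OF _ powr_ge_zero[of l "- N"]] order_trans by blast
      qed
      then show ?thesis by blast
    qed
    then obtain E where E: "\<And>l x \<xi> y \<eta>. l \<ge> 1 \<Longrightarrow> (x, \<xi>) \<in> U' \<Longrightarrow> Q d l x \<xi> y \<eta> * V y \<eta> \<le> E * l powr (- N)" by blast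

    define I where "I = (\<integral>x. inverse (wt (x :: (real ^ 'n) \<times> (real ^ 'n)) ^ d) \<partial>lborel)"
    define c where "c = (2 * pi) powr (- real CARD('n) / 2)"
    have c: "c \<ge> 0" unfolding c_def by simp
    have nsq: "cmod (norm_sq \<phi>) > 0" using norm_sq_nonzero[OF \<phi>] by simp
    \<comment> \<open>The factor \<open>wt w ^ d\<close> contained in \<open>Q d\<close> turns the
      pointwise bound into a bound for the reproducing integral.\<close>
    have E2: "l powr N * V' (l *\<^sub>R x) ((l powr \<sigma>) *\<^sub>R \<xi>) \<le> c * (E * I) / cmod (norm_sq \<phi>)" if l: "l \<ge> 1" and xx: "(x, \<xi>) \<in> U'" for l x \<xi>
    proof -
      define g where "g = solution_op v q (- t) (tfs \<phi> (l *\<^sub>R x, (l powr \<sigma>) *\<^sub>R \<xi>))"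
      have g: "g \<in> schwartz" unfolding g_def by (intro solution_op_schwartz schwartz_tfs \<phi>(1))
      have "cmod (\<integral>w. cnj (fstft \<phi> g w) * stft \<phi> u (fst w) (snd w) \<partial>lborel) \<le> (E * l powr (- N)) * I"
        unfolding I_def d_def
      proof (rule integral_wt_bound)
        show "(\<lambda>w. cnj (fstft \<phi> g w) * stft \<phi> u (fst w) (snd w)) \<in> borel_measurable borel"
          by (intro borel_measurable_continuous_onI continuous_intros fstft_continuous stft_continuous \<phi>(1) g u)
        fix w :: "(real ^ 'n) \<times> (real ^ 'n)"
        have "wt w ^ d \<le> (wt (fst w) * wt (snd w)) ^ d" by (intro power_mono wt_prod_le) auto
        then have "wt w ^ d * (cmod (fstft \<phi> g w) * V (fst w) (snd w)) \<le> (wt (fst w) * wt (snd w)) ^ d * (cmod (fstft \<phi> g w) * V (fst w) (snd w))"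
          by (intro mult_right_mono mult_nonneg_nonneg V0) auto
        also have "\<dots> = Q d l x \<xi> (fst w) (snd w) * V (fst w) (snd w)"
          unfolding Q_def k_def g_def by (simp add: power_mult_distrib mult_ac)
        also have "\<dots> \<le> E * l powr (- N)" by (rule E[OF l xx])
        finally show "wt w ^ (2 * DIM((real ^ 'n) \<times> (real ^ 'n))) * cmod (cnj (fstft \<phi> g w) * stft \<phi> u (fst w) (snd w)) \<le> E * l powr (- N)"
          unfolding d_def[symmetric] by (simp add: norm_mult V_def)
      qed
      then have "c * cmod (\<integral>w. cnj (fstft \<phi> g w) * stft \<phi> u (fst w) (snd w) \<partial>lborel) \<le> c * ((E * l powr (- N)) * I)"
        using c by (rule mult_left_mono)
      also have "c * cmod (\<integral>w. cnj (fstft \<phi> g w) * stft \<phi> u (fst w) (snd w) \<partial>lborel) = cmod (norm_sq \<phi>) * V' (l *\<^sub>R x) ((l powr \<sigma>) *\<^sub>R \<xi>)"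
        using arg_cong[OF stft_solution_op_dist_reproducing[OF u \<phi>(1), of t "l *\<^sub>R x" "(l powr \<sigma>) *\<^sub>R \<xi>"], of cmod] c
        unfolding g_def[symmetric] V'_def norm_mult norm_of_real c_def by simp
      finally have "cmod (norm_sq \<phi>) * V' (l *\<^sub>R x) ((l powr \<sigma>) *\<^sub>R \<xi>) \<le> c * (E * I) / l powr N"
        by (simp add: powr_minus field_simps)
      then show ?thesis using nsq l by (simp add: field_simps)
    qed
    show ?thesis
    proof (rule bdd_aboveI[of _ "max E1 (c * (E * I) / cmod (norm_sq \<phi>))"])
      fix r assume "r \<in> {l powr N * V' (l *\<^sub>R x) ((l powr \<sigma>) *\<^sub>R \<xi>) | l x \<xi>. (x, \<xi>) \<in> U' \<and> l > 0}"
      then obtain l x \<xi> where r: "r = l powr N * V' (l *\<^sub>R x) ((l powr \<sigma>) *\<^sub>R \<xi>)" "(x, \<xi>) \<in> U'" "l > 0" by blast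
      then show "r \<le> max E1 (c * (E * I) / cmod (norm_sq \<phi>))"
        using E1[OF r(2,3)] E2[OF _ r(2), of l] by (cases "l \<le> 1") (auto simp: max_def)
    qed
  qed
  ultimately show False using z unfolding gabor_WF_def V'_def by blast
qed

section \<open>Asymptotics of the phase gradient on the anisotropic scale\<close>

lemma norm_grad_diff_le: "norm (grad \<tau> \<zeta> - w) \<le> (\<Sum>j\<in>UNIV. \<bar>poly (phase_poly v p \<tau> j) (\<zeta> $ j) - w $ j\<bar>)"
  using norm_le_l1_cart[of "grad \<tau> \<zeta> - w"] by (simp add: grad_def)

text \<open>No restriction to indices of top degree is necessary: \<open>coeff (p j) m\<close> is 0
  for the others.\<close>

definition principal_grad :: "real ^ 'n \<Rightarrow> real ^ 'n" where
  "principal_grad \<xi> = (\<chi> j. real m * coeff (p j) m * (\<xi> $ j) ^ (m - 1))"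

text \<open>At the critical exponent \<open>\<sigma> = 1 / (m - 1)\<close> the leading term of the gradient scales like
  \<open>\<lambda>\<close>; below it, the whole gradient is \<open>o(\<lambda>)\<close>.\<close>

lemma grad_critical:
  assumes \<sigma>: "\<sigma> = 1 / (real m - 1)"
  shows "\<exists>C\<ge>0. \<forall>l\<ge>1. \<forall>\<xi>. norm \<xi> \<le> R \<longrightarrow>
      norm (grad (- t) (l powr \<sigma> *\<^sub>R \<xi>) - l *\<^sub>R (t *\<^sub>R principal_grad \<xi>)) \<le> C * l powr (\<sigma> * real (m - 2))"
proof -
  have s: "\<sigma> > 0" "\<sigma> * real (m - 1) = 1" using m unfolding \<sigma> by (auto simp: of_nat_diff)
  have "\<exists>C. \<forall>j. C j \<ge> 0 \<and> (\<forall>z. \<bar>poly (phase_poly v p (- t) j) z - t * (real m * coeff (p j) m) * z ^ (m - 1)\<bar> \<le> C j * (1 + \<bar>z\<bar>) ^ (m - 2))"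
    by (intro choice allI phase_poly_leading deg m v)
  then obtain C where C: "\<And>j. C j \<ge> 0" "\<And>j z. \<bar>poly (phase_poly v p (- t) j) z - t * (real m * coeff (p j) m) * z ^ (m - 1)\<bar> \<le> C j * (1 + \<bar>z\<bar>) ^ (m - 2)"
    by blast
  define D where "D = (\<Sum>j\<in>UNIV. C j * (1 + \<bar>R\<bar>) ^ (m - 2))"
  have "norm (grad (- t) (l powr \<sigma> *\<^sub>R \<xi>) - l *\<^sub>R (t *\<^sub>R principal_grad \<xi>)) \<le> D * l powr (\<sigma> * real (m - 2))"
    if l: "l \<ge> 1" and r: "norm \<xi> \<le> R" for l \<xi>
  proof -
    have "\<bar>poly (phase_poly v p (- t) j) ((l powr \<sigma> *\<^sub>R \<xi>) $ j) - (l *\<^sub>R (t *\<^sub>R principal_grad \<xi>)) $ j\<bar>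
        \<le> C j * (1 + \<bar>R\<bar>) ^ (m - 2) * l powr (\<sigma> * real (m - 2))" for j
    proof -
      have "((l powr \<sigma> *\<^sub>R \<xi>) $ j) ^ (m - 1) = l * (\<xi> $ j) ^ (m - 1)"
        unfolding vector_scaleR_component real_scaleR_def power_mult_distrib powr_power_nat[OF l] s(2) using l by simp
      then have "(l *\<^sub>R (t *\<^sub>R principal_grad \<xi>)) $ j = t * (real m * coeff (p j) m) * ((l powr \<sigma> *\<^sub>R \<xi>) $ j) ^ (m - 1)"
        by (simp add: principal_grad_def)
      then have "\<bar>poly (phase_poly v p (- t) j) ((l powr \<sigma> *\<^sub>R \<xi>) $ j) - (l *\<^sub>R (t *\<^sub>R principal_grad \<xi>)) $ j\<bar>
          \<le> C j * (1 + \<bar>(l powr \<sigma> *\<^sub>R \<xi>) $ j\<bar>) ^ (m - 2)" using C(2)[of j "(l powr \<sigma> *\<^sub>R \<xi>) $ j"] by (simp only:)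
      also have "\<dots> \<le> C j * ((1 + \<bar>R\<bar>) ^ (m - 2) * l powr (\<sigma> * real (m - 2)))"
        using scaled_abs_le[OF l s(1), of \<xi> "\<bar>R\<bar>"] r by (intro mult_left_mono C(1)) auto
      finally show ?thesis by (simp add: mult.assoc)
    qed
    then show ?thesis unfolding D_def sum_distrib_right
      by (intro order_trans[OF norm_grad_diff_le] sum_mono)
  qed
  moreover have "D \<ge> 0" unfolding D_def by (intro sum_nonneg mult_nonneg_nonneg C(1)) auto
  ultimately show ?thesis by blast
qed

text \<open>Written with \<open>l *\<^sub>R 0\<close> to fit \<open>gabor_WF_step\<close> with
  vanishing \<open>B\<close>. The exponent \<open>\<sigma> * real (m - 1)\<close> is below 1
  precisely when \<sigma> is subcritical.\<close>

lemma grad_subcritical: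
  assumes \<sigma>: "\<sigma> > 0"
  shows "\<exists>C\<ge>0. \<forall>l\<ge>1. \<forall>\<xi>. norm \<xi> \<le> R \<longrightarrow>
      norm (grad (- t) (l powr \<sigma> *\<^sub>R \<xi>) - l *\<^sub>R 0) \<le> C * l powr (\<sigma> * real (m - 1))"
proof -
  have "degree (phase_poly v p (- t) j) \<le> m - 1" for j using deg[of j] m by (intro degree_phase_poly) simp
  then have "\<exists>C. \<forall>j. C j \<ge> 0 \<and> (\<forall>z. \<bar>poly (phase_poly v p (- t) j) z\<bar> \<le> C j * (1 + \<bar>z\<bar>) ^ (m - 1))"
    by (intro choice allI poly_growth)
  then obtain C where C: "\<And>j. C j \<ge> 0" "\<And>j z. \<bar>poly (phase_poly v p (- t) j) z\<bar> \<le> C j * (1 + \<bar>z\<bar>) ^ (m - 1)"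
    by blast
  define D where "D = (\<Sum>j\<in>UNIV. C j * (1 + \<bar>R\<bar>) ^ (m - 1))"
  have "norm (grad (- t) (l powr \<sigma> *\<^sub>R \<xi>) - l *\<^sub>R 0) \<le> D * l powr (\<sigma> * real (m - 1))"
    if l: "l \<ge> 1" and r: "norm \<xi> \<le> R" for l \<xi>
  proof -
    have "\<bar>poly (phase_poly v p (- t) j) ((l powr \<sigma> *\<^sub>R \<xi>) $ j) - (l *\<^sub>R 0) $ j\<bar>
        \<le> C j * (1 + \<bar>R\<bar>) ^ (m - 1) * l powr (\<sigma> * real (m - 1))" for j
    proof -
      have "\<bar>poly (phase_poly v p (- t) j) ((l powr \<sigma> *\<^sub>R \<xi>) $ j) - (l *\<^sub>R (0 :: real ^ 'n)) $ j\<bar>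
          \<le> C j * (1 + \<bar>(l powr \<sigma> *\<^sub>R \<xi>) $ j\<bar>) ^ (m - 1)" using C(2)[of j "(l powr \<sigma> *\<^sub>R \<xi>) $ j"] by simp
      also have "\<dots> \<le> C j * ((1 + \<bar>R\<bar>) ^ (m - 1) * l powr (\<sigma> * real (m - 1)))"
        using scaled_abs_le[OF l \<sigma>, of \<xi> "\<bar>R\<bar>"] r by (intro mult_left_mono C(1)) auto
      finally show ?thesis by (simp add: mult.assoc)
    qed
    then show ?thesis unfolding D_def sum_distrib_right
      by (intro order_trans[OF norm_grad_diff_le] sum_mono)
  qed
  moreover have "D \<ge> 0" unfolding D_def by (intro sum_nonneg mult_nonneg_nonneg C(1)) auto
  ultimately show ?thesis by blast
qed

lemma gradient_principal_part: "gradient (principal_part p m) \<xi> = principal_grad \<xi>"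
proof -
  have D: "(principal_part p m has_derivative (\<lambda>h. \<Sum>j | degree (p j) = m. coeff (p j) m * (real m * (h $ j * (\<xi> $ j) ^ (m - 1))))) (at \<xi>)"
    unfolding principal_part_def[abs_def]
  proof (intro has_derivative_sum has_derivative_mult_right)
    fix j
    show "((\<lambda>\<xi>. (\<xi> $ j) ^ m) has_derivative (\<lambda>h. real m * (h $ j * (\<xi> $ j) ^ (m - 1)))) (at \<xi>)"
      using poly_coord_has_derivative_real[of "monom 1 m" j 0 \<xi>] by (simp add: poly_monom pderiv_monom mult_ac)
  qed
  have "partial_deriv j (principal_part p m) \<xi> = real m * coeff (p j) m * (\<xi> $ j) ^ (m - 1)" for j
  proof -
    have "partial_deriv j (principal_part p m) \<xi> =
        (\<Sum>i | degree (p i) = m. if i = j then coeff (p i) m * (real m * (\<xi> $ i) ^ (m - 1)) else 0)"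
      unfolding has_derivative_partial_deriv[OF D] by (intro sum.cong) (auto simp: axis_def)
    moreover have "degree (p j) \<noteq> m \<Longrightarrow> coeff (p j) m = 0" using deg[of j] by (intro coeff_eq_0) simp
    ultimately show ?thesis by (auto simp: sum.delta)
  qed
  then show ?thesis by (simp add: gradient_def principal_grad_def)
qed

lemma continuous_principal_grad: "continuous_on UNIV (\<lambda>\<xi>. t *\<^sub>R principal_grad \<xi>)"
  unfolding principal_grad_def by (intro continuous_intros continuous_on_vec_lambda)

lemma hamilton_flow_eq: "hamilton_flow (principal_part p m) t (x, \<xi>) = (x + t *\<^sub>R principal_grad \<xi>, \<xi>)"
  by (simp add: hamilton_flow_def gradient_principal_part)

text \<open>Here \<open>m - 1 > 0\<close> matters. It ensures that the flow keeps nonzero points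
  nonzero, as the definition of the wave front set demands.\<close>

lemma principal_grad_0: "principal_grad 0 = 0"
  using m by (simp add: principal_grad_def vec_eq_iff)

section \<open>Propagation at the critical exponent and invariance below it\<close>

lemma gabor_WF_inverse:
  assumes "\<phi> \<in> schwartz"
  shows "gabor_WF \<phi> \<sigma> (solution_op_dist v q (- t) (solution_op_dist v q t u)) = gabor_WF \<phi> \<sigma> u"
  unfolding gabor_WF_def stft_solution_op_dist_inverse[OF assms] ..

theorem gabor_WF_critical:
  assumes u: "u \<in> tempered_distributions" and \<phi>: "\<phi> \<in> schwartz" "\<phi> \<noteq> (\<lambda>x. 0)"
    and \<sigma>: "\<sigma> = 1 / (real m - 1)"
  shows "gabor_WF \<phi> \<sigma> (solution_op_dist v q t u) = hamilton_flow (principal_part p m) t ` gabor_WF \<phi> \<sigma> u"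
proof -
  have s: "\<sigma> > 0" "\<sigma> * real (m - 2) < 1" using m unfolding \<sigma> by (auto simp: of_nat_diff field_simps)
  have step: "(x - t *\<^sub>R principal_grad \<xi>, \<xi>) \<in> gabor_WF \<phi> \<sigma> u"
    if "u \<in> tempered_distributions" "(x, \<xi>) \<in> gabor_WF \<phi> \<sigma> (solution_op_dist v q t u)" for u t x \<xi>
  \<comment> \<open>The error exponent is \<open>\<sigma> * real (m - 2)\<close> too, so
    \<open>s(2)\<close> bounds both the kernel width and the error.\<close>
  proof (rule gabor_WF_step[OF that(1) \<phi> s continuous_principal_grad s(2) grad_critical[OF \<sigma>] that(2)])
    show "(x - t *\<^sub>R principal_grad \<xi>, \<xi>) \<noteq> 0"
      using gabor_WF_nonzero[OF that(2)] by (auto simp: zero_prod_def principal_grad_0)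
  qed
  show ?thesis
  proof (intro equalityI subsetI)
    fix z assume z: "z \<in> gabor_WF \<phi> \<sigma> (solution_op_dist v q t u)"
    obtain x \<xi> where xx: "z = (x, \<xi>)" by (cases z)
    have "z = hamilton_flow (principal_part p m) t (x - t *\<^sub>R principal_grad \<xi>, \<xi>)"
      unfolding hamilton_flow_eq xx by simp
    moreover have "(x - t *\<^sub>R principal_grad \<xi>, \<xi>) \<in> gabor_WF \<phi> \<sigma> u"
      using z unfolding xx by (rule step[OF u])
    ultimately show "z \<in> hamilton_flow (principal_part p m) t ` gabor_WF \<phi> \<sigma> u"
      by (rule image_eqI)
  next
    fix z assume "z \<in> hamilton_flow (principal_part p m) t ` gabor_WF \<phi> \<sigma> u"
    then obtain x \<xi> where xx: "(x, \<xi>) \<in> gabor_WF \<phi> \<sigma> u" "z = (x + t *\<^sub>R principal_grad \<xi>, \<xi>)"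
      by (auto simp: hamilton_flow_eq)
    then have "(x, \<xi>) \<in> gabor_WF \<phi> \<sigma> (solution_op_dist v q (- t) (solution_op_dist v q t u))"
      unfolding gabor_WF_inverse[OF \<phi>(1)] by simp
    \<comment> \<open>The inclusion already proved, for time \<open>- t\<close> and the evolved
      distribution, displaces \<open>x\<close> in the direction of the forward flow.\<close>
    from step[OF solution_op_dist_tempered[OF u] this]
    show "z \<in> gabor_WF \<phi> \<sigma> (solution_op_dist v q t u)" unfolding xx(2) by simp
  qed
qed

theorem gabor_WF_subcritical:
  assumes u: "u \<in> tempered_distributions" and \<phi>: "\<phi> \<in> schwartz" "\<phi> \<noteq> (\<lambda>x. 0)"
    and \<sigma>: "0 < \<sigma>" "\<sigma> < 1 / (real m - 1)"
  shows "gabor_WF \<phi> \<sigma> (solution_op_dist v q t u) = gabor_WF \<phi> \<sigma> u"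
proof -
  have s1: "\<sigma> * real (m - 1) < 1" using m \<sigma> by (simp add: of_nat_diff field_simps)
  have "\<sigma> * real (m - 2) \<le> \<sigma> * real (m - 1)" using \<sigma>(1) by (intro mult_left_mono) auto
  then have s: "\<sigma> * real (m - 2) < 1" using s1 by simp
  have step: "(x, \<xi>) \<in> gabor_WF \<phi> \<sigma> u"
    if "u \<in> tempered_distributions" "(x, \<xi>) \<in> gabor_WF \<phi> \<sigma> (solution_op_dist v q t u)" for u t x \<xi>
    \<comment> \<open>With \<open>B = 0\<close> the whole gradient is the error, of exponent
      \<open>\<sigma> * real (m - 1)\<close>, and \<open>s1\<close> says that it is below 1.\<close>
    using gabor_WF_step[OF that(1) \<phi> \<sigma>(1) s continuous_on_const s1 grad_subcritical[OF \<sigma>(1)] that(2)]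
      gabor_WF_nonzero[OF that(2)] by simp
  show ?thesis
  proof (intro equalityI subsetI)
    fix z assume "z \<in> gabor_WF \<phi> \<sigma> (solution_op_dist v q t u)"
    then show "z \<in> gabor_WF \<phi> \<sigma> u" using step[OF u] by (cases z) auto
  next
    fix z assume "z \<in> gabor_WF \<phi> \<sigma> u"
    then have "z \<in> gabor_WF \<phi> \<sigma> (solution_op_dist v q (- t) (solution_op_dist v q t u))"
      unfolding gabor_WF_inverse[OF \<phi>(1)] .
    then show "z \<in> gabor_WF \<phi> \<sigma> (solution_op_dist v q t u)"
      using step[OF solution_op_dist_tempered[OF u]] by (cases z) auto
  qed
qed

end

theorem theorem5p1:
  fixes v :: "real ^ 'n::finite"
    and p q :: "'n \<Rightarrow> real poly"
    and m :: nat
    and \<phi> :: "real ^ 'n \<Rightarrow> complex"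
  assumes "\<forall>j. v $ j \<noteq> 0"
    and "\<forall>j. p j \<noteq> 0"
    and "m = Max (range (\<lambda>j. degree (p j)))"
    and "m \<ge> 2"
    and "\<forall>j. pderiv (q j) = p j"
    and "\<phi> \<in> schwartz" and "\<phi> \<noteq> (\<lambda>x. 0)"
  shows "(\<forall>t. \<forall>u\<in>tempered_distributions. \<forall>\<sigma>. \<sigma> = 1 / (real m - 1) \<longrightarrow>
            gabor_WF \<phi> \<sigma> (solution_op_dist v q t u) =
              hamilton_flow (principal_part p m) t ` gabor_WF \<phi> \<sigma> u) \<and>
         (\<forall>t. \<forall>u\<in>tempered_distributions. \<forall>\<sigma>. 0 < \<sigma> \<and> \<sigma> < 1 / (real m - 1) \<longrightarrow>
            gabor_WF \<phi> \<sigma> (solution_op_dist v q t u) = gabor_WF \<phi> \<sigma> u)"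
proof -
  interpret evolution v p q m
  proof
    show "degree (p j) \<le> m" for j unfolding assms(3) by (rule Max_ge) auto
  qed (use assms in auto)
  show ?thesis
    using gabor_WF_critical gabor_WF_subcritical assms(6,7) by blast
qed

end
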